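(* Let $F\colon\Sigma_k\times\mathbb S^1\to\Sigma_k\times\mathbb S^1$ be a transitive step skew-product map whose fiber maps are $C^1$ diffeomorphisms of $\mathbb S^1$, and assume that $F$ satisfies Axioms CEC$\pm$ and Acc$\pm$. Then $$h_{\rm top}(F)=\sup_{\mu\in\mathscr M_{\rm erg,<0}}h(\mu)=\sup_{\mu\in\mathscr M_{\rm erg,>0}}h(\mu).$$
   Context: Setting. Let $k\ge 2$, let $\Sigma_k=\{0,\dots,k-1\}^{\mathbb Z}$ with the left shift $\sigma$, and $\mathbb S^1=\mathbb R/\mathbb Z$. Given $C^1$ diffeomorphisms $f_0,\dots,f_{k-1}$ of $\mathbb S^1$ (the fiber maps), the associated step skew-product is $F(\xi,x)=(\sigma(\xi),f_{\xi_0}(x))$. $F$ is transitive if for all nonempty open $U,V\subset\Sigma_k\times\mathbb S^1$ there is $n\ge1$ with $F^n(U)\cap V\neq\emptyset$. For a finite word put $f_{[\xi_0\ldots\xi_n]}=f_{\xi_n}\circ\cdots\circ f_{\xi_0}$. $|H|$ is the length of an interval $H\subset\mathbb S^1$, and $B(J,r)$ is the open $r$-neighborhood of $J$. Axioms, for a nondegenerate closed interval $J\subset\mathbb S^1$. CEC$+(J)$: there are positive constants $K_1,\dots,K_5$ such that for every interval $H\subset\mathbb S^1$ intersecting $J$ with $|H|<K_1$ there is a finite word $(\eta_0\ldots\eta_{\ell-1})$, with $\ell$ a positive integer, $\ell\le K_2\,|\log|H||+K_3$, such that $f_{[\eta_0\ldots\eta_{\ell-1}]}(H)\supset B(J,K_4)$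 and $\log|(f_{[\eta_0\ldots\eta_{\ell-1}]})'(x)|\ge \ell K_5$ for every $x\in H$. CEC$-(J)$: CEC$+(J)$ holds for the family $\{f_i^{-1}\}$ in place of $\{f_i\}$. Acc$+(J)$: every point of $\mathbb S^1$ lies in $f_{[\theta_0\ldots\theta_{n-1}]}(\operatorname{int}J)$ for some finite word ($n\ge 0$; the empty word gives the identity). Acc$-(J)$: Acc$+(J)$ holds for the family $\{f_i^{-1}\}$. $F$ satisfies Axioms CEC$\pm$ and Acc$\pm$ if there is a closed interval $J$ for which CEC$+(J)$, CEC$-(J)$, Acc$+(J)$, Acc$-(J)$ all hold. Measures. The fiber Lyapunov exponent of an $F$-invariant probability measure is $\chi(\mu)=\int\log|(f_{\xi_0})'(x)|\,d\mu(\xi,x)$. $\mathscr M_{\rm erg,<0}$ (respectively $\mathscr M_{\rm erg,>0}$) is the set of ergodic $F$-invariant Borel probability measures with $\chi(\mu)<0$ (respectively $\chi(\mu)>0$). $h(\mu)$ is the metric entropy and $h_{\rm top}(F)$ the topological entropy of $F$ on $\Sigma_k\times\mathbb S^1$. *)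

theory Defs
  imports "HOL-Probability.Probability"
begin

quotient_type circle = real / "\<lambda>x y::real. x - y \<in> \<int>"
  morphisms rep_circle to_circle
proof (rule equivpI)
  show "reflp (\<lambda>x y::real. x - y \<in> \<int>)"
    by (simp add: reflp_def)
  show "symp (\<lambda>x y::real. x - y \<in> \<int>)"
  proof (rule sympI)
    fix x y :: real
    assume "x - y \<in> \<int>"
    then have "- (x - y) \<in> \<int>" by (rule Ints_minus)
    then show "y - x \<in> \<int>" by simp
  qed
  show "transp (\<lambda>x y::real. x - y \<in> \<int>)"
  proof (rule transpI)
    fix x y z :: real
    assume "x - y \<in> \<int>" "y - z \<in> \<int>"
    then have "(x - y) + (y - z) \<in> \<int>" by (rule Ints_add)
    then show "x - z \<in> \<int>" by simp
  qed
qed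

lemma to_circle_eq_iff: "to_circle x = to_circle y \<longleftrightarrow> x - y \<in> \<int>"
  using circle.abs_eq_iff by simp

lemma to_circle_surj: "\<exists>t. to_circle t = p"
  by (induct p rule: circle.abs_induct) auto

lemma closed_Ints_real: "closed (\<int>::real set)"
  unfolding Ints_def by (rule closed_of_int_image)

lemma Ints_real_nonempty: "(\<int>::real set) \<noteq> {}"
  using Ints_0 by blast

lemma infdist_Ints_attained:
  fixes x :: real
  shows "\<exists>n\<in>\<int>. infdist x \<int> = \<bar>x - n\<bar>"
  using infdist_attains_inf[OF closed_Ints_real Ints_real_nonempty, of x]
  unfolding dist_real_def by blast

lemma infdist_Ints_le:
  fixes x :: real
  shows "n \<in> \<int> \<Longrightarrow> infdist x \<int> \<le> \<bar>x - n\<bar>"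
  using infdist_le[of n "\<int>" x] by (simp add: dist_real_def)

lemma infdist_Ints_shift:
  fixes x y :: real
  assumes "x - y \<in> \<int>"
  shows "infdist x \<int> = infdist y \<int>"
proof -
  have *: "infdist u \<int> \<le> infdist v \<int>" if uv: "u - v \<in> \<int>" for u v :: real
  proof -
    obtain n where n: "n \<in> \<int>" "infdist v \<int> = \<bar>v - n\<bar>"
      using infdist_Ints_attained by blast
    have "n + (u - v) \<in> \<int>" using n uv by simp
    then have "infdist u \<int> \<le> \<bar>u - (n + (u - v))\<bar>" by (rule infdist_Ints_le)
    then show ?thesis using n by simp
  qed
  have "y - x \<in> \<int>" using Ints_minus[OF assms] by simp
  from *[OF assms] *[OF this] show ?thesis by (rule antisym)
qed

instantiation circle :: metric_space
begin

lift_definition dist_circle :: "circle \<Rightarrow> circle \<Rightarrow> real"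
  is "\<lambda>x y. infdist (x - y) \<int>"
proof -
  fix x x' y y' :: real
  assume "x - x' \<in> \<int>" "y - y' \<in> \<int>"
  then have "(x - x') - (y - y') \<in> \<int>" by (rule Ints_diff)
  then have "(x - y) - (x' - y') \<in> \<int>" by (simp add: algebra_simps)
  then show "infdist (x - y) \<int> = infdist (x' - y') \<int>" by (rule infdist_Ints_shift)
qed

definition uniformity_circle :: "(circle \<times> circle) filter"
  where "uniformity_circle = (INF e\<in>{0<..}. principal {(x, y). dist x y < e})"

definition open_circle :: "circle set \<Rightarrow> bool"
  where "open_circle U \<longleftrightarrow> (\<forall>x\<in>U. eventually (\<lambda>(x', y). x' = x \<longrightarrow> y \<in> U) uniformity)"

instance
proof
  show "uniformity = (INF e\<in>{0<..}. principal {(x, y::circle). dist x y < e})"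
    by (rule uniformity_circle_def)
  show "open U \<longleftrightarrow> (\<forall>x\<in>U. eventually (\<lambda>(x', y). x' = x \<longrightarrow> y \<in> U) uniformity)"
    for U :: "circle set"
    by (rule open_circle_def)
  show "dist p q = 0 \<longleftrightarrow> p = q" for p q :: circle
  proof (transfer)
    fix x y :: real
    show "infdist (x - y) \<int> = 0 \<longleftrightarrow> x - y \<in> \<int>"
      using in_closed_iff_infdist_zero[OF closed_Ints_real Ints_real_nonempty] by simp
  qed
  show "dist p q \<le> dist p r + dist q r" for p q r :: circle
  proof (transfer)
    fix x y z :: real
    obtain m where m: "m \<in> \<int>" "infdist (x - z) \<int> = \<bar>x - z - m\<bar>"
      using infdist_Ints_attained by blast
    obtain n where n: "n \<in> \<int>" "infdist (y - z) \<int> = \<bar>y - z - n\<bar>"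
      using infdist_Ints_attained by blast
    have "infdist (x - y) \<int> \<le> \<bar>x - y - (m - n)\<bar>"
      using m n by (intro infdist_Ints_le) simp
    then show "infdist (x - y) \<int> \<le> infdist (x - z) \<int> + infdist (y - z) \<int>"
      using m n by linarith
  qed
qed

end

lemma dist_to_circle: "dist (to_circle x) (to_circle y) = infdist (x - y) \<int>"
  by (rule dist_circle.abs_eq)

lemma dist_to_circle_le: "dist (to_circle x) (to_circle y) \<le> \<bar>x - y\<bar>"
  using infdist_Ints_le[of 0 "x - y"] by (simp add: dist_to_circle)

text \<open>The metric induces the quotient topology.\<close>

lemma open_circle_iff: "open U \<longleftrightarrow> open (to_circle -` U)"
proof
  assume U: "open U"
  show "open (to_circle -` U)"
    unfolding open_dist
  proof
    fix x assume "x \<in> to_circle -` U"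
    then obtain e where e: "e > 0" "\<And>q. dist q (to_circle x) < e \<Longrightarrow> q \<in> U"
      using U unfolding open_dist by auto
    have "to_circle y \<in> U" if "dist y x < e" for y
      using that dist_to_circle_le[of y x] by (intro e(2)) (simp add: dist_real_def)
    with e(1) show "\<exists>e>0. \<forall>y. dist y x < e \<longrightarrow> y \<in> to_circle -` U"
      by auto
  qed
next
  assume U: "open (to_circle -` U)"
  show "open U"
    unfolding open_dist
  proof
    fix p assume p: "p \<in> U"
    obtain x where x: "to_circle x = p" using to_circle_surj by blast
    then obtain e where e: "e > 0" "\<And>y. dist y x < e \<Longrightarrow> to_circle y \<in> U"
      using U p unfolding open_dist by auto
    have "q \<in> U" if q: "dist q p < e" for q
    proof -
      obtain y where y: "to_circle y = q" using to_circle_surj by blast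
      obtain n where n: "n \<in> \<int>" "infdist (y - x) \<int> = \<bar>y - x - n\<bar>"
        using infdist_Ints_attained by blast
      have "dist (y - n) x < e"
        using q n unfolding x[symmetric] y[symmetric] dist_to_circle dist_real_def
        by (simp add: algebra_simps)
      then have "to_circle (y - n) \<in> U" by (rule e)
      moreover have "to_circle (y - n) = q"
        using n y by (auto simp: to_circle_eq_iff)
      ultimately show ?thesis by simp
    qed
    with e show "\<exists>e>0. \<forall>q. dist q p < e \<longrightarrow> q \<in> U" by blast
  qed
qed

text \<open>Nondegenerate intervals, with or without either endpoint, other than the whole circle
  and the circle minus one point.\<close>

definition circle_interval :: "circle set \<Rightarrow> bool" where
  "circle_interval H \<longleftrightarrow>
     (\<exists>a b I. a < b \<and> b < a + 1 \<and> {a<..<b} \<subseteq> I \<and> I \<subseteq> {a..b} \<and> H = to_circle ` I)"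

definition closed_circle_interval :: "circle set \<Rightarrow> bool" where
  "closed_circle_interval J \<longleftrightarrow> (\<exists>a b. a < b \<and> b < a + 1 \<and> J = to_circle ` {a..b})"

definition circle_length :: "circle set \<Rightarrow> real" where
  "circle_length H = measure lborel ({0..<1} \<inter> to_circle -` H)"

lemma circle_length_interval:
  assumes ab: "a < b" "b < a + 1" and I: "{a<..<b} \<subseteq> I" "I \<subseteq> {a..b}"
  shows "circle_length (to_circle ` I) = b - a"
proof -
  define n where "n = real_of_int \<lfloor>a\<rfloor>"
  have n: "n \<in> \<int>" "n \<le> a" "a < n + 1" unfolding n_def by auto
  have Ieq: "I = {a<..<b} \<union> (I \<inter> {a, b})" using I by fastforce
  have "{a<..<b} \<union> (I \<inter> {a, b}) \<in> sets borel"
    by (intro sets.Un borel_open finite_imp_closed[THEN borel_closed]) auto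
  then have bI: "I \<in> sets borel" using Ieq by simp
  have lm: "S \<in> lmeasurable" if "S \<in> sets borel" "S \<subseteq> I" for S
  proof -
    have "bounded S" using that(2) I(2) by (meson bounded_closed_interval bounded_subset)
    then show ?thesis using that(1) by (intro bounded_set_imp_lmeasurable) auto
  qed
  define L where "L = I \<inter> {..<n+1}"
  define R where "R = I \<inter> {n+1..}"
  have bL: "L \<in> sets borel" and bR: "R \<in> sets borel"
    using bI unfolding L_def R_def by auto
  have lL: "L \<in> lmeasurable" and lR: "R \<in> lmeasurable"
    using bL bR by (auto intro!: lm simp: L_def R_def)
  have S: "{0..<1} \<inter> to_circle -` (to_circle ` I) = (+) (-n) ` L \<union> (+) (-(n+1)) ` R"
    (is "?S = ?A \<union> ?B")
  proof
    show "?S \<subseteq> ?A \<union> ?B"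
    proof
      fix x assume "x \<in> ?S"
      then obtain y where x: "0 \<le> x" "x < 1" and y: "y \<in> I" "x - y \<in> \<int>"
        by (auto simp: to_circle_eq_iff)
      obtain m where m: "x - y - (-n) = real_of_int m" using y n by (metis Ints_cases Ints_diff Ints_minus)
      have "a \<le> y" "y \<le> b" using y I by auto
      then have "-2 < real_of_int m" "real_of_int m < 1" using m x n ab by linarith+
      then consider "m = 0" | "m = -1" by linarith
      then show "x \<in> ?A \<union> ?B"
      proof cases
        case 1
        then have "y = x + n" using m by simp
        then have "x = -n + y" "y \<in> L" using y x by (auto simp: L_def)
        then show ?thesis by blast
      next
        case 2
        then have "y = x + n + 1" using m by simp
        then have "x = -(n+1) + y" "y \<in> R" using y x by (auto simp: R_def)
        then show ?thesis by blast
      qed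
    qed
    have "-n + y \<in> ?S" if "y \<in> L" for y
    proof -
      have "y \<in> I" "y < n + 1" "a \<le> y" using that I by (auto simp: L_def)
      moreover have "to_circle (-n + y) = to_circle y" using n by (simp add: to_circle_eq_iff)
      ultimately show ?thesis using n by auto
    qed
    moreover have "-(n+1) + y \<in> ?S" if "y \<in> R" for y
    proof -
      have "y \<in> I" "n + 1 \<le> y" "y \<le> b" using that I by (auto simp: R_def)
      moreover have "-(n+1) + y - y \<in> \<int>" using Ints_minus[OF Ints_add[OF n(1) Ints_1]] by simp
      then have "to_circle (-(n+1) + y) = to_circle y" by (simp only: to_circle_eq_iff)
      ultimately show ?thesis using n ab by auto
    qed
    ultimately show "?A \<union> ?B \<subseteq> ?S" by blast
  qed
  have disj: "?A \<inter> ?B = {}"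
  proof -
    have False if "y \<in> L" "z \<in> R" "-n + y = -(n+1) + z" for y z
    proof -
      have "a \<le> y" "z \<le> b" using that I by (auto simp: L_def R_def)
      with that(3) ab show False by linarith
    qed
    then show ?thesis by blast
  qed
  have "(\<lambda>x. n + x) -` L \<in> sets borel" "(\<lambda>x. (n+1) + x) -` R \<in> sets borel"
    using measurable_sets[of "\<lambda>x. n + x" borel borel L] measurable_sets[of "\<lambda>x. (n+1) + x" borel borel R] bL bR
    by auto
  moreover have "?A = (\<lambda>x. n + x) -` L" "?B = (\<lambda>x. (n+1) + x) -` R"
    by (auto simp: image_iff intro!: bexI[rotated])
  ultimately have bA: "?A \<in> sets borel" and bB: "?B \<in> sets borel" by simp_all
  have lA: "?A \<in> lmeasurable" and lB: "?B \<in> lmeasurable"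
    using lL lR by (simp_all only: measurable_translation)
  have "circle_length (to_circle ` I) = measure lebesgue (?A \<union> ?B)"
    unfolding circle_length_def S using bA bB by (simp add: measure_completion)
  also have "\<dots> = measure lebesgue ?A + measure lebesgue ?B"
    using measure_Un2[OF lA lB] disj by (simp add: Diff_triv Int_commute)
  also have "\<dots> = measure lebesgue L + measure lebesgue R"
    by (simp only: measure_translation)
  also have "\<dots> = measure lebesgue (L \<union> R)"
  proof -
    have "R - L = R" unfolding L_def R_def by auto
    then show ?thesis using measure_Un2[OF lL lR] by simp
  qed
  also have "L \<union> R = I" unfolding L_def R_def by auto
  also have "measure lebesgue I = b - a"
  proof (rule antisym)
    have "measure lebesgue I \<le> measure lebesgue {a..b}"
      using I bI by (intro measure_mono_fmeasurable) auto
    then show "measure lebesgue I \<le> b - a" using ab by simp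
    have "measure lebesgue {a<..<b} \<le> measure lebesgue I"
      using I bI lm[OF bI] by (intro measure_mono_fmeasurable) auto
    then show "b - a \<le> measure lebesgue I" using ab by simp
  qed
  finally show ?thesis .
qed

definition nbhd :: "circle set \<Rightarrow> real \<Rightarrow> circle set" where
  "nbhd J r = (\<Union>x\<in>J. ball x r)"

text \<open>Differentiability in the charts given by local inverses of \<^const>\<open>to_circle\<close>;
  \<open>\<phi>\<close> is a local lift of \<open>f\<close> near \<open>t\<close>.\<close>

definition has_circle_derivative :: "(circle \<Rightarrow> circle) \<Rightarrow> real \<Rightarrow> circle \<Rightarrow> bool" where
  "has_circle_derivative f d p \<longleftrightarrow>
     (\<exists>t \<phi>. to_circle t = p \<and> (\<forall>\<^sub>F s in nhds t. f (to_circle s) = to_circle (\<phi> s)) \<and>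
            (\<phi> has_real_derivative d) (at t))"

definition circle_deriv :: "(circle \<Rightarrow> circle) \<Rightarrow> circle \<Rightarrow> real" where
  "circle_deriv f p = (THE d. has_circle_derivative f d p)"

definition circle_C1 :: "(circle \<Rightarrow> circle) \<Rightarrow> bool" where
  "circle_C1 f \<longleftrightarrow> (\<exists>f'. continuous_on UNIV f' \<and> (\<forall>p. has_circle_derivative f (f' p) p))"

definition circle_C1_diffeo :: "(circle \<Rightarrow> circle) \<Rightarrow> bool" where
  "circle_C1_diffeo f \<longleftrightarrow> bij f \<and> circle_C1 f \<and> circle_C1 (inv f)"

lemma has_circle_derivative_unique:
  assumes "has_circle_derivative f d p" "has_circle_derivative f d' p"
  shows "d = d'"
proof -
  obtain t \<phi> where t: "to_circle t = p" "\<forall>\<^sub>F s in nhds t. f (to_circle s) = to_circle (\<phi> s)"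
      "(\<phi> has_real_derivative d) (at t)"
    using assms(1) unfolding has_circle_derivative_def by blast
  obtain u \<psi> where u: "to_circle u = p" "\<forall>\<^sub>F s in nhds u. f (to_circle s) = to_circle (\<psi> s)"
      "(\<psi> has_real_derivative d') (at u)"
    using assms(2) unfolding has_circle_derivative_def by blast
  define n where "n = u - t"
  have n: "n \<in> \<int>" using t(1) u(1) unfolding n_def by (simp flip: to_circle_eq_iff)
  have sh: "to_circle (s + n) = to_circle s" for s
    using n by (simp add: to_circle_eq_iff)
  define \<psi>' where "\<psi>' = (\<lambda>s. \<psi> (s + n))"
  have flim: "filterlim (\<lambda>s. s + n) (nhds u) (nhds t)"
    using tendsto_add[OF filterlim_ident tendsto_const[of n], of t] by (simp add: n_def)
  have e2: "\<forall>\<^sub>F s in nhds t. f (to_circle s) = to_circle (\<psi>' s)"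
    using eventually_compose_filterlim[OF u(2) flim] by (simp add: sh \<psi>'_def)
  have d2: "(\<psi>' has_real_derivative d') (at t)"
    using u(3) DERIV_shift[of \<psi> d' t n] unfolding \<psi>'_def by (simp add: n_def)
  define g where "g = (\<lambda>s. \<phi> s - \<psi>' s)"
  have gd: "(g has_real_derivative (d - d')) (at t)"
    unfolding g_def by (intro DERIV_diff t d2)
  have gi: "\<forall>\<^sub>F s in nhds t. g s \<in> \<int>"
    using t(2) e2 by eventually_elim (simp add: g_def flip: to_circle_eq_iff)
  have "isCont g t" using gd by (rule DERIV_isCont)
  then have "(g \<longlongrightarrow> g t) (nhds t)" by (simp add: isCont_def tendsto_at_iff_tendsto_nhds)
  then have "\<forall>\<^sub>F s in nhds t. dist (g s) (g t) < 1"
    by (rule tendstoD) simp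
  then have "\<forall>\<^sub>F s in nhds t. g s = g t"
    using gi
  proof eventually_elim
    case (elim s)
    have "g t \<in> \<int>" using gi by (rule eventually_nhds_x_imp_x)
    have "g s - g t \<in> \<int>" using elim(2) \<open>g t \<in> \<int>\<close> by (rule Ints_diff)
    then show ?case using elim(1) Ints_nonzero_abs_less1[of "g s - g t"] by (simp add: dist_real_def)
  qed
  then have "(g has_real_derivative 0) (at t)"
    using DERIV_cong_ev[of t t g "\<lambda>_. g t" 0 0] by simp
  with gd have "d - d' = 0" by (rule DERIV_unique)
  then show ?thesis by simp
qed

lemma circle_deriv_eqI: "has_circle_derivative f d p \<Longrightarrow> circle_deriv f p = d"
  unfolding circle_deriv_def using has_circle_derivative_unique by blast

definition shift :: "(int \<Rightarrow> nat) \<Rightarrow> (int \<Rightarrow> nat)" where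
  "shift \<xi> = (\<lambda>i. \<xi> (i + 1))"

definition full_shift :: "nat \<Rightarrow> (int \<Rightarrow> nat) set" where
  "full_shift k = {\<xi>. \<forall>i. \<xi> i < k}"

definition skew_space :: "nat \<Rightarrow> ((int \<Rightarrow> nat) \<times> circle) set" where
  "skew_space k = full_shift k \<times> UNIV"

definition skew_product ::
    "(nat \<Rightarrow> circle \<Rightarrow> circle) \<Rightarrow> (int \<Rightarrow> nat) \<times> circle \<Rightarrow> (int \<Rightarrow> nat) \<times> circle" where
  "skew_product f = (\<lambda>(\<xi>, x). (shift \<xi>, f (\<xi> 0) x))"

definition transitive_on :: "'a::topological_space set \<Rightarrow> ('a \<Rightarrow> 'a) \<Rightarrow> bool" where
  "transitive_on X T \<longleftrightarrow>
     (\<forall>U V. openin (top_of_set X) U \<and> U \<noteq> {} \<and> openin (top_of_set X) V \<and> V \<noteq> {} \<longrightarrow>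
        (\<exists>n\<ge>1. (T ^^ n) ` U \<inter> V \<noteq> {}))"

text \<open>For a word \<open>w = [\<xi>\<^sub>0, \<dots>, \<xi>\<^sub>n]\<close> the composition \<open>f \<xi>\<^sub>n \<circ> \<dots> \<circ> f \<xi>\<^sub>0\<close> is \<open>fold f w\<close>.\<close>

definition CEC_plus :: "nat \<Rightarrow> (nat \<Rightarrow> circle \<Rightarrow> circle) \<Rightarrow> circle set \<Rightarrow> bool" where
  "CEC_plus k f J \<longleftrightarrow>
     (\<exists>K1 K2 K3 K4 K5::real. K1 > 0 \<and> K2 > 0 \<and> K3 > 0 \<and> K4 > 0 \<and> K5 > 0 \<and>
       (\<forall>H. circle_interval H \<and> H \<inter> J \<noteq> {} \<and> circle_length H < K1 \<longrightarrow>
         (\<exists>w. w \<noteq> [] \<and> set w \<subseteq> {..<k} \<and>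
              real (length w) \<le> K2 * \<bar>ln (circle_length H)\<bar> + K3 \<and>
              nbhd J K4 \<subseteq> fold f w ` H \<and>
              (\<forall>x\<in>H. ln \<bar>circle_deriv (fold f w) x\<bar> \<ge> real (length w) * K5))))"

definition CEC_minus :: "nat \<Rightarrow> (nat \<Rightarrow> circle \<Rightarrow> circle) \<Rightarrow> circle set \<Rightarrow> bool" where
  "CEC_minus k f J \<longleftrightarrow> CEC_plus k (\<lambda>i. inv (f i)) J"

definition Acc_plus :: "nat \<Rightarrow> (nat \<Rightarrow> circle \<Rightarrow> circle) \<Rightarrow> circle set \<Rightarrow> bool" where
  "Acc_plus k f J \<longleftrightarrow> (\<forall>x. \<exists>w. set w \<subseteq> {..<k} \<and> x \<in> fold f w ` interior J)"

definition Acc_minus :: "nat \<Rightarrow> (nat \<Rightarrow> circle \<Rightarrow> circle) \<Rightarrow> circle set \<Rightarrow> bool" where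
  "Acc_minus k f J \<longleftrightarrow> Acc_plus k (\<lambda>i. inv (f i)) J"

definition axioms_CEC_Acc :: "nat \<Rightarrow> (nat \<Rightarrow> circle \<Rightarrow> circle) \<Rightarrow> bool" where
  "axioms_CEC_Acc k f \<longleftrightarrow>
     (\<exists>J. closed_circle_interval J \<and>
          CEC_plus k f J \<and> CEC_minus k f J \<and> Acc_plus k f J \<and> Acc_minus k f J)"

definition ergodic_measures :: "'a::topological_space set \<Rightarrow> ('a \<Rightarrow> 'a) \<Rightarrow> 'a measure set" where
  "ergodic_measures X T =
     {\<mu>. prob_space \<mu> \<and> space \<mu> = X \<and> sets \<mu> = sets (restrict_space borel X) \<and>
         T \<in> measurable \<mu> \<mu> \<and> distr \<mu> \<mu> T = \<mu> \<and>
         (\<forall>A\<in>sets \<mu>. T -` A \<inter> X = A \<longrightarrow> measure \<mu> A = 0 \<or> measure \<mu> A = 1)}"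

definition fiber_exponent ::
    "(nat \<Rightarrow> circle \<Rightarrow> circle) \<Rightarrow> ((int \<Rightarrow> nat) \<times> circle) measure \<Rightarrow> real" where
  "fiber_exponent f \<mu> = (\<integral>(\<xi>, x). ln \<bar>circle_deriv (f (\<xi> 0)) x\<bar> \<partial>\<mu>)"

definition ergodic_neg ::
    "nat \<Rightarrow> (nat \<Rightarrow> circle \<Rightarrow> circle) \<Rightarrow> ((int \<Rightarrow> nat) \<times> circle) measure set" where
  "ergodic_neg k f =
     {\<mu> \<in> ergodic_measures (skew_space k) (skew_product f). fiber_exponent f \<mu> < 0}"

definition ergodic_pos ::
    "nat \<Rightarrow> (nat \<Rightarrow> circle \<Rightarrow> circle) \<Rightarrow> ((int \<Rightarrow> nat) \<times> circle) measure set" where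
  "ergodic_pos k f =
     {\<mu> \<in> ergodic_measures (skew_space k) (skew_product f). fiber_exponent f \<mu> > 0}"

definition partition_entropy :: "'a measure \<Rightarrow> 'a set set \<Rightarrow> real" where
  "partition_entropy \<mu> P = - (\<Sum>A\<in>P. measure \<mu> A * ln (measure \<mu> A))"

text \<open>The join of the preimages of \<open>P\<close> under \<open>T\<^sup>i\<close> for \<open>i < n\<close>. It may contain the empty set,
  which contributes nothing to \<^const>\<open>partition_entropy\<close>.\<close>

definition dynamical_join :: "'a set \<Rightarrow> ('a \<Rightarrow> 'a) \<Rightarrow> 'a set set \<Rightarrow> nat \<Rightarrow> 'a set set" where
  "dynamical_join X T P n =
     {{x \<in> X. \<forall>i<n. (T ^^ i) x \<in> A i} | A. A \<in> {..<n} \<rightarrow> P}"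

text \<open>For invariant \<open>\<mu>\<close> the upper limit is a limit, by subadditivity.\<close>

definition metric_entropy :: "('a \<Rightarrow> 'a) \<Rightarrow> 'a measure \<Rightarrow> ereal" where
  "metric_entropy T \<mu> =
     (SUP P\<in>{P. finite P \<and> P \<subseteq> sets \<mu> \<and> partition_on (space \<mu>) P}.
        limsup (\<lambda>n. ereal (partition_entropy \<mu> (dynamical_join (space \<mu>) T P n) / real n)))"

text \<open>Topological entropy via open covers (Adler, Konheim, McAndrew), for compact \<open>X\<close> and
  continuous \<open>T\<close>; then finite subcovers exist and the upper limit is a limit.\<close>

definition open_cover :: "'a::topological_space set \<Rightarrow> 'a set set \<Rightarrow> bool" where
  "open_cover X C \<longleftrightarrow> (\<forall>U\<in>C. openin (top_of_set X) U) \<and> \<Union>C = X"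

definition min_subcover :: "'a set \<Rightarrow> 'a set set \<Rightarrow> nat" where
  "min_subcover X C = (LEAST m. \<exists>D\<subseteq>C. finite D \<and> card D = m \<and> X \<subseteq> \<Union>D)"

definition topological_entropy :: "'a::topological_space set \<Rightarrow> ('a \<Rightarrow> 'a) \<Rightarrow> ereal" where
  "topological_entropy X T =
     (SUP C\<in>{C. open_cover X C}.
        limsup (\<lambda>n. ereal (ln (real (min_subcover X (dynamical_join X T C n))) / real n)))"

end

theory Submission
  imports Defs "HOL-Real_Asymp.Real_Asymp"
begin

text \<open>
  The topological entropy and both suprema are equal to \<open>ln k\<close>.

  Upper bounds. The fiber maps are homeomorphisms of the circle. Along a fixed word of length \<open>n\<close>, the
  end points of \<open>M\<close> arcs have at most \<open>n * M\<close> preimages, so the itineraries with respect to the arcs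
  take a number of values that is only linear in \<open>n\<close> (\<open>arc_itinerary_classes\<close>). Together with the
  symbols this gives at most \<open>k ^ (n + 2 * L) * (2 * (n * 2 ^ L) + 1)\<close> itineraries with respect to the
  partition into cells of level \<open>L\<close> (\<open>card_itineraries\<close>), an exponential growth rate of \<open>ln k\<close>. Fine cells
  refine every open cover, which bounds the topological entropy (\<open>topological_entropy_le\<close>). Cells also
  generate the Borel sets, so a finite measurable partition is a function of the cell outside a set
  of small measure; the exceptional symbols form a process of small entropy, and subadditivity bounds the
  entropy of every ergodic measure (\<open>metric_entropy_le\<close>). The reverse inequality for the topological
  entropy comes from the base shift (\<open>topological_entropy_ge\<close>).

  Measures of negative exponent and entropy close to \<open>ln k\<close>. Since the absolute value of the derivative of a
  circle diffeomorphism integrates to at most one, Markov's inequality yields, for every word \<open>w\<close> of length \<open>n\<close>,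
  a point \<open>x\<close> of \<open>J\<close> along whose orbit all derivatives are at most \<open>exp (\<tau> * n)\<close>
  (\<open>exists_small_derivatives\<close>). By uniform continuity of the derivatives the same holds, with a slightly larger
  rate, on a ball around \<open>x\<close> of radius \<open>exp (- \<delta> * n)\<close> if \<open>\<tau>\<close> is small against \<open>\<delta>\<close>
  (\<open>distortion_control\<close>). Backward expansion provides a word \<open>v\<close>, of length proportional to \<open>\<delta> * n\<close> up
  to a constant, that maps \<open>J\<close> into this ball with a contraction that outweighs the loss along \<open>w\<close>
  (\<open>contraction_into_balls\<close>), and backward accessibility provides a word \<open>u\<close> of bounded length leading
  back to \<open>J\<close> (\<open>return_words\<close>). So \<open>v @ w @ u\<close> maps \<open>J\<close> into itself and contracts it. Every \<open>w\<close> arises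
  here, and fixing the lengths of \<open>v\<close> and \<open>u\<close> costs a polynomial factor; hence there is a set \<open>W\<close> of
  contracting words of one length \<open>N\<close> with \<open>ln (card W) / N\<close> as close to \<open>ln k\<close> as desired
  (\<open>contracting_horseshoe\<close>). Over the full shift on \<open>W\<close> the images of \<open>J\<close> along the past shrink to a point
  (\<open>attracting_section\<close>). The image of the uniform Bernoulli measure under concatenation of words
  and this section, averaged over the first \<open>N\<close> iterates, is ergodic with entropy at least
  \<open>ln (card W) / N\<close> and negative exponent (\<open>horseshoe_measure\<close>).

  For positive exponents the same horseshoe is built for the inverse maps, using forward
  expansion and accessibility, and read backwards in time (\<open>repelling_section\<close>).
\<close>


section \<open>Topology of the circle\<close>

lemma continuous_to_circle: "continuous_on A to_circle"
proof -
  have "continuous_on UNIV to_circle"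
    by (simp add: continuous_on_open_vimage open_circle_iff)
  then show ?thesis
    by (rule continuous_on_subset) simp
qed

lemma to_circle_frac: "to_circle (frac t) = to_circle t"
  by (simp add: to_circle_eq_iff frac_def)

lemma circle_lift_near: "\<exists>t. to_circle t = q \<and> \<bar>t - s\<bar> = dist q (to_circle s)"
proof -
  obtain u where u: "to_circle u = q" using to_circle_surj by blast
  obtain n where n: "n \<in> \<int>" "infdist (u - s) \<int> = \<bar>u - s - n\<bar>"
    using infdist_Ints_attained by blast
  have "to_circle (u - n) = q" using u n by (auto simp: to_circle_eq_iff)
  moreover have "\<bar>u - n - s\<bar> = dist q (to_circle s)"
    using n u dist_to_circle[of u s] by (simp add: algebra_simps)
  ultimately show ?thesis by blast
qed

lemma compact_UNIV_circle: "compact (UNIV :: circle set)"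
proof -
  have "p \<in> to_circle ` {0..1}" for p
  proof -
    obtain t where "to_circle t = p" using to_circle_surj by blast
    then have "p = to_circle (frac t)" by (simp add: to_circle_frac)
    moreover have "frac t \<in> {0..1}" using frac_lt_1[of t] by auto
    ultimately show ?thesis by blast
  qed
  then have "to_circle ` {0..1} = UNIV" by blast
  then show ?thesis
    using compact_continuous_image[OF continuous_to_circle, of "{0..1}"] by simp
qed

instance circle :: second_countable_topology
proof
  define B where "B = (\<lambda>(q, r). ball (to_circle (real_of_rat q)) (real_of_rat r)) ` UNIV"
  have "topological_basis B"
  proof (rule topological_basisI)
    fix U :: "circle set" and p assume U: "open U" "p \<in> U"
    obtain e where e: "e > 0" "ball p e \<subseteq> U" using U openE by blast
    obtain t where t: "to_circle t = p" using to_circle_surj by blast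
    obtain r where r: "0 < real_of_rat r" "real_of_rat r < e / 2"
      using of_rat_dense[of 0 "e / 2"] e by auto
    obtain q where q: "t < real_of_rat q" "real_of_rat q < t + real_of_rat r"
      using of_rat_dense[of t "t + real_of_rat r"] r by auto
    have d: "dist (to_circle (real_of_rat q)) p < real_of_rat r"
      using dist_to_circle_le[of "real_of_rat q" t] q t by auto
    have "ball (to_circle (real_of_rat q)) (real_of_rat r) \<subseteq> ball p e"
    proof
      fix z assume "z \<in> ball (to_circle (real_of_rat q)) (real_of_rat r)"
      then have "dist p z < e"
        using d r dist_triangle[of p z "to_circle (real_of_rat q)"] by (simp add: dist_commute)
      then show "z \<in> ball p e" by simp
    qed
    with d e show "\<exists>B'\<in>B. p \<in> B' \<and> B' \<subseteq> U"
      unfolding B_def by (intro bexI[of _ "ball (to_circle (real_of_rat q)) (real_of_rat r)"]) auto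
  qed (auto simp: B_def)
  moreover have "countable B" unfolding B_def by (intro countable_image) auto
  ultimately show "\<exists>B::circle set set. countable B \<and> open = generate_topology B"
    using topological_basis_imp_subbasis by blast
qed

section \<open>Derivatives of circle maps\<close>

lemma has_circle_derivative_lift:
  assumes "has_circle_derivative h d (to_circle t)"
  obtains \<phi> where "\<forall>\<^sub>F s in nhds t. h (to_circle s) = to_circle (\<phi> s)"
    "(\<phi> has_real_derivative d) (at t)"
proof -
  obtain u \<psi> where u: "to_circle u = to_circle t" "\<forall>\<^sub>F s in nhds u. h (to_circle s) = to_circle (\<psi> s)"
      "(\<psi> has_real_derivative d) (at u)"
    using assms unfolding has_circle_derivative_def by blast
  define n where "n = u - t"
  have sh: "to_circle (s + n) = to_circle s" for s
    using u(1) by (simp add: to_circle_eq_iff n_def)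
  have flim: "filterlim (\<lambda>s. s + n) (nhds u) (nhds t)"
    using tendsto_add[OF filterlim_ident tendsto_const[of n], of t] by (simp add: n_def)
  have "\<forall>\<^sub>F s in nhds t. h (to_circle s) = to_circle (\<psi> (s + n))"
    using eventually_compose_filterlim[OF u(2) flim] by (simp add: sh)
  moreover have "((\<lambda>s. \<psi> (s + n)) has_real_derivative d) (at t)"
    using u(3) DERIV_shift[of \<psi> d t n] by (simp add: n_def)
  ultimately show ?thesis by (rule that)
qed

lemma has_circle_derivative_local_bound:
  assumes "has_circle_derivative h d (to_circle t)" "\<bar>d\<bar> < L"
  shows "\<exists>e>0. \<forall>s. \<bar>s - t\<bar> < e \<longrightarrow> dist (h (to_circle s)) (h (to_circle t)) \<le> L * \<bar>s - t\<bar>"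
proof -
  obtain \<phi> where \<phi>: "\<forall>\<^sub>F s in nhds t. h (to_circle s) = to_circle (\<phi> s)"
    "(\<phi> has_real_derivative d) (at t)"
    using has_circle_derivative_lift[OF assms(1)] .
  have "((\<lambda>s. (\<phi> s - \<phi> t) / (s - t)) \<longlongrightarrow> d) (at t)"
    using \<phi>(2) by (simp add: has_field_derivative_iff)
  then have "((\<lambda>s. \<bar>(\<phi> s - \<phi> t) / (s - t)\<bar>) \<longlongrightarrow> \<bar>d\<bar>) (at t)"
    by (rule tendsto_rabs)
  then have "\<forall>\<^sub>F s in at t. \<bar>(\<phi> s - \<phi> t) / (s - t)\<bar> < L"
    using assms(2) by (rule order_tendstoD)
  then obtain e1 where e1: "e1 > 0" "\<And>s. s \<noteq> t \<Longrightarrow> dist s t < e1 \<Longrightarrow> \<bar>(\<phi> s - \<phi> t) / (s - t)\<bar> < L"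
    unfolding eventually_at by auto
  obtain e2 where e2: "e2 > 0" "\<And>s. dist s t < e2 \<Longrightarrow> h (to_circle s) = to_circle (\<phi> s)"
    using \<phi>(1) unfolding eventually_nhds_metric by auto
  have "dist (h (to_circle s)) (h (to_circle t)) \<le> L * \<bar>s - t\<bar>" if "\<bar>s - t\<bar> < min e1 e2" for s
  proof (cases "s = t")
    case False
    have "\<bar>\<phi> s - \<phi> t\<bar> / \<bar>s - t\<bar> < L"
      using e1(2)[OF False] that by (simp add: dist_real_def)
    then have "\<bar>\<phi> s - \<phi> t\<bar> \<le> L * \<bar>s - t\<bar>"
      using False by (simp add: field_simps)
    moreover have "dist (h (to_circle s)) (h (to_circle t)) \<le> \<bar>\<phi> s - \<phi> t\<bar>"
      using e2(2)[of s] e2(2)[of t] e2(1) that dist_to_circle_le[of "\<phi> s" "\<phi> t"]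
      by (simp add: dist_real_def)
    ultimately show ?thesis by linarith
  qed simp
  moreover have "min e1 e2 > 0" using e1(1) e2(1) by simp
  ultimately show ?thesis by blast
qed

text \<open>A mean value inequality for circle maps, read along an interval of the covering line. It is local
  in nature, so it needs no global lift of \<open>h\<close>.\<close>

lemma circle_mean_value:
  assumes "a \<le> b" "\<And>t. a \<le> t \<Longrightarrow> t \<le> b \<Longrightarrow> has_circle_derivative h (D t) (to_circle t)"
    and "\<And>t. a \<le> t \<Longrightarrow> t \<le> b \<Longrightarrow> \<bar>D t\<bar> \<le> L"
  shows "dist (h (to_circle a)) (h (to_circle b)) \<le> L * (b - a)"
proof -
  have "dist (h (to_circle a)) (h (to_circle b)) \<le> M * (b - a)" if M: "M > L" for M
    using \<open>a \<le> b\<close>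
  proof (induct rule: Bolzano)
    case (trans x y z)
    then show ?case
      using dist_triangle[of "h (to_circle x)" "h (to_circle z)" "h (to_circle y)"]
      by (simp add: algebra_simps)
  next
    case (local x)
    then obtain e where e: "e > 0"
      "\<And>s. \<bar>s - x\<bar> < e \<Longrightarrow> dist (h (to_circle s)) (h (to_circle x)) \<le> M * \<bar>s - x\<bar>"
      using has_circle_derivative_local_bound[OF assms(2)[OF local], of M] assms(3)[OF local] M
      by fastforce
    have "dist (h (to_circle u)) (h (to_circle v)) \<le> M * (v - u)"
      if "u \<le> x" "x \<le> v" "v - u < e" for u v
      using e(2)[of u] e(2)[of v] that
        dist_triangle[of "h (to_circle u)" "h (to_circle v)" "h (to_circle x)"]
      by (simp add: algebra_simps dist_commute)
    with e(1) show ?case by blast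
  qed
  then have "\<forall>\<^sub>F M in at_right L. dist (h (to_circle a)) (h (to_circle b)) \<le> M * (b - a)"
    by (simp add: eventually_at_right_less eventually_at_filter)
  moreover have "((\<lambda>M. M * (b - a)) \<longlongrightarrow> L * (b - a)) (at_right L)"
    by (intro tendsto_intros)
  ultimately show ?thesis
    by (intro tendsto_lowerbound[where F = "at_right L"]) auto
qed

lemma circle_mean_value_ball:
  assumes D: "\<And>q. dist q p \<le> r \<Longrightarrow> has_circle_derivative h (D q) q"
    and L: "\<And>q. dist q p \<le> r \<Longrightarrow> \<bar>D q\<bar> \<le> L" and q: "dist q p \<le> r"
  shows "dist (h q) (h p) \<le> L * dist q p"
proof -
  obtain t where t: "to_circle t = p" using to_circle_surj by blast
  obtain s where s: "to_circle s = q" "\<bar>s - t\<bar> = dist q p"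
    using circle_lift_near[of q t] t by auto
  have near: "dist (to_circle u) p \<le> r" if "\<bar>u - t\<bar> \<le> \<bar>s - t\<bar>" for u
    using dist_to_circle_le[of u t] that s q t by simp
  show ?thesis
  proof (cases "s \<le> t")
    case True
    have "dist (h (to_circle s)) (h (to_circle t)) \<le> L * (t - s)"
      by (rule circle_mean_value[OF True, where D = "\<lambda>u. D (to_circle u)"])
         (use True in \<open>auto intro!: D L near\<close>)
    then show ?thesis using s t True by simp
  next
    case False
    then have "t \<le> s" by simp
    then have "dist (h (to_circle t)) (h (to_circle s)) \<le> L * (s - t)"
      by (rule circle_mean_value[where D = "\<lambda>u. D (to_circle u)"])
         (use False in \<open>auto intro!: D L near\<close>)
    then show ?thesis using s t False by (simp add: dist_commute)
  qed
qed

lemma has_circle_derivative_continuous: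
  assumes "\<And>p. has_circle_derivative h (D p) p"
  shows "continuous_on A h"
proof -
  have "isCont h p" for p
    unfolding continuous_at_eps_delta
  proof safe
    fix e :: real assume "e > 0"
    obtain t where t: "to_circle t = p" using to_circle_surj by blast
    define L where "L = \<bar>D p\<bar> + 1"
    have L: "L > 0" "\<bar>D p\<bar> < L" by (auto simp: L_def)
    obtain d where d: "d > 0"
      "\<And>s. \<bar>s - t\<bar> < d \<Longrightarrow> dist (h (to_circle s)) (h (to_circle t)) \<le> L * \<bar>s - t\<bar>"
      using has_circle_derivative_local_bound[of h "D p" t L] assms[of p] t L by auto
    have "dist (h q) (h p) < e" if q: "dist q p < min d (e / L)" for q
    proof -
      obtain s where s: "to_circle s = q" "\<bar>s - t\<bar> = dist q p"
        using circle_lift_near[of q t] t by auto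
      have "dist (h q) (h p) \<le> L * dist q p" using d(2)[of s] s t q by simp
      also have "\<dots> < e" using q L by (simp add: field_simps)
      finally show ?thesis .
    qed
    then show "\<exists>d>0. \<forall>q. dist q p < d \<longrightarrow> dist (h q) (h p) < e"
      using d(1) L \<open>e > 0\<close> by (intro exI[of _ "min d (e / L)"]) auto
  qed
  then show ?thesis by (simp add: continuous_at_imp_continuous_on)
qed

lemma has_circle_derivative_compose:
  assumes "has_circle_derivative f d p" "has_circle_derivative g d' (f p)"
  shows "has_circle_derivative (g \<circ> f) (d' * d) p"
proof -
  obtain t \<phi> where t: "to_circle t = p" "\<forall>\<^sub>F s in nhds t. f (to_circle s) = to_circle (\<phi> s)"
      "(\<phi> has_real_derivative d) (at t)"
    using assms(1) unfolding has_circle_derivative_def by blast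
  have fp: "f p = to_circle (\<phi> t)"
    using eventually_nhds_x_imp_x[OF t(2)] t(1) by simp
  obtain \<psi> where \<psi>: "\<forall>\<^sub>F s in nhds (\<phi> t). g (to_circle s) = to_circle (\<psi> s)"
      "(\<psi> has_real_derivative d') (at (\<phi> t))"
    using has_circle_derivative_lift assms(2) unfolding fp by blast
  have "isCont \<phi> t" using t(3) by (rule DERIV_isCont)
  then have "filterlim \<phi> (nhds (\<phi> t)) (nhds t)"
    by (simp add: isCont_def tendsto_at_iff_tendsto_nhds)
  then have "\<forall>\<^sub>F s in nhds t. g (to_circle (\<phi> s)) = to_circle (\<psi> (\<phi> s))"
    using eventually_compose_filterlim[OF \<psi>(1)] by blast
  with t(2) have "\<forall>\<^sub>F s in nhds t. (g \<circ> f) (to_circle s) = to_circle ((\<psi> \<circ> \<phi>) s)"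
    by eventually_elim simp
  moreover have "((\<psi> \<circ> \<phi>) has_real_derivative (d' * d)) (at t)"
    using DERIV_chain[OF \<psi>(2) t(3)] by simp
  ultimately show ?thesis using t(1) unfolding has_circle_derivative_def by blast
qed

lemma has_circle_derivative_id: "has_circle_derivative (\<lambda>x. x) 1 p"
proof -
  obtain t where "to_circle t = p" using to_circle_surj by blast
  then show ?thesis unfolding has_circle_derivative_def
    by (intro exI[of _ t] exI[of _ "\<lambda>x. x"]) auto
qed

lemma circle_C1_derivative:
  assumes "circle_C1 f"
  shows "has_circle_derivative f (circle_deriv f p) p" "continuous_on A (circle_deriv f)"
proof -
  obtain f' where f': "continuous_on UNIV f'" "\<And>p. has_circle_derivative f (f' p) p"
    using assms unfolding circle_C1_def by blast
  then have "circle_deriv f = f'" by (auto intro: circle_deriv_eqI)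
  with f' show "has_circle_derivative f (circle_deriv f p) p" "continuous_on A (circle_deriv f)"
    by (auto intro: continuous_on_subset)
qed

lemma circle_C1_continuous: "circle_C1 f \<Longrightarrow> continuous_on A f"
  using has_circle_derivative_continuous circle_C1_derivative(1) by blast

lemma circle_C1_compose:
  assumes "circle_C1 f" "circle_C1 g"
  shows "circle_C1 (g \<circ> f)"
    and "circle_deriv (g \<circ> f) p = circle_deriv g (f p) * circle_deriv f p"
proof -
  have D: "has_circle_derivative (g \<circ> f) (circle_deriv g (f p) * circle_deriv f p) p" for p
    using assms by (intro has_circle_derivative_compose circle_C1_derivative)
  show "circle_deriv (g \<circ> f) p = circle_deriv g (f p) * circle_deriv f p"
    using D by (rule circle_deriv_eqI)
  have "continuous_on UNIV (\<lambda>p. circle_deriv g (f p) * circle_deriv f p)"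
    using assms by (intro continuous_intros continuous_on_compose2[of UNIV "circle_deriv g" UNIV f]
        circle_C1_derivative circle_C1_continuous) auto
  with D show "circle_C1 (g \<circ> f)" unfolding circle_C1_def by blast
qed

lemma circle_C1_id: "circle_C1 (\<lambda>x. x)" "circle_deriv (\<lambda>x. x) p = 1"
  using has_circle_derivative_id by (auto simp: circle_C1_def intro!: exI[of _ "\<lambda>_. 1"] circle_deriv_eqI)

lemma circle_C1_diffeo_inv:
  assumes "circle_C1_diffeo f"
  shows "circle_C1_diffeo (inv f)"
  using assms by (simp add: circle_C1_diffeo_def bij_imp_bij_inv inv_inv_eq)

lemma circle_deriv_inv:
  assumes "circle_C1_diffeo f"
  shows "circle_deriv (inv f) (f p) * circle_deriv f p = 1"
proof -
  have "inv f \<circ> f = (\<lambda>x. x)"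
    using assms by (auto simp: circle_C1_diffeo_def bij_is_inj)
  then show ?thesis
    using circle_C1_compose(2)[of f "inv f" p] assms circle_C1_id(2)
    by (simp add: circle_C1_diffeo_def)
qed

lemma circle_deriv_nonzero: "circle_C1_diffeo f \<Longrightarrow> circle_deriv f p \<noteq> 0"
  using circle_deriv_inv[of f p] by auto

lemma circle_C1_diffeo_compose:
  assumes "circle_C1_diffeo f" "circle_C1_diffeo g"
  shows "circle_C1_diffeo (g \<circ> f)"
  using assms by (simp add: circle_C1_diffeo_def bij_comp circle_C1_compose o_inv_distrib)

lemma circle_C1_diffeo_id: "circle_C1_diffeo (\<lambda>x. x)"
  by (simp add: circle_C1_diffeo_def circle_C1_id inv_id[unfolded id_def] bij_id[unfolded id_def])

section \<open>Compositions of fiber maps\<close>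

lemma circle_C1_diffeo_fold:
  assumes "\<forall>i<(k::nat). circle_C1_diffeo (f i)" "set w \<subseteq> {..<k}"
  shows "circle_C1_diffeo (fold f w)"
  using assms(2)
proof (induct w rule: rev_induct)
  case Nil
  then show ?case using circle_C1_diffeo_id by (simp add: id_def)
next
  case (snoc i w)
  have "fold f (w @ [i]) = f i \<circ> fold f w" by auto
  moreover have "circle_C1_diffeo (f i \<circ> fold f w)"
    using snoc assms(1) by (intro circle_C1_diffeo_compose) auto
  ultimately show ?case by (simp only:)
qed

lemma circle_C1_diffeoD:
  assumes "circle_C1_diffeo f"
  shows "has_circle_derivative f (circle_deriv f p) p" "continuous_on A (circle_deriv f)"
    "continuous_on A f" "bij f"
  using assms circle_C1_derivative circle_C1_continuous unfolding circle_C1_diffeo_def by auto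

lemma circle_deriv_compose:
  "circle_C1_diffeo f \<Longrightarrow> circle_C1_diffeo g \<Longrightarrow>
    circle_deriv (g \<circ> f) p = circle_deriv g (f p) * circle_deriv f p"
  by (simp add: circle_C1_diffeo_def circle_C1_compose)

lemma fold_inv_rev:
  assumes "\<forall>i\<in>set w. bij (f i)"
  shows "fold (\<lambda>i. inv (f i)) (rev w) = inv (fold f w)" "bij (fold f w)"
  using assms
proof (induct w)
  case (Cons i w)
  have eq: "fold f (i # w) = fold f w \<circ> f i" by auto
  have "fold (\<lambda>i. inv (f i)) (rev (i # w)) = inv (f i) \<circ> fold (\<lambda>i. inv (f i)) (rev w)" by auto
  moreover {
    case 1
    then have "bij (f i)" "bij (fold f w)" "fold (\<lambda>i. inv (f i)) (rev w) = inv (fold f w)"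
      using Cons by auto
    then show ?case using calculation o_inv_distrib[of "fold f w" "f i"] by (simp only: eq)
  next
    case 2
    then have "bij (f i)" "bij (fold f w)" using Cons by auto
    then show ?case using bij_comp[of "f i" "fold f w"] by (simp only: eq)
  }
qed (auto simp: id_def inv_id[unfolded id_def] bij_id[unfolded id_def])

lemma circle_deriv_fold_append:
  assumes "\<forall>i<(k::nat). circle_C1_diffeo (f i)" "set u \<subseteq> {..<k}" "set v \<subseteq> {..<k}"
  shows "circle_deriv (fold f (u @ v)) p = circle_deriv (fold f v) (fold f u p) * circle_deriv (fold f u) p"
  using circle_deriv_compose[OF circle_C1_diffeo_fold[OF assms(1,2)] circle_C1_diffeo_fold[OF assms(1,3)]]
  by simp

lemma fiber_derivative_bound:
  assumes "\<forall>i<(k::nat). circle_C1_diffeo (f i)"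
  shows "\<exists>L>1. \<forall>i<k. \<forall>p. \<bar>circle_deriv (f i) p\<bar> \<le> L"
proof -
  have "\<forall>i<k. \<exists>B. \<forall>p. \<bar>circle_deriv (f i) p\<bar> \<le> B"
  proof safe
    fix i assume "i < k"
    then have "compact (circle_deriv (f i) ` UNIV)"
      using assms by (intro compact_continuous_image compact_UNIV_circle circle_C1_diffeoD) auto
    then have "bounded (circle_deriv (f i) ` UNIV)" by (rule compact_imp_bounded)
    then show "\<exists>B. \<forall>p. \<bar>circle_deriv (f i) p\<bar> \<le> B" by (auto simp: bounded_iff)
  qed
  then obtain B where B: "\<And>i p. i < k \<Longrightarrow> \<bar>circle_deriv (f i) p\<bar> \<le> B i" by metis
  have "\<bar>circle_deriv (f i) p\<bar> \<le> 2 + (\<Sum>i<k. \<bar>B i\<bar>)" if "i < k" for i p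
  proof -
    have "\<bar>B i\<bar> \<le> (\<Sum>i<k. \<bar>B i\<bar>)" using that by (intro member_le_sum[of i "{..<k}" "\<lambda>i. \<bar>B i\<bar>"]) auto
    then show ?thesis using B[OF that, of p] by linarith
  qed
  moreover have "(\<Sum>i<k. \<bar>B i\<bar>) \<ge> 0" by (rule sum_nonneg) simp
  then have "2 + (\<Sum>i<k. \<bar>B i\<bar>) > 1" by linarith
  ultimately show ?thesis by blast
qed

lemma fold_derivative_bound:
  assumes f: "\<forall>i<(k::nat). circle_C1_diffeo (f i)" and L: "\<forall>i<k. \<forall>p. \<bar>circle_deriv (f i) p\<bar> \<le> L" "L > 1"
    and w: "set w \<subseteq> {..<k}"
  shows "\<bar>circle_deriv (fold f w) p\<bar> \<le> L ^ length w"
  using w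
proof (induct w rule: rev_induct)
  case Nil
  then show ?case by (simp add: id_def circle_C1_id)
next
  case (snoc i w)
  then have "\<bar>circle_deriv (f i) (fold f w p)\<bar> * \<bar>circle_deriv (fold f w) p\<bar> \<le> L * L ^ length w"
    using L by (intro mult_mono) auto
  then show ?case
    using circle_deriv_fold_append[OF f, of w "[i]" p] snoc.prems by (simp add: abs_mult del: fold_append)
qed

lemma fold_lipschitz:
  assumes "\<forall>i<(k::nat). circle_C1_diffeo (f i)" "\<forall>i<k. \<forall>p. \<bar>circle_deriv (f i) p\<bar> \<le> L" "L > 1"
    and "set w \<subseteq> {..<k}"
  shows "dist (fold f w p) (fold f w q) \<le> L ^ length w * dist p q"
  using circle_mean_value_ball[of q "dist p q" "fold f w" "circle_deriv (fold f w)" "L ^ length w" p]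
    circle_C1_diffeoD(1)[OF circle_C1_diffeo_fold[OF assms(1,4)]] fold_derivative_bound[OF assms]
  by auto

section \<open>Points with small derivatives\<close>

text \<open>The absolute value of the derivative of a circle diffeomorphism integrates to at most one, so by
  Markov's inequality it exceeds \<open>c\<close> only on a set of length at most \<open>1 / c\<close>. The diffeomorphism is read in
  the coordinate \<open>[0, 1)\<close> of its target, and the one point that it maps to \<open>to_circle 0\<close>, where this
  coordinate jumps, is left out of \<open>E\<close>.\<close>

lemma circle_derivative_markov:
  assumes h: "circle_C1_diffeo h" and c: "c > 0" and ab: "b \<le> a + 1"
  defines "E \<equiv> {t \<in> {a<..<b}. h (to_circle t) \<noteq> to_circle 0 \<and> \<bar>circle_deriv h (to_circle t)\<bar> > c}"
  shows "open E" "measure lebesgue E \<le> 1 / c"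
proof -
  have cont: "continuous_on UNIV (\<lambda>t. h (to_circle t))" "continuous_on UNIV (\<lambda>t. circle_deriv h (to_circle t))"
    using h by (auto intro!: continuous_on_compose2[of UNIV _ UNIV to_circle] continuous_to_circle
        circle_C1_diffeoD)
  have "open {t. h (to_circle t) \<noteq> to_circle 0}"
    using cont(1) by (intro open_Collect_neq) auto
  moreover have "open {t. c < \<bar>circle_deriv h (to_circle t)\<bar>}"
    using cont(2) by (intro open_Collect_less continuous_intros)
  moreover have "E = {a<..<b} \<inter> {t. h (to_circle t) \<noteq> to_circle 0} \<inter> {t. c < \<bar>circle_deriv h (to_circle t)\<bar>}"
    by (auto simp: E_def)
  ultimately show E: "open E" by (metis open_Int open_greaterThanLessThan)
  have "bounded E" by (rule bounded_subset[of "{a<..<b}"]) (auto simp: E_def)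
  with E have lm: "E \<in> lmeasurable" by (simp add: bounded_set_imp_lmeasurable)
  define g where "g t = frac (rep_circle (h (to_circle t)))" for t
  have abs_rep: "to_circle (rep_circle p) = p" for p
    using Quotient3_abs_rep[OF Quotient3_circle] by simp
  have frac_eq: "frac u = frac v" if "to_circle u = to_circle v" for u v
  proof -
    obtain n where "u - v = real_of_int n" using \<open>to_circle u = to_circle v\<close> by (auto simp: to_circle_eq_iff elim: Ints_cases)
    then have "u = v + real_of_int n" by simp
    then show ?thesis by (simp add: frac_def)
  qed
  have to_g: "to_circle (g t) = h (to_circle t)" for t
    by (simp add: g_def to_circle_frac abs_rep)
  have deriv: "(g has_real_derivative circle_deriv h (to_circle t)) (at t within E)" if t: "t \<in> E" for t
  proof -
    obtain \<phi> where \<phi>: "\<forall>\<^sub>F s in nhds t. h (to_circle s) = to_circle (\<phi> s)"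
      "(\<phi> has_real_derivative circle_deriv h (to_circle t)) (at t)"
      using has_circle_derivative_lift[OF circle_C1_diffeoD(1)[OF h]] .
    have "to_circle (\<phi> t) \<noteq> to_circle 0"
      using eventually_nhds_x_imp_x[OF \<phi>(1)] t by (simp add: E_def)
    then have "\<phi> t \<notin> \<int>" by (simp add: to_circle_eq_iff)
    then have *: "of_int \<lfloor>\<phi> t\<rfloor> < \<phi> t" "\<phi> t < of_int \<lfloor>\<phi> t\<rfloor> + 1"
      using of_int_floor_le[of "\<phi> t"] floor_correct[of "\<phi> t"] Ints_of_int[of "\<lfloor>\<phi> t\<rfloor>"]
      by (metis less_le, simp)
    have "isCont \<phi> t" using \<phi>(2) by (rule DERIV_isCont)
    then have "(\<phi> \<longlongrightarrow> \<phi> t) (nhds t)" by (simp add: isCont_def tendsto_at_iff_tendsto_nhds)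
    then have "\<forall>\<^sub>F s in nhds t. of_int \<lfloor>\<phi> t\<rfloor> < \<phi> s" "\<forall>\<^sub>F s in nhds t. \<phi> s < of_int \<lfloor>\<phi> t\<rfloor> + 1"
      using order_tendstoD(1)[OF _ *(1)] order_tendstoD(2)[OF _ *(2)] by blast+
    with \<phi>(1) have "\<forall>\<^sub>F s in nhds t. g s = \<phi> s - of_int \<lfloor>\<phi> t\<rfloor>"
    proof eventually_elim
      case (elim s)
      then have "\<lfloor>\<phi> s\<rfloor> = \<lfloor>\<phi> t\<rfloor>" by (intro floor_unique) auto
      moreover have "g s = frac (\<phi> s)"
        unfolding g_def using elim(1) by (intro frac_eq) (simp add: abs_rep)
      ultimately show ?case by (simp add: frac_def)
    qed
    then have "(g has_real_derivative circle_deriv h (to_circle t)) (at t)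
      \<longleftrightarrow> ((\<lambda>s. \<phi> s - of_int \<lfloor>\<phi> t\<rfloor>) has_real_derivative circle_deriv h (to_circle t)) (at t)"
      by (intro DERIV_cong_ev) auto
    moreover have "((\<lambda>s. \<phi> s - of_int \<lfloor>\<phi> t\<rfloor>) has_real_derivative circle_deriv h (to_circle t)) (at t)"
      using \<phi>(2) by (auto intro!: derivative_eq_intros)
    ultimately show ?thesis by (auto intro: has_field_derivative_at_within)
  qed
  have inj: "inj_on g E"
  proof (rule inj_onI)
    fix s t assume st: "s \<in> E" "t \<in> E" "g s = g t"
    then have "h (to_circle s) = h (to_circle t)" using to_g by metis
    then have "s - t \<in> \<int>"
      using circle_C1_diffeoD(4)[OF h] by (simp add: bij_is_inj inj_eq to_circle_eq_iff)
    moreover have "\<bar>s - t\<bar> < 1" using st ab by (auto simp: E_def)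
    ultimately show "s = t" using Ints_nonzero_abs_less1[of "s - t"] by auto
  qed
  obtain B where B: "\<And>p. \<bar>circle_deriv h p\<bar> \<le> B"
    using fiber_derivative_bound[of 1 "\<lambda>_. h"] h by auto
  have "(\<lambda>t. circle_deriv h (to_circle t)) \<in> borel_measurable (lebesgue_on E)"
    using cont(2) lm by (intro continuous_imp_measurable_on_sets_lebesgue)
      (auto intro: continuous_on_subset fmeasurableD)
  then have ai: "(\<lambda>t. \<bar>circle_deriv h (to_circle t)\<bar> * 1) absolutely_integrable_on E"
    using lm B
    by (intro measurable_bounded_by_integrable_imp_absolutely_integrable[where g = "\<lambda>_. B"])
      (auto intro: integrable_on_const fmeasurableD)
  have cv: "(\<lambda>_. 1::real) absolutely_integrable_on g ` E
      \<and> integral (g ` E) (\<lambda>_. 1::real) = integral E (\<lambda>t. \<bar>circle_deriv h (to_circle t)\<bar> * 1)"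
    using has_absolute_integral_change_of_variables_1'[OF fmeasurableD[OF lm] deriv inj,
        of "\<lambda>_. 1" "integral E (\<lambda>t. \<bar>circle_deriv h (to_circle t)\<bar> * 1)"] ai
    by simp
  have "c * measure lebesgue E = integral E (\<lambda>_. c)"
    using lm by (simp add: lmeasure_integral flip: integral_mult_right)
  also have "\<dots> \<le> integral E (\<lambda>t. \<bar>circle_deriv h (to_circle t)\<bar> * 1)"
    using ai lm by (intro integral_le) (auto simp: E_def intro: integrable_on_const set_lebesgue_integral_eq_integral)
  also have "\<dots> = integral (g ` E) (\<lambda>_. 1::real)" using cv by simp
  also have "\<dots> \<le> integral {0..1::real} (\<lambda>_. 1::real)"
  proof (rule integral_subset_le)
    show "g ` E \<subseteq> {0..1}" using less_imp_le[OF frac_lt_1] by (auto simp: g_def)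
    show "(\<lambda>_. 1::real) integrable_on g ` E"
      using cv set_lebesgue_integral_eq_integral(1) by blast
  qed auto
  finally show "measure lebesgue E \<le> 1 / c" using c by (simp add: field_simps)
qed

lemma exists_small_derivatives:
  assumes h: "\<And>j. j \<le> n \<Longrightarrow> circle_C1_diffeo (h j)" and ab: "b \<le> a + 1"
    and c: "c > 0" "real (n + 1) / c < b - a"
  shows "\<exists>t\<in>{a<..<b}. \<forall>j\<le>n. \<bar>circle_deriv (h j) (to_circle t)\<bar> \<le> c"
proof (rule ccontr)
  assume neg: "\<not> ?thesis"
  define E where "E j = {t \<in> {a<..<b}. h j (to_circle t) \<noteq> to_circle 0
    \<and> \<bar>circle_deriv (h j) (to_circle t)\<bar> > c}" for j
  define Z where "Z j = {t \<in> {a<..<b}. h j (to_circle t) = to_circle 0}" for j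
  have E: "open (E j)" "measure lebesgue (E j) \<le> 1 / c" if "j \<le> n" for j
    using circle_derivative_markov[OF h[OF that] c(1) ab] by (auto simp: E_def)
  have El: "E j \<in> lmeasurable" if "j \<le> n" for j
    by (intro bounded_set_imp_lmeasurable bounded_subset[of "{a<..<b}" "E j"])
       (use E(1)[OF that] in \<open>auto simp: E_def\<close>)
  have Z: "negligible (Z j)" if "j \<le> n" for j
  proof (cases "Z j = {}")
    case False
    then obtain z where z: "z \<in> Z j" by blast
    have "t = z" if t: "t \<in> Z j" for t
    proof -
      have "h j (to_circle t) = h j (to_circle z)" using z t by (simp add: Z_def)
      then have "t - z \<in> \<int>"
        using circle_C1_diffeoD(4)[OF h[OF \<open>j \<le> n\<close>]] by (simp add: bij_is_inj inj_eq to_circle_eq_iff)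
      moreover have "\<bar>t - z\<bar> < 1" using z t ab by (auto simp: Z_def)
      ultimately show ?thesis using Ints_nonzero_abs_less1[of "t - z"] by auto
    qed
    then have "Z j \<subseteq> {z}" by blast
    then show ?thesis using negligible_subset negligible_sing by blast
  qed simp
  have "{a<..<b} \<subseteq> (\<Union>j\<le>n. E j) \<union> (\<Union>j\<le>n. Z j)"
  proof
    fix t assume t: "t \<in> {a<..<b}"
    then obtain j where "j \<le> n" "\<not> \<bar>circle_deriv (h j) (to_circle t)\<bar> \<le> c" using neg by blast
    then show "t \<in> (\<Union>j\<le>n. E j) \<union> (\<Union>j\<le>n. Z j)" using t by (auto simp: E_def Z_def)
  qed
  have nZ: "negligible (\<Union>j\<le>n. Z j)" using Z by (intro negligible_Union) auto
  have lU: "(\<Union>j\<le>n. E j) \<in> lmeasurable" using El by (intro fmeasurable.finite_UN) auto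
  have "b - a \<le> measure lebesgue {a<..<b}" by (cases "a \<le> b") auto
  also have "\<dots> \<le> measure lebesgue ((\<Union>j\<le>n. E j) \<union> (\<Union>j\<le>n. Z j))"
    using lU nZ \<open>{a<..<b} \<subseteq> _\<close> by (intro measure_mono_fmeasurable) (auto intro: negligible_imp_measurable)
  also have "\<dots> = measure lebesgue (\<Union>j\<le>n. E j)"
    using lU nZ by (simp add: measure_Un3 negligible_imp_measurable negligible_imp_measure0 negligible_Int)
  also have "\<dots> \<le> (\<Sum>j\<le>n. measure lebesgue (E j))"
    using El by (intro measure_UNION_le) (auto intro: fmeasurableD)
  also have "\<dots> \<le> (\<Sum>j\<le>n. 1 / c)" using E(2) by (intro sum_mono) auto
  also have "\<dots> = real (n + 1) / c" by simp
  finally show False using c(2) by linarith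
qed

section \<open>Contracting words\<close>

text \<open>If the derivatives along the orbit of \<open>x\<close> are bounded by \<open>C\<close>, then those along the orbits of the
  points of a sufficiently small ball around \<open>x\<close> are bounded by \<open>C * exp (\<tau> * j)\<close>: the images of the ball
  stay so small that uniform continuity of the derivatives costs only a factor \<open>exp \<tau>\<close> per step.\<close>

lemma distortion_control:
  fixes k :: nat and \<tau> :: real
  assumes f: "\<forall>i<k. circle_C1_diffeo (f i)" and \<tau>: "\<tau> > 0"
  shows "\<exists>\<rho>>0. \<forall>w x r C. set w \<subseteq> {..<k} \<longrightarrow> r \<ge> 0 \<longrightarrow> C * exp (\<tau> * length w) * r < \<rho> \<longrightarrow>
    (\<forall>j\<le>length w. \<bar>circle_deriv (fold f (take j w)) x\<bar> \<le> C) \<longrightarrow>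
    (\<forall>j\<le>length w. \<forall>y. dist y x \<le> r \<longrightarrow>
      \<bar>circle_deriv (fold f (take j w)) y\<bar> \<le> C * exp (\<tau> * j) \<and>
      dist (fold f (take j w) y) (fold f (take j w) x) \<le> C * exp (\<tau> * j) * r)"
proof -
  have "\<forall>i<k. \<exists>\<rho>>0. \<forall>y z. dist y z < \<rho> \<longrightarrow> \<bar>circle_deriv (f i) y\<bar> \<le> exp \<tau> * \<bar>circle_deriv (f i) z\<bar>"
  proof safe
    fix i assume i: "i < k"
    define l where "l p = ln \<bar>circle_deriv (f i) p\<bar>" for p
    have nz: "circle_deriv (f i) p \<noteq> 0" for p using f i circle_deriv_nonzero by blast
    have "continuous_on UNIV l"
      unfolding l_def using f i nz by (intro continuous_intros circle_C1_diffeoD) auto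
    then have "uniformly_continuous_on UNIV l"
      by (rule compact_uniformly_continuous) (rule compact_UNIV_circle)
    then have "\<exists>\<rho>>0. \<forall>z\<in>UNIV. \<forall>y\<in>UNIV. dist y z < \<rho> \<longrightarrow> dist (l y) (l z) < \<tau>"
      using \<tau> unfolding uniformly_continuous_on_def by (elim allE[of _ \<tau>]) (rule mp)
    then obtain \<rho> where \<rho>: "\<rho> > 0" "\<And>y z. dist y z < \<rho> \<Longrightarrow> dist (l y) (l z) < \<tau>"
      by blast
    have "\<bar>circle_deriv (f i) y\<bar> \<le> exp \<tau> * \<bar>circle_deriv (f i) z\<bar>" if "dist y z < \<rho>" for y z
    proof -
      have "l y \<le> \<tau> + l z" using \<rho>(2)[OF that] by (simp add: dist_real_def)
      then have "exp (l y) \<le> exp \<tau> * exp (l z)" by (simp flip: exp_add)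
      then show ?thesis using nz by (simp add: l_def)
    qed
    with \<rho>(1) show "\<exists>\<rho>>0. \<forall>y z. dist y z < \<rho> \<longrightarrow>
        \<bar>circle_deriv (f i) y\<bar> \<le> exp \<tau> * \<bar>circle_deriv (f i) z\<bar>" by blast
  qed
  then obtain R where R: "\<And>i. i < k \<Longrightarrow> R i > 0"
    "\<And>i y z. i < k \<Longrightarrow> dist y z < R i \<Longrightarrow> \<bar>circle_deriv (f i) y\<bar> \<le> exp \<tau> * \<bar>circle_deriv (f i) z\<bar>"
    by metis
  define \<rho> where "\<rho> = Min (insert 1 (R ` {..<k}))"
  have \<rho>: "\<rho> > 0" "\<And>i. i < k \<Longrightarrow> \<rho> \<le> R i" using R(1) by (auto simp: \<rho>_def)
  show ?thesis
  proof (intro exI[of _ \<rho>] conjI allI impI)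
    fix w x r C j y
    assume w: "set w \<subseteq> {..<k}" and r: "r \<ge> 0" and small: "C * exp (\<tau> * length w) * r < \<rho>"
      and C: "\<forall>j\<le>length w. \<bar>circle_deriv (fold f (take j w)) x\<bar> \<le> C"
    have C0: "C \<ge> 0" using C abs_ge_zero order_trans by blast
    define D where "D j = circle_deriv (fold f (take j w))" for j
    have tk: "set (take j w) \<subseteq> {..<k}" for j using w set_take_subset by fast
    have deriv: "has_circle_derivative (fold f (take j w)) (D j q) q" for j q
      using circle_C1_diffeo_fold[OF f tk] unfolding D_def by (rule circle_C1_diffeoD)
    have key: "(\<forall>y. dist y x \<le> r \<longrightarrow> \<bar>D j y\<bar> \<le> exp (\<tau> * j) * \<bar>D j x\<bar>) \<and>
      (\<forall>y. dist y x \<le> r \<longrightarrow> dist (fold f (take j w) y) (fold f (take j w) x) \<le> C * exp (\<tau> * j) * r)"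
      if "j \<le> length w" for j
      using that
    proof (induct j)
      case 0
      have "1 \<le> C" using C[rule_format, of 0] by (simp add: id_def circle_C1_id)
      then have "dist y x \<le> C * r" if "dist y x \<le> r" for y
        using that r mult_right_mono[of 1 C r] by simp
      then show ?case by (simp add: D_def id_def circle_C1_id)
    next
      case (Suc j)
      let ?i = "w ! j"
      have i: "?i < k" using w Suc.prems by (metis Suc_le_lessD lessThan_iff nth_mem subset_iff)
      have step: "D (Suc j) q = circle_deriv (f ?i) (fold f (take j w) q) * D j q" for q
        using circle_deriv_fold_append[OF f tk, of "[?i]" j q] i Suc.prems
        by (simp add: D_def take_Suc_conv_app_nth del: fold_append)
      have 1: "\<bar>D (Suc j) y\<bar> \<le> exp (\<tau> * Suc j) * \<bar>D (Suc j) x\<bar>" if y: "dist y x \<le> r" for y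
      proof -
        have "dist (fold f (take j w) y) (fold f (take j w) x) \<le> C * exp (\<tau> * j) * r"
          using Suc y by simp
        also have "\<dots> \<le> C * exp (\<tau> * length w) * r"
          using C0 r \<tau> Suc.prems by (intro mult_right_mono mult_left_mono) auto
        also have "\<dots> < R ?i" using small \<rho>(2)[OF i] by simp
        finally have "\<bar>circle_deriv (f ?i) (fold f (take j w) y)\<bar>
          \<le> exp \<tau> * \<bar>circle_deriv (f ?i) (fold f (take j w) x)\<bar>" using R(2) i by blast
        moreover have "\<bar>D j y\<bar> \<le> exp (\<tau> * j) * \<bar>D j x\<bar>" using Suc y by simp
        ultimately have "\<bar>D (Suc j) y\<bar>
          \<le> (exp \<tau> * \<bar>circle_deriv (f ?i) (fold f (take j w) x)\<bar>) * (exp (\<tau> * j) * \<bar>D j x\<bar>)"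
          unfolding step abs_mult by (intro mult_mono) auto
        also have "\<dots> = exp (\<tau> * Suc j) * \<bar>D (Suc j) x\<bar>"
          unfolding step abs_mult by (simp add: algebra_simps exp_add)
        finally show ?thesis .
      qed
      have 2: "dist (fold f (take (Suc j) w) y) (fold f (take (Suc j) w) x) \<le> C * exp (\<tau> * Suc j) * r"
        if y: "dist y x \<le> r" for y
      proof -
        have "\<bar>D (Suc j) q\<bar> \<le> C * exp (\<tau> * Suc j)" if "dist q x \<le> r" for q
        proof -
          have "\<bar>D (Suc j) q\<bar> \<le> exp (\<tau> * Suc j) * \<bar>D (Suc j) x\<bar>" using 1 that by blast
          also have "\<dots> \<le> exp (\<tau> * Suc j) * C"
            using C Suc.prems unfolding D_def by (intro mult_left_mono) auto
          finally show ?thesis by (simp add: mult.commute)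
        qed
        then have "dist (fold f (take (Suc j) w) y) (fold f (take (Suc j) w) x)
          \<le> C * exp (\<tau> * Suc j) * dist y x"
          using deriv y by (intro circle_mean_value_ball[where r = r and D = "D (Suc j)"]) auto
        also have "\<dots> \<le> C * exp (\<tau> * Suc j) * r" using y C0 by (intro mult_left_mono) auto
        finally show ?thesis .
      qed
      from 1 2 show ?case by blast
    qed
    assume j: "j \<le> length w" and y: "dist y x \<le> r"
    have "\<bar>D j y\<bar> \<le> exp (\<tau> * j) * \<bar>D j x\<bar>" using key j y by blast
    also have "\<dots> \<le> exp (\<tau> * j) * C" using C j by (simp add: D_def)
    finally show "\<bar>circle_deriv (fold f (take j w)) y\<bar> \<le> C * exp (\<tau> * j)"
      by (simp add: D_def mult.commute)
    show "dist (fold f (take j w) y) (fold f (take j w) x) \<le> C * exp (\<tau> * j) * r"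
      using key j y by blast
  qed (rule \<rho>(1))
qed

text \<open>By compactness, finitely many words suffice to lead every point into the interior of \<open>J\<close>, together
  with a ball of uniform radius.\<close>

lemma return_words:
  fixes k :: nat
  assumes f: "\<forall>i<k. circle_C1_diffeo (f i)" and acc: "Acc_minus k f J"
  shows "\<exists>M \<rho>. \<rho> > 0 \<and>
    (\<forall>y. \<exists>w. set w \<subseteq> {..<k} \<and> length w \<le> M \<and> fold f w ` ball y \<rho> \<subseteq> J)"
proof -
  have "\<exists>w. set w \<subseteq> {..<k} \<and> fold f w y \<in> interior J" for y
  proof -
    obtain w where w: "set w \<subseteq> {..<k}" "y \<in> fold (\<lambda>i. inv (f i)) w ` interior J"
      using acc unfolding Acc_minus_def Acc_plus_def by blast
    have bij: "\<forall>i\<in>set (rev w). bij (f i)" using f w(1) circle_C1_diffeoD(4) by auto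
    have "fold (\<lambda>i. inv (f i)) w = inv (fold f (rev w))" "bij (fold f (rev w))"
      using fold_inv_rev[OF bij] by simp_all
    moreover obtain z where "z \<in> interior J" "y = fold (\<lambda>i. inv (f i)) w z" using w(2) by blast
    ultimately have "fold f (rev w) y \<in> interior J"
      using surj_f_inv_f[OF bij_is_surj, of "fold f (rev w)" z] by metis
    with w(1) show ?thesis by (intro exI[of _ "rev w"]) simp
  qed
  then obtain W where W: "\<And>y. set (W y) \<subseteq> {..<k}" "\<And>y. fold f (W y) y \<in> interior J" by metis
  define U where "U y = fold f (W y) -` interior J" for y
  have "open (U y)" for y
    unfolding U_def using circle_C1_diffeoD(3)[OF circle_C1_diffeo_fold[OF f W(1)]]
    by (intro open_vimage) auto
  moreover have "UNIV \<subseteq> (\<Union>y\<in>UNIV. U y)" using W(2) by (auto simp: U_def)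
  ultimately obtain F where F: "finite F" "UNIV \<subseteq> (\<Union>y\<in>F. U y)"
    using compactE_image[OF compact_UNIV_circle, of UNIV U] by metis
  have "\<And>G. G \<in> U ` F \<Longrightarrow> open G" using \<open>\<And>y. open (U y)\<close> by blast
  then obtain \<rho> where \<rho>: "\<rho> > 0" "\<And>y. \<exists>G\<in>U ` F. ball y \<rho> \<subseteq> G"
    using Heine_Borel_lemma[OF compact_UNIV_circle F(2)] by (metis UNIV_I)
  define M where "M = Max (insert 0 ((\<lambda>y. length (W y)) ` F))"
  have "\<exists>w. set w \<subseteq> {..<k} \<and> length w \<le> M \<and> fold f w ` ball y \<rho> \<subseteq> J" for y
  proof -
    obtain z where z: "z \<in> F" "ball y \<rho> \<subseteq> U z" using \<rho>(2) by blast
    have "length (W z) \<le> M" using F(1) z(1) by (auto simp: M_def intro!: Max_ge)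
    moreover have "fold f (W z) ` ball y \<rho> \<subseteq> J" using z(2) interior_subset by (auto simp: U_def)
    ultimately show ?thesis using W(1) by blast
  qed
  with \<rho>(1) show ?thesis by blast
qed

text \<open>Backward controlled expansion, read forwards: words that send \<open>J\<close> into a prescribed small ball
  centred in \<open>J\<close> and whose derivatives on \<open>J\<close> are bounded by a positive power of the radius. Expansion is
  uniform in the length of the word, and a word that blows a small interval up to \<open>J\<close> has length at
  least proportional to the logarithm of its size.\<close>

lemma contraction_into_balls:
  fixes k :: nat
  assumes f: "\<forall>i<k. circle_C1_diffeo (f i)" and J: "closed_circle_interval J"
    and cec: "CEC_minus k f J"
  shows "\<exists>A B s0 \<kappa> E. A > 0 \<and> B > 0 \<and> s0 > 0 \<and> \<kappa> > 0 \<and>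
    (\<forall>x s. x \<in> J \<longrightarrow> 0 < s \<longrightarrow> s < s0 \<longrightarrow> (\<exists>v. set v \<subseteq> {..<k} \<and> length v \<le> A * \<bar>ln s\<bar> + B \<and>
      fold f v ` J \<subseteq> cball x s \<and>
      (\<forall>p\<in>J. \<bar>circle_deriv (fold f v) p\<bar> \<le> exp (\<kappa> * ln s + E))))"
proof -
  let ?g = "\<lambda>i. inv (f i)"
  have g: "\<forall>i<k. circle_C1_diffeo (?g i)" using f circle_C1_diffeo_inv by blast
  obtain K1 K2 K3 K4 K5 where K: "K1 > 0" "K2 > 0" "K3 > 0" "K4 > 0" "K5 > 0"
    and CEC: "\<And>H. circle_interval H \<Longrightarrow> H \<inter> J \<noteq> {} \<Longrightarrow> circle_length H < K1 \<Longrightarrow>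
         (\<exists>w. w \<noteq> [] \<and> set w \<subseteq> {..<k} \<and> real (length w) \<le> K2 * \<bar>ln (circle_length H)\<bar> + K3 \<and>
              nbhd J K4 \<subseteq> fold ?g w ` H \<and>
              (\<forall>x\<in>H. ln \<bar>circle_deriv (fold ?g w) x\<bar> \<ge> real (length w) * K5))"
    using cec unfolding CEC_minus_def CEC_plus_def by metis
  obtain L where L: "L > 1" "\<forall>i<k. \<forall>p. \<bar>circle_deriv (?g i) p\<bar> \<le> L"
    using fiber_derivative_bound[OF g] by blast
  obtain a b where ab: "a < b" "b < a + 1" "J = to_circle ` {a..b}"
    using J unfolding closed_circle_interval_def by blast
  define d where "d = dist (to_circle a) (to_circle b)"
  have "\<bar>a - b\<bar> < 1" using ab by auto
  then have "to_circle a \<noteq> to_circle b"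
    using ab Ints_nonzero_abs_less1[of "a - b"] by (auto simp: to_circle_eq_iff)
  then have d: "d > 0" by (simp add: d_def)
  define \<kappa> where "\<kappa> = K5 / ln L"
  have \<kappa>: "\<kappa> > 0" using K(5) L(1) by (simp add: \<kappa>_def)
  define s0 where "s0 = min K1 1"
  have "\<exists>v. set v \<subseteq> {..<k} \<and> length v \<le> K2 * \<bar>ln s\<bar> + K3 \<and> fold f v ` J \<subseteq> cball x s \<and>
      (\<forall>p\<in>J. \<bar>circle_deriv (fold f v) p\<bar> \<le> exp (\<kappa> * ln s + (- \<kappa> * ln d)))"
    if x: "x \<in> J" and s: "0 < s" "s < s0" for x s
  proof -
    obtain t where t: "to_circle t = x" using to_circle_surj by blast
    define H where "H = to_circle ` {t - s/2..t + s/2}"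
    have "circle_interval H"
      unfolding circle_interval_def H_def using s
      by (intro exI[of _ "t - s/2"] exI[of _ "t + s/2"] exI[of _ "{t - s/2..t + s/2}"]) (auto simp: s0_def)
    moreover have "x \<in> H" using s by (auto simp: H_def simp flip: t)
    moreover have len: "circle_length H = s"
      unfolding H_def
      using s circle_length_interval[of "t - s/2" "t + s/2" "{t - s/2..t + s/2}"]
        greaterThanLessThan_subseteq_atLeastAtMost_iff[of "t - s/2" "t + s/2" "t - s/2" "t + s/2"]
      by (simp add: s0_def)
    ultimately have "\<exists>w. w \<noteq> [] \<and> set w \<subseteq> {..<k} \<and> real (length w) \<le> K2 * \<bar>ln s\<bar> + K3 \<and>
              nbhd J K4 \<subseteq> fold ?g w ` H \<and>
              (\<forall>x\<in>H. ln \<bar>circle_deriv (fold ?g w) x\<bar> \<ge> real (length w) * K5)"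
      using CEC[of H] x s(2) unfolding len s0_def by (metis IntI empty_iff min_less_iff_conj)
    then obtain w where w: "set w \<subseteq> {..<k}" "real (length w) \<le> K2 * \<bar>ln s\<bar> + K3"
      "nbhd J K4 \<subseteq> fold ?g w ` H" "\<And>q. q \<in> H \<Longrightarrow> ln \<bar>circle_deriv (fold ?g w) q\<bar> \<ge> real (length w) * K5"
      by metis
    have H_dist: "dist p q \<le> s" if "p \<in> H" "q \<in> H" for p q
    proof -
      obtain y z where "p = to_circle y" "q = to_circle z" "y \<in> {t - s/2..t + s/2}" "z \<in> {t - s/2..t + s/2}"
        using \<open>p \<in> H\<close> \<open>q \<in> H\<close> unfolding H_def by blast
      moreover from this have "\<bar>y - z\<bar> \<le> s" by (simp add: abs_le_iff)
      ultimately show ?thesis using dist_to_circle_le[of y z] by simp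
    qed
    have gw: "circle_C1_diffeo (fold ?g w)" using circle_C1_diffeo_fold[OF g w(1)] .
    have "\<forall>i\<in>set (rev w). bij (f i)" using f w(1) circle_C1_diffeoD(4) by auto
    from fold_inv_rev[OF this] have inv: "fold f (rev w) = inv (fold ?g w)"
      by (simp add: inv_inv_eq)
    have "J \<subseteq> nbhd J K4" using K(4) by (auto simp: nbhd_def)
    then have JH: "\<exists>q\<in>H. p = fold ?g w q \<and> fold f (rev w) p = q" if "p \<in> J" for p
    proof -
      obtain q where q: "q \<in> H" "p = fold ?g w q" using w(3) \<open>J \<subseteq> nbhd J K4\<close> \<open>p \<in> J\<close> by blast
      have "inj (fold ?g w)" using gw by (simp add: circle_C1_diffeo_def bij_is_inj)
      then have "fold f (rev w) p = q" unfolding inv q(2) by (rule inv_f_f)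
      with q show ?thesis by blast
    qed
    obtain qa qb where q: "qa \<in> H" "qb \<in> H" "to_circle a = fold ?g w qa" "to_circle b = fold ?g w qb"
      using JH[of "to_circle a"] JH[of "to_circle b"] ab(1) unfolding ab(3)
      by (metis atLeastAtMost_iff image_eqI less_imp_le order_refl)
    \<comment> \<open>Two points of \<open>H\<close> are moved apart to the distance \<open>d\<close> of the end points of \<open>J\<close>, which bounds the
      length of \<open>w\<close> from below.\<close>
    have "d \<le> L ^ length w * dist qa qb"
      unfolding d_def q using fold_lipschitz[OF g L(2,1) w(1)] by simp
    also have "\<dots> \<le> L ^ length w * s" using H_dist[OF q(1,2)] L(1) by (intro mult_left_mono) auto
    finally have "ln d \<le> ln (L ^ length w * s)" using d s L(1) by simp
    also have "\<dots> = length w * ln L + ln s" using s L(1) by (simp add: ln_mult ln_realpow)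
    finally have "(ln d - ln s) / ln L \<le> length w" using L(1) by (simp add: field_simps)
    then have "(ln d - ln s) / ln L * K5 \<le> length w * K5" using K(5) by (intro mult_right_mono) auto
    then have long: "- (length w * K5) \<le> \<kappa> * ln s + (- \<kappa> * ln d)"
    proof -
      have "(x - y) / l * K = K / l * x - K / l * y" for x y l K :: real
        by (cases "l = 0") (auto simp: field_simps)
      then have "(ln d - ln s) / ln L * K5 = \<kappa> * ln d - \<kappa> * ln s"
        unfolding \<kappa>_def .
      then show ?thesis using \<open>(ln d - ln s) / ln L * K5 \<le> length w * K5\<close> by simp
    qed
    have contr: "\<bar>circle_deriv (fold f (rev w)) p\<bar> \<le> exp (\<kappa> * ln s + (- \<kappa> * ln d))" if p: "p \<in> J" for p
    proof -
      obtain q where q: "q \<in> H" "p = fold ?g w q" using JH[OF p] by blast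
      have nz: "circle_deriv (fold ?g w) q \<noteq> 0" using circle_deriv_nonzero[OF gw] .
      have "circle_deriv (fold f (rev w)) p * circle_deriv (fold ?g w) q = 1"
        unfolding inv q(2) by (rule circle_deriv_inv[OF gw])
      then have "\<bar>circle_deriv (fold f (rev w)) p\<bar> * \<bar>circle_deriv (fold ?g w) q\<bar> = 1"
        by (metis abs_mult abs_one)
      then have "\<bar>circle_deriv (fold f (rev w)) p\<bar> = inverse \<bar>circle_deriv (fold ?g w) q\<bar>"
        by (metis inverse_unique mult.commute)
      also have "\<dots> = exp (- ln \<bar>circle_deriv (fold ?g w) q\<bar>)" using nz by (simp add: exp_minus)
      also have "\<dots> \<le> exp (\<kappa> * ln s + (- \<kappa> * ln d))" using w(4)[OF q(1)] long by simp
      finally show ?thesis .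
    qed
    have into: "fold f (rev w) ` J \<subseteq> cball x s"
    proof
      fix q assume "q \<in> fold f (rev w) ` J"
      then have "q \<in> H" using JH by blast
      then show "q \<in> cball x s" using H_dist[OF \<open>x \<in> H\<close>] by simp
    qed
    show ?thesis
      by (intro exI[of _ "rev w"] conjI ballI into contr) (use w(1,2) in simp_all)
  qed
  moreover have "s0 > 0" using K(1) by (simp add: s0_def)
  ultimately show ?thesis
    using K(2,3) \<kappa>
    by (intro exI[of _ K2] exI[of _ K3] exI[of _ s0] exI[of _ \<kappa>] exI[of _ "- \<kappa> * ln d"] conjI allI impI)
qed

text \<open>Every sufficiently long word \<open>w\<close> extends, by a comparatively short word on the left and a bounded word
  on the right, to a word that maps \<open>J\<close> into itself and contracts it.\<close>

lemma contracting_extension: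
  fixes k :: nat
  assumes f: "\<forall>i<k. circle_C1_diffeo (f i)" and J: "closed_circle_interval J"
    and cec: "CEC_minus k f J" and acc: "Acc_minus k f J"
  shows "\<exists>(A::real) (B::real) (M::nat). A > 0 \<and> B > 0 \<and> (\<forall>\<delta>>(0::real). \<forall>\<^sub>F n in sequentially. \<forall>w. set w \<subseteq> {..<k} \<longrightarrow> length w = n \<longrightarrow>
    (\<exists>v u. set v \<subseteq> {..<k} \<and> set u \<subseteq> {..<k} \<and> real (length v) \<le> A * (\<delta> * n) + B \<and> length u \<le> M \<and>
      fold f (v @ w @ u) ` J \<subseteq> J \<and> (\<forall>p\<in>J. \<bar>circle_deriv (fold f (v @ w @ u)) p\<bar> \<le> 1 / 2)))"
proof -
  obtain A B s0 \<kappa> E where AB: "A > 0" "B > 0" "s0 > 0" "\<kappa> > 0"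
    and enter: "\<And>x s. x \<in> J \<Longrightarrow> 0 < s \<Longrightarrow> s < s0 \<Longrightarrow>
      (\<exists>v. set v \<subseteq> {..<k} \<and> length v \<le> A * \<bar>ln s\<bar> + B \<and> fold f v ` J \<subseteq> cball x s \<and>
      (\<forall>p\<in>J. \<bar>circle_deriv (fold f v) p\<bar> \<le> exp (\<kappa> * ln s + E)))"
    using contraction_into_balls[OF f J cec] by metis
  obtain M \<rho>' where \<rho>': "\<rho>' > 0"
    and ret: "\<And>y. \<exists>u. set u \<subseteq> {..<k} \<and> length u \<le> M \<and> fold f u ` ball y \<rho>' \<subseteq> J"
    using return_words[OF f acc] by blast
  obtain L where L: "L > 1" "\<forall>i<k. \<forall>p. \<bar>circle_deriv (f i) p\<bar> \<le> L"
    using fiber_derivative_bound[OF f] by blast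
  obtain a b where ab: "a < b" "b < a + 1" "J = to_circle ` {a..b}"
    using J unfolding closed_circle_interval_def by blast
  have "\<forall>\<^sub>F n in sequentially. \<forall>w. set w \<subseteq> {..<k} \<longrightarrow> length w = n \<longrightarrow>
    (\<exists>v u. set v \<subseteq> {..<k} \<and> set u \<subseteq> {..<k} \<and> real (length v) \<le> A * (\<delta> * n) + B \<and> length u \<le> M \<and>
      fold f (v @ w @ u) ` J \<subseteq> J \<and> (\<forall>p\<in>J. \<bar>circle_deriv (fold f (v @ w @ u)) p\<bar> \<le> 1 / 2))"
    if \<delta>: "\<delta> > 0" for \<delta> :: real
  proof -
    \<comment> \<open>The loss \<open>\<tau>\<close> per step is small against both the rate \<open>\<delta>\<close> at which the ball shrinks
      and the rate \<open>\<delta> * \<kappa>\<close> of contraction into the ball.\<close>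
    define \<tau> where "\<tau> = min \<delta> (\<delta> * \<kappa>) / 3"
    have \<tau>: "\<tau> > 0" "2 * \<tau> < \<delta>" "2 * \<tau> < \<delta> * \<kappa>" using \<delta> AB(4) mult_pos_pos[OF \<delta> AB(4)] by (auto simp: \<tau>_def min_def)
    obtain \<rho> where \<rho>: "\<rho> > 0"
      and dist: "\<And>w x r C. set w \<subseteq> {..<k} \<Longrightarrow> r \<ge> 0 \<Longrightarrow> C * exp (\<tau> * length w) * r < \<rho> \<Longrightarrow>
        (\<forall>j\<le>length w. \<bar>circle_deriv (fold f (take j w)) x\<bar> \<le> C) \<Longrightarrow>
        (\<forall>j\<le>length w. \<forall>y. dist y x \<le> r \<longrightarrow>
          \<bar>circle_deriv (fold f (take j w)) y\<bar> \<le> C * exp (\<tau> * j) \<and>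
          dist (fold f (take j w) y) (fold f (take j w) x) \<le> C * exp (\<tau> * j) * r)"
      using distortion_control[OF f \<tau>(1)] by metis
    have tend: "((\<lambda>n. exp (- (c * real n) + d)) \<longlongrightarrow> 0) sequentially" if "c > 0" for c d :: real
      using that by real_asymp
    have 1: "\<forall>\<^sub>F n in sequentially. exp (- (\<delta> * real n)) < s0"
      using order_tendstoD(2)[OF tend[of \<delta> 0] AB(3)] \<delta> by simp
    have 2: "\<forall>\<^sub>F n in sequentially. exp (- ((\<delta> - 2 * \<tau>) * real n)) < min \<rho> \<rho>'"
      using order_tendstoD(2)[OF tend[of "\<delta> - 2 * \<tau>" 0], of "min \<rho> \<rho>'"] \<tau> \<rho> \<rho>' by simp
    have 3: "\<forall>\<^sub>F n in sequentially. real (n + 1) / exp (\<tau> * real n) < b - a"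
    proof -
      have "((\<lambda>n. real (n + 1) / exp (\<tau> * real n)) \<longlongrightarrow> 0) sequentially"
        using \<tau>(1) by real_asymp
      then show ?thesis using order_tendstoD(2)[of _ 0 sequentially "b - a"] ab(1) by simp
    qed
    have 4: "\<forall>\<^sub>F n in sequentially. exp (- ((\<delta> * \<kappa> - 2 * \<tau>) * real n) + (E + M * ln L)) < 1 / 2"
      using order_tendstoD(2)[OF tend[of "\<delta> * \<kappa> - 2 * \<tau>" "E + M * ln L"], of "1/2"] \<tau> by simp
    from 1 2 3 4 show ?thesis
    proof eventually_elim
      case (elim n)
      show ?case
      proof (intro allI impI)
        fix w assume w: "set w \<subseteq> {..<k}" "length w = n"
        define s where "s = exp (- (\<delta> * real n))"
        define C where "C = exp (\<tau> * real n)"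
        have s: "0 < s" "s < s0" "\<bar>ln s\<bar> = \<delta> * n" "ln s = - (\<delta> * n)"
          using elim(1) \<delta> by (auto simp: s_def)
        have tk: "set (take j w) \<subseteq> {..<k}" for j using w set_take_subset by fast
        obtain t where t: "t \<in> {a<..<b}" "\<forall>j\<le>n. \<bar>circle_deriv (fold f (take j w)) (to_circle t)\<bar> \<le> C"
          using exists_small_derivatives[of n "\<lambda>j. fold f (take j w)" b a C]
            circle_C1_diffeo_fold[OF f tk] ab(2) elim(3) by (auto simp: C_def)
        define x where "x = to_circle t"
        have xJ: "x \<in> J" using t(1) ab(3) by (auto simp: x_def)
        obtain v where v: "set v \<subseteq> {..<k}" "real (length v) \<le> A * (\<delta> * n) + B"
          "fold f v ` J \<subseteq> cball x s" "\<And>p. p \<in> J \<Longrightarrow> \<bar>circle_deriv (fold f v) p\<bar> \<le> exp (\<kappa> * ln s + E)"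
          using enter[OF xJ s(1,2)] unfolding s(3) by metis
        define y where "y = fold f w x"
        obtain u where u: "set u \<subseteq> {..<k}" "length u \<le> M" "fold f u ` ball y \<rho>' \<subseteq> J"
          using ret by blast
        have small: "C * exp (\<tau> * real n) * s < min \<rho> \<rho>'"
          using elim(2) by (simp add: C_def s_def algebra_simps flip: exp_add)
        have mid: "\<bar>circle_deriv (fold f w) q\<bar> \<le> C * exp (\<tau> * n)"
          "dist (fold f w q) y \<le> C * exp (\<tau> * n) * s" if "dist q x \<le> s" for q
          using dist[of w s C x, rule_format, of n q] w s(1) small t(2) that
          by (auto simp: y_def x_def)
        have toJ: "fold f v p \<in> cball x s" "fold f w (fold f v p) \<in> ball y \<rho>'" if p: "p \<in> J" for p
        proof -
          show *: "fold f v p \<in> cball x s" using v(3) p by blast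
          have "dist (fold f w (fold f v p)) y \<le> C * exp (\<tau> * n) * s"
            using * by (intro mid(2)) (simp add: dist_commute)
          then show "fold f w (fold f v p) \<in> ball y \<rho>'" using small by (simp add: dist_commute)
        qed
        have "fold f (v @ w @ u) ` J \<subseteq> J" using toJ(2) u(3) by auto
        moreover have "\<bar>circle_deriv (fold f (v @ w @ u)) p\<bar> \<le> 1 / 2" if p: "p \<in> J" for p
        proof -
          have "circle_deriv (fold f (v @ (w @ u))) p
            = circle_deriv (fold f u) (fold f w (fold f v p)) * circle_deriv (fold f w) (fold f v p)
              * circle_deriv (fold f v) p"
            using circle_deriv_fold_append[OF f v(1), of "w @ u" p]
              circle_deriv_fold_append[OF f w(1) u(1), of "fold f v p"] w(1) u(1)
            by (simp del: fold_append)
          also have "\<bar>\<dots>\<bar> \<le> L ^ M * (C * exp (\<tau> * n)) * exp (\<kappa> * ln s + E)"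
            unfolding abs_mult
          proof (intro mult_mono)
            have "\<bar>circle_deriv (fold f u) (fold f w (fold f v p))\<bar> \<le> L ^ length u"
              by (rule fold_derivative_bound[OF f L(2,1) u(1)])
            also have "\<dots> \<le> L ^ M" using L(1) u(2) by (intro power_increasing) auto
            finally show "\<bar>circle_deriv (fold f u) (fold f w (fold f v p))\<bar> \<le> L ^ M" .
            show "\<bar>circle_deriv (fold f w) (fold f v p)\<bar> \<le> C * exp (\<tau> * n)"
              using toJ(1)[OF p] by (intro mid(1)) (simp add: dist_commute)
            show "\<bar>circle_deriv (fold f v) p\<bar> \<le> exp (\<kappa> * ln s + E)" by (rule v(4)[OF p])
          qed (use L(1) in \<open>auto simp: C_def\<close>)
          also have "L ^ M = exp (M * ln L)"
            using L(1) by (simp add: exp_of_nat_mult)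
          also have "exp (M * ln L) * (C * exp (\<tau> * n)) * exp (\<kappa> * ln s + E)
            = exp (- ((\<delta> * \<kappa> - 2 * \<tau>) * real n) + (E + M * ln L))"
            unfolding C_def s(4) by (simp add: algebra_simps flip: exp_add)
          finally show ?thesis using elim(4) by linarith
        qed
        ultimately show "\<exists>v u. set v \<subseteq> {..<k} \<and> set u \<subseteq> {..<k} \<and> real (length v) \<le> A * (\<delta> * n) + B \<and>
            length u \<le> M \<and> fold f (v @ w @ u) ` J \<subseteq> J \<and>
            (\<forall>p\<in>J. \<bar>circle_deriv (fold f (v @ w @ u)) p\<bar> \<le> 1 / 2)"
          using v(1,2) u(1,2) by (intro exI[of _ v] exI[of _ u] conjI ballI)
      qed
    qed
  qed
  then show ?thesis using AB(1,2) by (intro exI[of _ A] exI[of _ B] exI[of _ M] conjI allI impI)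
qed

text \<open>Contracting words of a common length \<open>N\<close> whose number has a growth rate above a given nonnegative
  \<open>c < ln k\<close>.\<close>

lemma contracting_horseshoe:
  fixes k :: nat
  assumes k: "k > 0" and f: "\<forall>i<k. circle_C1_diffeo (f i)" and J: "closed_circle_interval J"
    and cec: "CEC_minus k f J" and acc: "Acc_minus k f J" and c: "0 \<le> c" "c < ln k"
  shows "\<exists>N W. N > 0 \<and> finite W \<and> W \<noteq> {} \<and> c * N < ln (card W) \<and>
    (\<forall>w\<in>W. length w = N \<and> set w \<subseteq> {..<k} \<and> fold f w ` J \<subseteq> J \<and>
      (\<forall>p\<in>J. \<bar>circle_deriv (fold f w) p\<bar> \<le> 1 / 2))"
proof -
  from contracting_extension[OF f J cec acc]
  obtain A B :: real and M :: nat where AB: "A > 0" "B > 0" and ext: "\<forall>\<delta>>(0::real). \<forall>\<^sub>F n in sequentially.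
    \<forall>w. set w \<subseteq> {..<k} \<longrightarrow> length w = n \<longrightarrow>
    (\<exists>v u. set v \<subseteq> {..<k} \<and> set u \<subseteq> {..<k} \<and> real (length v) \<le> A * (\<delta> * n) + B \<and> length u \<le> M \<and>
      fold f (v @ w @ u) ` J \<subseteq> J \<and> (\<forall>p\<in>J. \<bar>circle_deriv (fold f (v @ w @ u)) p\<bar> \<le> 1 / 2))"
    by (elim exE conjE)
  \<comment> \<open>Lengthening the words by the factor \<open>1 + A * \<delta>\<close> must keep their growth rate above \<open>c\<close>.\<close>
  define \<delta> where "\<delta> = (ln k - c) / (2 * A * (c + 1))"
  have \<delta>: "\<delta> > 0" using AB(1) c by (simp add: \<delta>_def)
  have "\<delta> * (2 * A * (c + 1)) = ln k - c" using AB(1) c(1) by (simp add: \<delta>_def)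
  then have "A * \<delta> * (c + 1) = (ln k - c) / 2" by (simp add: algebra_simps)
  moreover have "A * \<delta> * c < A * \<delta> * (c + 1)" using AB(1) \<delta> by simp
  ultimately have gap: "c * (1 + A * \<delta>) < ln k" using c by (simp add: algebra_simps)
  define P where "P n = (A * (\<delta> * real n) + B + 1) * (real M + 1)" for n
  have "filterlim (\<lambda>n. real n * (ln k - c * (1 + A * \<delta>)) - c * (B + M)
     - ln ((A * (\<delta> * real n) + B + 1) * (real M + 1))) at_top sequentially"
  proof -
    define g where "g = ln k - c * (1 + A * \<delta>)"
    define m where "m = real M + 1"
    define e where "e = A * \<delta>"
    have "g > 0" "m > 0" "e > 0" "B > 0" using gap AB \<delta> by (auto simp: g_def m_def e_def)
    then have "filterlim (\<lambda>n. real n * g - c * (B + M) - ln ((e * real n + B + 1) * m)) at_top sequentially"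
      by real_asymp
    then show ?thesis by (simp add: g_def m_def e_def mult.assoc)
  qed
  then have pos: "\<forall>\<^sub>F n in sequentially. 0 < real n * (ln k - c * (1 + A * \<delta>)) - c * (B + M) - ln (P n)"
    unfolding P_def filterlim_at_top_dense by (rule spec)
  have "\<forall>\<^sub>F n in sequentially. n > 0 \<and>
      0 < real n * (ln k - c * (1 + A * \<delta>)) - c * (B + M) - ln (P n) \<and>
      (\<forall>w. set w \<subseteq> {..<k} \<longrightarrow> length w = n \<longrightarrow>
        (\<exists>v u. set v \<subseteq> {..<k} \<and> set u \<subseteq> {..<k} \<and> real (length v) \<le> A * (\<delta> * n) + B \<and> length u \<le> M \<and>
        fold f (v @ w @ u) ` J \<subseteq> J \<and> (\<forall>p\<in>J. \<bar>circle_deriv (fold f (v @ w @ u)) p\<bar> \<le> 1 / 2)))"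
    by (intro eventually_conj eventually_gt_at_top pos ext[THEN spec, THEN mp, OF \<delta>])
  from eventually_happens'[OF sequentially_bot this]
  obtain n where n: "n > 0" "0 < real n * (ln k - c * (1 + A * \<delta>)) - c * (B + M) - ln (P n)"
    and ex: "\<forall>w. set w \<subseteq> {..<k} \<longrightarrow> length w = n \<longrightarrow>
        (\<exists>v u. set v \<subseteq> {..<k} \<and> set u \<subseteq> {..<k} \<and> real (length v) \<le> A * (\<delta> * n) + B \<and> length u \<le> M \<and>
        fold f (v @ w @ u) ` J \<subseteq> J \<and> (\<forall>p\<in>J. \<bar>circle_deriv (fold f (v @ w @ u)) p\<bar> \<le> 1 / 2))"
    by (elim exE conjE)
  define S where "S = {w. set w \<subseteq> {..<k} \<and> length w = n}"
  have S: "finite S" "card S = k ^ n"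
    unfolding S_def using card_lists_length_eq[of "{..<k}" n] finite_lists_length_eq[of "{..<k}" n] by auto
  define good where "good w v u \<longleftrightarrow> set v \<subseteq> {..<k} \<and> set u \<subseteq> {..<k} \<and>
      real (length v) \<le> A * (\<delta> * n) + B \<and> length u \<le> M \<and>
      fold f (v @ w @ u) ` J \<subseteq> J \<and> (\<forall>p\<in>J. \<bar>circle_deriv (fold f (v @ w @ u)) p\<bar> \<le> 1 / 2)" for w v u
  have "\<forall>w\<in>S. \<exists>v u. good w v u"
    using ex unfolding S_def good_def by (simp del: fold_append)
  then obtain V U where VU: "\<And>w. w \<in> S \<Longrightarrow> good w (V w) (U w)" by metis
  define Q where "Q = nat \<lfloor>A * (\<delta> * n) + B\<rfloor>"
  have Q: "real Q \<le> A * (\<delta> * n) + B" using AB \<delta> by (simp add: Q_def)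
  define key where "key w = (length (V w), length (U w))" for w
  have "key \<in> S \<rightarrow> {..Q} \<times> {..M}"
    using VU by (auto simp: key_def Q_def good_def le_nat_floor)
  \<comment> \<open>Passing to the most frequent pair of lengths costs only a polynomial factor.\<close>
  then have "\<exists>y\<in>{..Q} \<times> {..M}. card S \<le> card (key -` {y} \<inter> S) * card ({..Q} \<times> {..M})"
    using S(1) by (intro pigeonhole_card) auto
  then obtain y where y: "y \<in> {..Q} \<times> {..M}"
    "card S \<le> card (key -` {y} \<inter> S) * card ({..Q} \<times> {..M})" by (rule bexE)
  define W where "W = (\<lambda>w. V w @ w @ U w) ` (key -` {y} \<inter> S)"
  define N where "N = fst y + n + snd y"
  have "inj_on (\<lambda>w. V w @ w @ U w) (key -` {y} \<inter> S)"
  proof (rule inj_onI)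
    fix w w' assume w: "w \<in> key -` {y} \<inter> S" "w' \<in> key -` {y} \<inter> S" "V w @ w @ U w = V w' @ w' @ U w'"
    from w(1,2) have len: "length (V w) = length (V w')" "length w = length w'"
      by (auto simp: key_def S_def)
    show "w = w'" using append_eq_append_conv[THEN iffD1, OF disjI1, OF len(1) w(3)] len(2) by simp
  qed
  then have cW: "card W = card (key -` {y} \<inter> S)" unfolding W_def by (rule card_image)
  have "real (k ^ n) \<le> real (card W) * real ((Q + 1) * (M + 1))"
    using y(2) unfolding S cW of_nat_mult[symmetric] of_nat_le_iff by simp
  also have "\<dots> \<le> real (card W) * P n"
    using Q unfolding P_def of_nat_mult by (intro mult_left_mono mult_mono) auto
  finally have le: "real (k ^ n) \<le> real (card W) * P n" .
  have Pn: "P n > 0" using AB \<delta> unfolding P_def by (intro mult_pos_pos) (auto intro!: add_nonneg_pos)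
  have "0 < real (k ^ n)" using k by simp
  have Wpos: "card W > 0"
  proof (rule gr0I)
    assume "card W = 0"
    then have "real (card W) * P n = 0" by simp
    with le \<open>0 < real (k ^ n)\<close> show False by linarith
  qed
  have "n * ln k = ln (real (k ^ n))" using k by (simp add: ln_realpow)
  also have "\<dots> \<le> ln (real (card W) * P n)" using le k by (intro ln_mono) auto
  also have "\<dots> = ln (card W) + ln (P n)" using Pn Wpos by (simp add: ln_mult)
  finally have 1: "n * ln k - ln (P n) \<le> ln (card W)" by simp
  have "real N \<le> n * (1 + A * \<delta>) + (B + M)"
  proof -
    have "real (fst y) \<le> real Q" "snd y \<le> M" using y(1) by auto
    then show ?thesis using Q by (simp add: N_def algebra_simps)
  qed
  then have "c * N \<le> c * (n * (1 + A * \<delta>) + (B + M))" using c(1) by (rule mult_left_mono)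
  then have "c * N < ln (card W)" using 1 n(2) by (simp add: algebra_simps)
  moreover have "W \<noteq> {}" "finite W" using Wpos by (auto intro: card_ge_0_finite)
  moreover have w_ok: "length w = N \<and> set w \<subseteq> {..<k} \<and> fold f w ` J \<subseteq> J \<and>
      (\<forall>p\<in>J. \<bar>circle_deriv (fold f w) p\<bar> \<le> 1 / 2)" if wW: "w \<in> W" for w
  proof -
    obtain w' where w': "w = V w' @ w' @ U w'" "w' \<in> S" "key w' = y" 
      using wW unfolding W_def by blast
    have "length w = N" using w'(2,3) unfolding w'(1) N_def S_def key_def by (auto simp del: fold_append)
    moreover have "set w \<subseteq> {..<k}" using w'(2) VU[OF w'(2)] unfolding w'(1) S_def good_def by simp
    ultimately show ?thesis using VU[OF w'(2)] unfolding w'(1) good_def by (elim conjE, intro conjI)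
  qed
  moreover have "N > 0" using n(1) by (simp add: N_def)
  ultimately show ?thesis by (intro exI[of _ N] exI[of _ W] conjI ballI[OF w_ok])
qed

section \<open>Bernoulli measures\<close>

text \<open>The sets that can be approximated in measure by members of a generating algebra form a
  \<open>\<sigma>\<close>-algebra.\<close>

lemma (in finite_measure) approximation_by_algebra:
  assumes alg: "algebra (space M) \<A>" and gen: "sets M = sigma_sets (space M) \<A>"
    and X: "X \<in> sets M" and e: "e > 0"
  shows "\<exists>B\<in>\<A>. measure M ((X - B) \<union> (B - X)) < e"
proof -
  interpret A: algebra "space M" \<A> by (rule alg)
  have sets: "B \<in> sets M" if "B \<in> \<A>" for B using that gen by auto
  have "X \<in> sigma_sets (space M) \<A>" using X gen by simp
  then show ?thesis using e
  proof (induct arbitrary: e)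
    case (Basic a)
    then show ?case by (intro bexI[of _ a]) auto
  next
    case Empty
    then show ?case by (intro bexI[of _ "{}"]) auto
  next
    case (Compl a)
    then obtain B where B: "B \<in> \<A>" "measure M ((a - B) \<union> (B - a)) < e" by blast
    have "a \<subseteq> space M" "B \<subseteq> space M"
      using Compl(1) B(1) gen sets.sets_into_space A.sets_into_space by auto
    then have "(space M - a - (space M - B)) \<union> (space M - B - (space M - a)) = (a - B) \<union> (B - a)" by blast
    with B show ?case by (intro bexI[of _ "space M - B"]) auto
  next
    case (Union a)
    have a: "range a \<subseteq> sets M" using Union(1) gen by auto
    have "(\<lambda>n. measure M (\<Union>i<n. a i)) \<longlonglongrightarrow> measure M (\<Union>n. \<Union>i<n. a i)"
    proof (rule finite_Lim_measure_incseq)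
      show "incseq (\<lambda>n. \<Union>i<n. a i)" unfolding incseq_def by (intro allI impI UN_mono) auto
    qed (use a in auto)
    moreover have "(\<Union>n. \<Union>i<n. a i) = (\<Union>i. a i)" by auto
    ultimately have "(\<lambda>n. measure M (\<Union>i<n. a i)) \<longlonglongrightarrow> measure M (\<Union>i. a i)" by simp
    then have "\<forall>\<^sub>F n in sequentially. measure M (\<Union>i. a i) - e / 2 < measure M (\<Union>i<n. a i)"
      using Union(3) by (intro order_tendstoD) auto
    then obtain n where n: "measure M (\<Union>i. a i) - e / 2 < measure M (\<Union>i<n. a i)"
      using eventually_happens'[OF sequentially_bot] by blast
    define d where "d = e / (2 * real (n + 1))"
    have d: "d > 0" "n * d \<le> e / 2" using Union(3) by (auto simp: d_def field_simps)
    have "\<forall>i. \<exists>B\<in>\<A>. measure M ((a i - B) \<union> (B - a i)) < d" using Union(2) d(1) by blast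
    then obtain B where B: "\<And>i. B i \<in> \<A>" "\<And>i. measure M ((a i - B i) \<union> (B i - a i)) < d" by metis
    let ?B = "\<Union>i<n. B i"
    have sB: "?B \<in> \<A>" using B(1) by (intro A.finite_UN) auto
    have m: "(\<Union>i. a i) \<in> sets M" "(\<Union>i<n. a i) \<in> sets M" "(a i - B i) \<union> (B i - a i) \<in> sets M" for i
      using a B(1) sets by (auto intro!: sets.Un sets.Diff)
    have "measure M (((\<Union>i. a i) - ?B) \<union> (?B - (\<Union>i. a i)))
      \<le> measure M (((\<Union>i. a i) - (\<Union>i<n. a i)) \<union> (\<Union>i<n. (a i - B i) \<union> (B i - a i)))"
      using m by (intro finite_measure_mono) (auto intro!: sets.Un sets.Diff)
    also have "\<dots> \<le> measure M ((\<Union>i. a i) - (\<Union>i<n. a i)) + measure M (\<Union>i<n. (a i - B i) \<union> (B i - a i))"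
      using m by (intro measure_Un_le) auto
    also have "measure M ((\<Union>i. a i) - (\<Union>i<n. a i)) = measure M (\<Union>i. a i) - measure M (\<Union>i<n. a i)"
      using m by (intro finite_measure_Diff) auto
    also have "measure M (\<Union>i<n. (a i - B i) \<union> (B i - a i)) \<le> (\<Sum>i<n. measure M ((a i - B i) \<union> (B i - a i)))"
      using m by (intro measure_UNION_le) auto
    also have "\<dots> \<le> (\<Sum>i<n. d)" using B(2) by (intro sum_mono) (auto intro: less_imp_le)
    also have "\<dots> \<le> e / 2" using d by simp
    finally have "measure M (((\<Union>i. a i) - ?B) \<union> (?B - (\<Union>i. a i))) < e" using n by linarith
    with sB show ?case by blast
  qed
qed

text \<open>The left shift on two-sided sequences over an arbitrary alphabet.\<close>

definition shift_seq :: "(int \<Rightarrow> 'a) \<Rightarrow> int \<Rightarrow> 'a" where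
  "shift_seq \<omega> = (\<lambda>i. \<omega> (i + 1))"

text \<open>The uniform product measure on two-sided sequences over a finite alphabet.\<close>

definition bernoulli :: "'a set \<Rightarrow> (int \<Rightarrow> 'a) measure" where
  "bernoulli W = (\<Pi>\<^sub>M i\<in>UNIV. uniform_count_measure W)"

lemma shift_seq_funpow: "(shift_seq ^^ n) \<omega> = (\<lambda>i. \<omega> (i + int n))"
  by (induct n) (auto simp: shift_seq_def fun_eq_iff algebra_simps)

context
  fixes W :: "'a set"
  assumes W: "finite W" "W \<noteq> {}"
begin

interpretation product_prob_space "\<lambda>_. uniform_count_measure W" "UNIV :: int set"
proof -
  interpret prob_space "uniform_count_measure W" by (rule prob_space_uniform_count_measure[OF W])
  show "product_prob_space (\<lambda>_. uniform_count_measure W)" by unfold_locales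
qed

lemma prob_space_bernoulli: "prob_space (bernoulli W)"
  unfolding bernoulli_def by (rule P.prob_space_axioms)

lemma space_bernoulli: "space (bernoulli W) = {\<omega>. \<forall>i. \<omega> i \<in> W}"
  by (auto simp: bernoulli_def space_PiM space_uniform_count_measure PiE_def)

lemma measurable_bernoulli_component: "(\<lambda>\<omega>. \<omega> i) \<in> measurable (bernoulli W) (count_space W)"
proof -
  have "(\<lambda>\<omega>. \<omega> i) \<in> measurable (bernoulli W) (uniform_count_measure W)"
    unfolding bernoulli_def by (rule measurable_component_singleton) simp
  then show ?thesis
    using measurable_cong_sets[OF refl sets_uniform_count_measure_count_space] by blast
qed

lemma measurable_bernoulli_discrete:
  "(\<And>a. g a \<in> space N) \<Longrightarrow> (\<lambda>\<omega>. g (\<omega> i)) \<in> measurable (bernoulli W) N"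
  by (rule measurable_compose[OF measurable_bernoulli_component]) simp

lemma bernoulli_cylinder:
  assumes "finite I"
  shows "measure (bernoulli W) {\<omega> \<in> space (bernoulli W). \<forall>i\<in>I. \<omega> i = u i} \<le> (1 / card W) ^ card I"
proof -
  have "{\<omega> \<in> space (bernoulli W). \<forall>i\<in>I. \<omega> i = u i} = emb UNIV I (Pi\<^sub>E I (\<lambda>i. W \<inter> {u i}))"
  proof (rule set_eqI)
    fix x :: "int \<Rightarrow> 'a"
    have "x \<in> emb UNIV I (Pi\<^sub>E I (\<lambda>i. W \<inter> {u i})) \<longleftrightarrow> (\<forall>i. x i \<in> W) \<and> (\<forall>i\<in>I. x i \<in> W \<and> x i = u i)"
      by (auto simp: prod_emb_iff space_uniform_count_measure)
    then show "x \<in> {\<omega> \<in> space (bernoulli W). \<forall>i\<in>I. \<omega> i = u i} \<longleftrightarrow> x \<in> emb UNIV I (Pi\<^sub>E I (\<lambda>i. W \<inter> {u i}))"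
      unfolding space_bernoulli mem_Collect_eq by blast
  qed
  then have "measure (bernoulli W) {\<omega> \<in> space (bernoulli W). \<forall>i\<in>I. \<omega> i = u i}
      = (\<Prod>i\<in>I. measure (uniform_count_measure W) (W \<inter> {u i}))"
    using assms unfolding bernoulli_def
    by (simp add: measure_PiM_emb sets_uniform_count_measure)
  also have "\<dots> \<le> (\<Prod>i\<in>I. 1 / card W)"
  proof (intro prod_mono conjI measure_nonneg)
    fix i
    have "card (W \<inter> {u i}) \<le> 1" using card_mono[of "{u i}" "W \<inter> {u i}"] by simp
    then show "measure (uniform_count_measure W) (W \<inter> {u i}) \<le> 1 / card W"
      using W by (simp add: measure_uniform_count_measure divide_right_mono)
  qed
  finally show ?thesis by simp
qed

lemma measurable_shift_seq: "shift_seq \<in> measurable (bernoulli W) (bernoulli W)"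
  unfolding bernoulli_def
  by (rule measurable_PiM_single')
     (auto simp: shift_seq_def space_PiM PiE_iff intro!: measurable_component_singleton)

lemma distr_shift_seq: "distr (bernoulli W) (bernoulli W) shift_seq = bernoulli W"
  using distr_PiM_reindex[of UNIV "\<lambda>_. uniform_count_measure W" "\<lambda>i::int. i + 1" UNIV]
  by (simp add: bernoulli_def shift_seq_def[abs_def] prob_space inj_on_def restrict_UNIV)

lemma bernoulli_preserving:
  "(shift_seq ^^ n) \<in> measurable (bernoulli W) (bernoulli W)"
  "distr (bernoulli W) (bernoulli W) (shift_seq ^^ n) = bernoulli W"
proof -
  show m: "(shift_seq ^^ n) \<in> measurable (bernoulli W) (bernoulli W)" for n
    using measurable_shift_seq by (induct n) (auto intro: measurable_comp)
  show "distr (bernoulli W) (bernoulli W) (shift_seq ^^ n) = bernoulli W"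
  proof (induct n)
    case 0
    then show ?case by (simp add: id_def)
  next
    case (Suc n)
    have "distr (bernoulli W) (bernoulli W) (shift_seq \<circ> (shift_seq ^^ n))
      = distr (distr (bernoulli W) (bernoulli W) (shift_seq ^^ n)) (bernoulli W) shift_seq"
      using measurable_shift_seq m by (simp add: distr_distr)
    then show ?case unfolding funpow.simps Suc distr_shift_seq .
  qed
qed

text \<open>A cylinder set over finitely many coordinates is independent of its preimage under a large
  power of the shift.\<close>

lemma cylinder_mixing:
  assumes B: "B \<in> generator"
  shows "\<exists>n. measure (bernoulli W) (B \<inter> ((shift_seq ^^ n) -` B \<inter> space (bernoulli W)))
    = measure (bernoulli W) B * measure (bernoulli W) B"
proof -
  obtain J X where J: "finite J" "X \<in> sets (Pi\<^sub>M J (\<lambda>_. uniform_count_measure W))" "B = emb UNIV J X"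
    using B by (auto elim: generator.cases)
  let ?M = "bernoulli W" and ?U = "\<lambda>_::int. uniform_count_measure W"
  obtain b where b: "\<And>i. i \<in> J \<Longrightarrow> \<bar>i\<bar> \<le> b"
  proof
    show "\<bar>i\<bar> \<le> Max (insert 0 (abs ` J))" if "i \<in> J" for i using J(1) that by (intro Max_ge) auto
  qed
  define n where "n = nat (2 * b + 1)"
  define K where "K = (\<lambda>i. i + int n) ` J"
  have "i + int n \<notin> J" if "i \<in> J" for i
    using b[of i] b[of "i + int n"] that by (auto simp: n_def)
  then have disj: "J \<inter> K = {}" by (auto simp: K_def)
  define T where "T = (shift_seq ^^ n :: (int \<Rightarrow> 'a) \<Rightarrow> _)"
  have ind: "P.indep_vars ?U (\<lambda>i \<omega>. \<omega> i) UNIV"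
    by (subst P.indep_vars_iff_distr_eq_PiM') (auto simp: PiM_component restrict_UNIV)
  have ind2: "P.indep_var (PiM J ?U) (\<lambda>\<omega>. restrict \<omega> J) (PiM K ?U) (\<lambda>\<omega>. restrict \<omega> K)"
    using P.indep_var_restrict[OF ind disj] by (simp add: restrict_def)
  define X' where "X' = (\<lambda>\<omega>. \<lambda>i\<in>J. \<omega> (i + int n)) -` X \<inter> space (PiM K ?U)"
  have X': "X' \<in> sets (PiM K ?U)"
    unfolding X'_def by (rule measurable_sets[OF measurable_restrict J(2)])
      (auto simp: K_def intro!: measurable_component_singleton)
  have Beq: "B = (\<lambda>\<omega>. restrict \<omega> J) -` X \<inter> space ?M"
    by (simp add: J(3) prod_emb_def bernoulli_def space_PiM Int_commute)
  have Teq: "T -` B \<inter> space ?M = (\<lambda>\<omega>. restrict \<omega> K) -` X' \<inter> space ?M"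
  proof -
    have eq: "restrict (T \<omega>) J = (\<lambda>i\<in>J. restrict \<omega> K (i + int n))" for \<omega>
      by (auto simp: T_def shift_seq_funpow K_def fun_eq_iff restrict_def)
    have "T \<omega> \<in> space ?M" if "\<omega> \<in> space ?M" for \<omega>
      using measurable_space[OF bernoulli_preserving(1) that] by (simp add: T_def)
    moreover have "restrict \<omega> K \<in> space (PiM K ?U)" if "\<omega> \<in> space ?M" for \<omega>
      using that by (auto simp: space_bernoulli space_PiM space_uniform_count_measure)
    ultimately show ?thesis unfolding Beq X'_def by (auto simp: eq)
  qed
  have "B \<in> sets ?M" using B unfolding bernoulli_def by (simp add: sets_PiM_generator)
  have "measure ?M (T -` B \<inter> space ?M) = measure (distr ?M ?M T) B"
    unfolding T_def using bernoulli_preserving(1) \<open>B \<in> sets ?M\<close> by (simp add: measure_distr)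
  then have same: "measure ?M (T -` B \<inter> space ?M) = measure ?M B"
    by (simp add: T_def bernoulli_preserving)
  have "B \<inter> (T -` B \<inter> space ?M)
      = (\<lambda>\<omega>. (restrict \<omega> J, restrict \<omega> K)) -` (X \<times> X') \<inter> space ?M"
    unfolding Teq unfolding Beq by auto
  moreover have "measure ?M ((\<lambda>\<omega>. (restrict \<omega> J, restrict \<omega> K)) -` (X \<times> X') \<inter> space ?M)
      = measure ?M B * measure ?M (T -` B \<inter> space ?M)"
    unfolding Teq unfolding Beq unfolding bernoulli_def by (rule P.indep_varD[OF ind2 J(2) X'])
  ultimately have "measure ?M (B \<inter> (T -` B \<inter> space ?M)) = measure ?M B * measure ?M (T -` B \<inter> space ?M)"
    by simp
  with same show ?thesis unfolding T_def by (intro exI[of _ n]) simp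
qed

text \<open>An invariant set \<open>A\<close> is close to a cylinder set \<open>B\<close> and to its shifted image, so mixing of cylinders forces
  the probability of \<open>A\<close> to equal its square.\<close>

lemma bernoulli_ergodic:
  assumes A: "A \<in> sets (bernoulli W)" "shift_seq -` A \<inter> space (bernoulli W) = A"
  shows "measure (bernoulli W) A = 0 \<or> measure (bernoulli W) A = 1"
proof -
  let ?M = "bernoulli W"
  interpret PM: prob_space ?M by (rule prob_space_bernoulli)
  have inv: "(shift_seq ^^ n) -` A \<inter> space ?M = A" for n
  proof (induct n)
    case 0
    then show ?case using sets.sets_into_space[OF A(1)] by auto
  next
    case (Suc n)
    have "(shift_seq ^^ Suc n) -` A \<inter> space ?M
        = (shift_seq ^^ n) -` (shift_seq -` A \<inter> space ?M) \<inter> space ?M"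
      using measurable_space[OF bernoulli_preserving(1)] by auto
    then show ?case by (simp only: A(2) Suc)
  qed
  have "\<bar>PM.prob A - PM.prob A * PM.prob A\<bar> \<le> 0 + e" if e: "e > 0" for e
  proof -
    have "\<exists>B\<in>generator. PM.prob ((A - B) \<union> (B - A)) < e / 4"
      using e A(1) unfolding bernoulli_def
      by (intro P.approximation_by_algebra algebra_generator sets_PiM_generator) auto
    then obtain B where B: "B \<in> generator" "PM.prob ((A - B) \<union> (B - A)) < e / 4" by blast
    have sB: "B \<in> sets ?M" using B unfolding bernoulli_def by (simp add: sets_PiM_generator)
    obtain n where n: "PM.prob (B \<inter> ((shift_seq ^^ n) -` B \<inter> space ?M)) = PM.prob B * PM.prob B"
      using cylinder_mixing[OF B(1)] by blast
    define C where "C = (shift_seq ^^ n) -` B \<inter> space ?M"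
    have sC: "C \<in> sets ?M" unfolding C_def using bernoulli_preserving(1) sB by (rule measurable_sets)
    have "(A - C) \<union> (C - A) = (shift_seq ^^ n) -` ((A - B) \<union> (B - A)) \<inter> space ?M"
      using inv[of n] unfolding C_def by auto
    then have "PM.prob ((A - C) \<union> (C - A)) = measure (distr ?M ?M (shift_seq ^^ n)) ((A - B) \<union> (B - A))"
      using bernoulli_preserving(1) A(1) sB by (simp add: measure_distr)
    then have C: "PM.prob ((A - C) \<union> (C - A)) < e / 4" using B(2) by (simp add: bernoulli_preserving)
    have diff: "\<bar>PM.prob A - PM.prob D\<bar> \<le> PM.prob ((A - D) \<union> (D - A))" if "D \<in> sets ?M" for D
    proof -
      have "PM.prob A \<le> PM.prob (D \<union> ((A - D) \<union> (D - A)))" "PM.prob D \<le> PM.prob (A \<union> ((A - D) \<union> (D - A)))"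
        using A(1) that by (auto intro!: PM.finite_measure_mono)
      moreover have "PM.prob (D \<union> ((A - D) \<union> (D - A))) \<le> PM.prob D + PM.prob ((A - D) \<union> (D - A))"
        "PM.prob (A \<union> ((A - D) \<union> (D - A))) \<le> PM.prob A + PM.prob ((A - D) \<union> (D - A))"
        using A(1) that by (auto intro!: measure_Un_le)
      ultimately show ?thesis by linarith
    qed
    have "PM.prob ((A - B \<inter> C) \<union> (B \<inter> C - A)) \<le> PM.prob (((A - B) \<union> (B - A)) \<union> ((A - C) \<union> (C - A)))"
      using A(1) sB sC by (intro PM.finite_measure_mono) auto
    also have "\<dots> \<le> PM.prob ((A - B) \<union> (B - A)) + PM.prob ((A - C) \<union> (C - A))"
      using A(1) sB sC by (intro measure_Un_le) auto
    finally have 1: "\<bar>PM.prob A - PM.prob B * PM.prob B\<bar> \<le> e / 2"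
      using diff[of "B \<inter> C"] sB sC B(2) C n unfolding C_def[symmetric] by auto
    have 2: "\<bar>PM.prob A - PM.prob B\<bar> \<le> e / 4" using diff[OF sB] B(2) by simp
    have "PM.prob A * PM.prob A - PM.prob B * PM.prob B = (PM.prob A - PM.prob B) * (PM.prob A + PM.prob B)"
      by (simp add: algebra_simps)
    then have "\<bar>PM.prob A * PM.prob A - PM.prob B * PM.prob B\<bar> = \<bar>PM.prob A - PM.prob B\<bar> * (PM.prob A + PM.prob B)"
      by (simp add: abs_mult)
    also have "\<dots> \<le> e / 4 * 2"
      using 2 add_mono[OF PM.prob_le_1[of A] PM.prob_le_1[of B]] e by (intro mult_mono) auto
    finally show ?thesis using 1 by linarith
  qed
  then have "\<bar>PM.prob A - PM.prob A * PM.prob A\<bar> \<le> 0" by (rule field_le_epsilon)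
  then have "PM.prob A * (1 - PM.prob A) = 0" by (simp add: algebra_simps)
  then show ?thesis by auto
qed

end

section \<open>Suspensions of ergodic systems\<close>

text \<open>Let \<open>\<Phi>\<close> be a semiconjugacy from an ergodic system \<open>(B, S)\<close> to the \<open>N\<close>-th power of \<open>T\<close>. The average
  of the images of \<open>B\<close> under \<open>\<Phi>, T \<circ> \<Phi>, ..., T ^^ (N - 1) \<circ> \<Phi>\<close> is an ergodic measure for \<open>T\<close>; it is obtained
  here by choosing the exponent uniformly at random.\<close>

definition suspension_measure ::
    "'a::topological_space set \<Rightarrow> ('a \<Rightarrow> 'a) \<Rightarrow> 'b measure \<Rightarrow> ('b \<Rightarrow> 'a) \<Rightarrow> nat \<Rightarrow> 'a measure" where
  "suspension_measure X T B \<Phi> N =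
     distr (B \<Otimes>\<^sub>M uniform_count_measure {..<N}) (restrict_space borel X) (\<lambda>(\<omega>, j). (T ^^ j) (\<Phi> \<omega>))"

locale suspension = prob_space B
  for B :: "'b measure" and S :: "'b \<Rightarrow> 'b" +
  fixes X :: "'a::topological_space set" and T :: "'a \<Rightarrow> 'a" and \<Phi> :: "'b \<Rightarrow> 'a" and N :: nat
  assumes S: "S \<in> measurable B B" and S_preserving: "distr B B S = B"
    and ergodic: "\<And>A. A \<in> sets B \<Longrightarrow> S -` A \<inter> space B = A \<Longrightarrow> prob A = 0 \<or> prob A = 1"
    and T: "T \<in> measurable (restrict_space borel X) (restrict_space borel X)"
    and \<Phi>: "\<Phi> \<in> measurable B (restrict_space borel X)"
    and semiconj: "\<And>\<omega>. \<omega> \<in> space B \<Longrightarrow> (T ^^ N) (\<Phi> \<omega>) = \<Phi> (S \<omega>)"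
    and N: "N > 0"
begin

abbreviation "\<mu> \<equiv> suspension_measure X T B \<Phi> N"

lemma T_iterate: "(T ^^ j) \<in> measurable (restrict_space borel X) (restrict_space borel X)"
  using T by (induct j) (auto intro: measurable_comp)

lemma T_iterate_\<Phi>: "(\<lambda>\<omega>. (T ^^ j) (\<Phi> \<omega>)) \<in> measurable B (restrict_space borel X)"
  using measurable_compose[OF \<Phi> T_iterate] .

lemma T_iterate_\<Phi>_pair:
  "(\<lambda>(\<omega>, j). (T ^^ j) (\<Phi> \<omega>)) \<in> measurable (B \<Otimes>\<^sub>M uniform_count_measure {..<N}) (restrict_space borel X)"
proof -
  have "(\<lambda>p. (T ^^ snd p) (\<Phi> (fst p)))
      \<in> measurable (B \<Otimes>\<^sub>M uniform_count_measure {..<N}) (restrict_space borel X)"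
  proof (rule measurable_compose_countable'[where f = "\<lambda>i p. (T ^^ i) (\<Phi> (fst p))" and g = snd and I = "{..<N}"])
    show "(\<lambda>p. (T ^^ i) (\<Phi> (fst p))) \<in> measurable (B \<Otimes>\<^sub>M uniform_count_measure {..<N}) (restrict_space borel X)" for i
      by (rule measurable_compose[OF measurable_fst T_iterate_\<Phi>])
    have "snd \<in> measurable (B \<Otimes>\<^sub>M uniform_count_measure {..<N}) (uniform_count_measure {..<N})" by (rule measurable_snd)
    then show "snd \<in> measurable (B \<Otimes>\<^sub>M uniform_count_measure {..<N}) (count_space {..<N})"
      using measurable_cong_sets[OF refl sets_uniform_count_measure_count_space] by blast
  qed auto
  then show ?thesis by (simp add: case_prod_beta')
qed

lemma sets_suspension: "sets \<mu> = sets (restrict_space borel X)" "space \<mu> = X"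
  by (auto simp: suspension_measure_def space_restrict_space)

lemma prob_space_suspension: "prob_space \<mu>"
proof -
  interpret U: prob_space "uniform_count_measure {..<N}"
    using N by (intro prob_space_uniform_count_measure) auto
  interpret pair_prob_space B "uniform_count_measure {..<N}" ..
  show ?thesis unfolding suspension_measure_def
    using T_iterate_\<Phi>_pair by (rule prob_space_distr)
qed

lemma suspension_integral:
  fixes g :: "'a \<Rightarrow> real"
  assumes g: "g \<in> borel_measurable (restrict_space borel X)" and bound: "\<And>p. p \<in> X \<Longrightarrow> \<bar>g p\<bar> \<le> C"
  shows "integral\<^sup>L \<mu> g = (\<Sum>j<N. \<integral>\<omega>. g ((T ^^ j) (\<Phi> \<omega>)) \<partial>B) / N"
    and "integrable B (\<lambda>\<omega>. g ((T ^^ j) (\<Phi> \<omega>)))"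
proof -
  interpret U: prob_space "uniform_count_measure {..<N}"
    using N by (intro prob_space_uniform_count_measure) auto
  interpret P: pair_prob_space B "uniform_count_measure {..<N}" ..
  have m: "(\<lambda>p. g ((\<lambda>(\<omega>, j). (T ^^ j) (\<Phi> \<omega>)) p)) \<in> borel_measurable (B \<Otimes>\<^sub>M uniform_count_measure {..<N})"
    using measurable_compose[OF T_iterate_\<Phi>_pair g] .
  have "\<bar>g ((\<lambda>(\<omega>, j). (T ^^ j) (\<Phi> \<omega>)) p)\<bar> \<le> C" if "p \<in> space (B \<Otimes>\<^sub>M uniform_count_measure {..<N})" for p
    using measurable_space[OF T_iterate_\<Phi>_pair that] by (intro bound) (simp add: space_restrict_space)
  then have "integrable (B \<Otimes>\<^sub>M uniform_count_measure {..<N}) (\<lambda>p. g ((\<lambda>(\<omega>, j). (T ^^ j) (\<Phi> \<omega>)) p))"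
    using m by (intro P.P.integrable_const_bound[of _ C]) auto
  then have int: "integrable (B \<Otimes>\<^sub>M uniform_count_measure {..<N}) (case_prod (\<lambda>\<omega> j. g ((T ^^ j) (\<Phi> \<omega>))))"
    by (simp add: case_prod_beta')
  have "integral\<^sup>L \<mu> g = integral\<^sup>L (B \<Otimes>\<^sub>M uniform_count_measure {..<N}) (case_prod (\<lambda>\<omega> j. g ((T ^^ j) (\<Phi> \<omega>))))"
    unfolding suspension_measure_def using T_iterate_\<Phi>_pair g
    by (simp add: integral_distr case_prod_beta')
  also have "\<dots> = (\<integral>j. (\<integral>\<omega>. g ((T ^^ j) (\<Phi> \<omega>)) \<partial>B) \<partial>uniform_count_measure {..<N})"
    using P.integral_snd[OF int] by simp
  also have "\<dots> = (\<Sum>j<N. \<integral>\<omega>. g ((T ^^ j) (\<Phi> \<omega>)) \<partial>B) / N"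
    by (simp add: integral_uniform_count_measure)
  finally show "integral\<^sup>L \<mu> g = (\<Sum>j<N. \<integral>\<omega>. g ((T ^^ j) (\<Phi> \<omega>)) \<partial>B) / N" .
  have "\<bar>g ((T ^^ j) (\<Phi> \<omega>))\<bar> \<le> C" if "\<omega> \<in> space B" for \<omega>
    using measurable_space[OF T_iterate_\<Phi> that] by (intro bound) (simp add: space_restrict_space)
  then show "integrable B (\<lambda>\<omega>. g ((T ^^ j) (\<Phi> \<omega>)))"
    using measurable_compose[OF T_iterate_\<Phi> g] by (intro integrable_const_bound[of _ C]) auto
qed

lemma suspension_prob:
  assumes A: "A \<in> sets (restrict_space borel X)"
  shows "measure \<mu> A = (\<Sum>j<N. prob ((\<lambda>\<omega>. (T ^^ j) (\<Phi> \<omega>)) -` A \<inter> space B)) / N"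
proof -
  interpret M: prob_space \<mu> by (rule prob_space_suspension)
  have A': "A \<in> sets \<mu>" "A \<subseteq> X" using A sets.sets_into_space[OF A] by (auto simp: sets_suspension space_restrict_space)
  have "measure \<mu> A = integral\<^sup>L \<mu> (indicat_real A)"
    using A' sets_suspension(2) by (simp add: Int_absorb2)
  also have "\<dots> = (\<Sum>j<N. \<integral>\<omega>. indicator A ((T ^^ j) (\<Phi> \<omega>)) \<partial>B) / N"
    using A by (intro suspension_integral(1)[where C = 1]) (auto simp: indicator_def)
  also have "\<dots> = (\<Sum>j<N. prob ((\<lambda>\<omega>. (T ^^ j) (\<Phi> \<omega>)) -` A \<inter> space B)) / N"
  proof (intro arg_cong2[where f = "(/)"] sum.cong refl)
    fix j
    show "(\<integral>\<omega>. indicat_real A ((T ^^ j) (\<Phi> \<omega>)) \<partial>B) = prob ((\<lambda>\<omega>. (T ^^ j) (\<Phi> \<omega>)) -` A \<inter> space B)"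
    proof -
      have "(\<integral>\<omega>. indicat_real A ((T ^^ j) (\<Phi> \<omega>)) \<partial>B) = (\<integral>\<omega>. indicat_real ((\<lambda>\<omega>. (T ^^ j) (\<Phi> \<omega>)) -` A \<inter> space B) \<omega> \<partial>B)"
        by (intro Bochner_Integration.integral_cong) (auto simp: indicator_def)
      then show ?thesis by simp
    qed
  qed
  finally show ?thesis .
qed

lemma suspension_ergodic: "\<mu> \<in> ergodic_measures X T"
proof -
  interpret M: prob_space \<mu> by (rule prob_space_suspension)
  have TM: "T \<in> measurable \<mu> \<mu>"
    using T measurable_cong_sets[OF sets_suspension(1) sets_suspension(1)] by blast
  have \<Phi>X: "(T ^^ j) (\<Phi> \<omega>) \<in> X" if "\<omega> \<in> space B" for \<omega> j
    using measurable_space[OF T_iterate_\<Phi> that] by (simp add: space_restrict_space)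
  have "distr \<mu> \<mu> T = \<mu>"
  proof (rule measure_eqI)
    fix A assume "A \<in> sets (distr \<mu> \<mu> T)"
    then have A: "A \<in> sets \<mu>" "A \<in> sets (restrict_space borel X)" by (auto simp: sets_suspension)
    define a where "a j = prob ((\<lambda>\<omega>. (T ^^ j) (\<Phi> \<omega>)) -` A \<inter> space B)" for j
    have TA: "T -` A \<inter> X \<in> sets (restrict_space borel X)"
      using measurable_sets[OF T A(2)] by (simp add: space_restrict_space)
    have "(\<lambda>\<omega>. (T ^^ j) (\<Phi> \<omega>)) -` (T -` A \<inter> X) \<inter> space B = (\<lambda>\<omega>. (T ^^ Suc j) (\<Phi> \<omega>)) -` A \<inter> space B" for j
      using \<Phi>X by auto
    then have "measure \<mu> (T -` A \<inter> X) = (\<Sum>j<N. a (Suc j)) / N"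
      using suspension_prob[OF TA] by (simp add: a_def del: funpow.simps)
    also have "(\<Sum>j<N. a (Suc j)) = (\<Sum>j<N. a j) + a N - a 0"
      using sum.lessThan_Suc_shift[of a N] sum.lessThan_Suc[of a N] by simp
    also have "a N = a 0"
    proof -
      have D: "\<Phi> -` A \<inter> space B \<in> sets B" using \<Phi> A(2) by (rule measurable_sets)
      have "(\<lambda>\<omega>. (T ^^ N) (\<Phi> \<omega>)) -` A \<inter> space B = S -` (\<Phi> -` A \<inter> space B) \<inter> space B"
        using semiconj measurable_space[OF S] by auto
      then have "a N = measure (distr B B S) (\<Phi> -` A \<inter> space B)"
        using S D by (simp add: a_def measure_distr)
      then show ?thesis by (simp add: S_preserving a_def)
    qed
    also have "((\<Sum>j<N. a j) + a 0 - a 0) / N = measure \<mu> A"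
      using suspension_prob[OF A(2)] by (simp add: a_def)
    finally show "emeasure (distr \<mu> \<mu> T) A = emeasure \<mu> A"
      using TM A by (simp add: emeasure_distr sets_suspension M.emeasure_eq_measure)
  qed simp
  moreover have "measure \<mu> A = 0 \<or> measure \<mu> A = 1" if A: "A \<in> sets \<mu>" "T -` A \<inter> X = A" for A
  proof -
    have A': "A \<in> sets (restrict_space borel X)" using A(1) by (simp add: sets_suspension)
    have inv: "(T ^^ j) p \<in> A \<longleftrightarrow> p \<in> A" if "p \<in> X" for j p
      using that
    proof (induct j arbitrary: p)
      case (Suc j)
      have "T p \<in> X" using measurable_space[OF T] Suc(2) by (simp add: space_restrict_space)
      then have "(T ^^ j) (T p) \<in> A \<longleftrightarrow> T p \<in> A" by (rule Suc(1))
      then show ?case using A(2) Suc(2) by (auto simp: funpow_swap1)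
    qed simp
    define D where "D = \<Phi> -` A \<inter> space B"
    have D: "D \<in> sets B" unfolding D_def using \<Phi> A' by (rule measurable_sets)
    have eq: "(\<lambda>\<omega>. (T ^^ j) (\<Phi> \<omega>)) -` A \<inter> space B = D" for j
      using inv \<Phi>X[of _ 0] by (auto simp: D_def)
    have "S -` D \<inter> space B = (\<lambda>\<omega>. (T ^^ N) (\<Phi> \<omega>)) -` A \<inter> space B"
      using semiconj measurable_space[OF S] by (auto simp: D_def)
    then have "S -` D \<inter> space B = D" using eq by simp
    then have "prob D = 0 \<or> prob D = 1" using ergodic D by blast
    moreover have "measure \<mu> A = prob D" using suspension_prob[OF A'] N by (simp add: eq)
    ultimately show ?thesis by simp
  qed
  ultimately show ?thesis
    unfolding ergodic_measures_def
    using TM sets_suspension prob_space_suspension by simp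
qed

end

section \<open>Partitions and their dynamical joins\<close>

lemma partition_entropy_ge:
  assumes "prob_space \<mu>" "finite P" "P \<subseteq> sets \<mu>" "disjoint P" "\<Union>P = space \<mu>"
    and \<delta>: "\<And>A. A \<in> P \<Longrightarrow> measure \<mu> A \<le> \<delta>"
  shows "- ln \<delta> \<le> partition_entropy \<mu> P"
proof -
  interpret prob_space \<mu> by fact
  have "(\<Sum>A\<in>P. prob A) = prob (\<Union>P)"
    using assms by (intro measure_Union'[symmetric]) (auto simp: fmeasurable_eq_sets disjoint_def pairwise_def disjnt_def)
  also have "\<dots> = 1" using assms prob_space by simp
  finally have 1: "(\<Sum>A\<in>P. prob A) = 1" .
  have "- ln \<delta> = - ((\<Sum>A\<in>P. prob A) * ln \<delta>)" by (simp add: 1)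
  also have "\<dots> \<le> - (\<Sum>A\<in>P. prob A * ln (prob A))"
    unfolding neg_le_iff_le sum_distrib_right
  proof (intro sum_mono)
    fix A assume "A \<in> P"
    then show "prob A * ln (prob A) \<le> prob A * ln \<delta>"
      using \<delta>[of A] measure_nonneg[of \<mu> A] by (cases "prob A = 0") (auto simp: less_le intro!: mult_left_mono ln_mono)
  qed
  finally show ?thesis by (simp add: partition_entropy_def)
qed

text \<open>Only the values of the choice functions below \<open>n\<close> matter, so finitely many functions suffice.\<close>

lemma dynamical_join_image:
  "dynamical_join X T P n = (\<lambda>A. {x \<in> X. \<forall>i<n. (T ^^ i) x \<in> A i}) ` (\<Pi>\<^sub>E i\<in>{..<n}. P)"
proof (intro equalityI subsetI)
  fix C assume "C \<in> dynamical_join X T P n"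
  then obtain A where A: "A \<in> {..<n} \<rightarrow> P" "C = {x \<in> X. \<forall>i<n. (T ^^ i) x \<in> A i}"
    by (auto simp: dynamical_join_def)
  then have "C = {x \<in> X. \<forall>i<n. (T ^^ i) x \<in> restrict A {..<n} i}" by auto
  moreover have "restrict A {..<n} \<in> (\<Pi>\<^sub>E i\<in>{..<n}. P)" using A(1) by auto
  ultimately show "C \<in> (\<lambda>A. {x \<in> X. \<forall>i<n. (T ^^ i) x \<in> A i}) ` (\<Pi>\<^sub>E i\<in>{..<n}. P)" by blast
qed (auto simp: dynamical_join_def PiE_iff Pi_iff)

lemma finite_dynamical_join: "finite P \<Longrightarrow> finite (dynamical_join X T P n)"
  unfolding dynamical_join_image by (intro finite_imageI finite_PiE) auto

lemma disjoint_dynamical_join: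
  assumes "disjoint P"
  shows "disjoint (dynamical_join X T P n)"
proof (rule disjointI)
  fix C D assume C: "C \<in> dynamical_join X T P n" and D: "D \<in> dynamical_join X T P n" and ne: "C \<noteq> D"
  obtain A where A: "A \<in> {..<n} \<rightarrow> P" "C = {x \<in> X. \<forall>i<n. (T ^^ i) x \<in> A i}"
    using C by (auto simp: dynamical_join_def)
  obtain B where B: "B \<in> {..<n} \<rightarrow> P" "D = {x \<in> X. \<forall>i<n. (T ^^ i) x \<in> B i}"
    using D by (auto simp: dynamical_join_def)
  obtain i where i: "i < n" "A i \<noteq> B i" using ne unfolding A(2) B(2) by blast
  then have "A i \<inter> B i = {}" using A(1) B(1) disjointD[OF assms] by (auto simp: Pi_iff)
  with i(1) show "C \<inter> D = {}" unfolding A(2) B(2) by blast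
qed

lemma Union_dynamical_join:
  assumes "T ` X \<subseteq> X" "\<Union>P = X"
  shows "\<Union>(dynamical_join X T P n) = X"
proof -
  have TX: "(T ^^ i) x \<in> X" if "x \<in> X" for i x
    using that assms(1) by (induct i) auto
  have "x \<in> \<Union>(dynamical_join X T P n)" if x: "x \<in> X" for x
  proof -
    have "\<forall>i. \<exists>A\<in>P. (T ^^ i) x \<in> A" using TX[OF x] assms(2) by blast
    then obtain A where A: "\<And>i. A i \<in> P" "\<And>i. (T ^^ i) x \<in> A i" by metis
    then have "{y \<in> X. \<forall>i<n. (T ^^ i) y \<in> A i} \<in> dynamical_join X T P n"
      unfolding dynamical_join_def by blast
    with A(2) x show ?thesis by blast
  qed
  then show ?thesis by (auto simp: dynamical_join_def)
qed

lemma dynamical_join_sets: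
  assumes "space M = X" "T \<in> measurable M M" "P \<subseteq> sets M"
  shows "dynamical_join X T P n \<subseteq> sets M"
proof
  fix C assume "C \<in> dynamical_join X T P n"
  then obtain A where A: "A \<in> {..<n} \<rightarrow> P" "C = {x \<in> X. \<forall>i<n. (T ^^ i) x \<in> A i}"
    by (auto simp: dynamical_join_def)
  have m: "(T ^^ i) \<in> measurable M M" for i
  proof (induct i)
    case (Suc i)
    then show ?case unfolding funpow.simps using assms(2) by (rule measurable_comp)
  qed simp
  have "{x \<in> space M. (T ^^ i) x \<in> A i} \<in> sets M" if "i < n" for i
  proof -
    have "A i \<in> sets M" using A(1) assms(3) that by auto
    with m have "(T ^^ i) -` A i \<inter> space M \<in> sets M" by (rule measurable_sets)
    moreover have "{x \<in> space M. (T ^^ i) x \<in> A i} = (T ^^ i) -` A i \<inter> space M" by blast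
    ultimately show ?thesis by simp
  qed
  then have "{x \<in> space M. \<forall>i\<in>{..<n}. (T ^^ i) x \<in> A i} \<in> sets M"
    by (rule sets.sets_Collect_finite_All) simp_all
  moreover have "C = {x \<in> space M. \<forall>i\<in>{..<n}. (T ^^ i) x \<in> A i}" using A(2) assms(1) by blast
  ultimately show "C \<in> sets M" by simp
qed

section \<open>Step skew-products\<close>

lemma skew_product_iterate:
  "(skew_product f ^^ n) p = ((\<lambda>i. fst p (i + int n)), fold f (map (\<lambda>i. fst p (int i)) [0..<n]) (snd p))"
proof (induct n)
  case (Suc n)
  then show ?case by (simp add: skew_product_def shift_def fun_eq_iff algebra_simps)
qed simp

lemma skew_product_in_space: "p \<in> skew_space k \<Longrightarrow> skew_product f p \<in> skew_space k"
  by (auto simp: skew_space_def skew_product_def full_shift_def shift_def)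

lemma skew_product_iterate_in_space: "p \<in> skew_space k \<Longrightarrow> (skew_product f ^^ n) p \<in> skew_space k"
  by (induct n) (auto simp: skew_product_in_space)

lemma skew_space_symbol: "p \<in> skew_space k \<Longrightarrow> fst p i < k"
  by (auto simp: skew_space_def full_shift_def)

lemma skew_space_word: "p \<in> skew_space k \<Longrightarrow> set (map (\<lambda>i. fst p (int i)) [0..<n]) \<subseteq> {..<k}"
  using skew_space_symbol by fastforce

lemma open_symbol: "open {p :: (int \<Rightarrow> nat) \<times> circle. fst p i = a}"
proof -
  have "continuous_on UNIV (\<lambda>p :: (int \<Rightarrow> nat) \<times> circle. fst p i)"
    by (rule continuous_on_product_then_coordinatewise[OF continuous_on_fst[OF continuous_on_id]])
  then have "open ((\<lambda>p :: (int \<Rightarrow> nat) \<times> circle. fst p i) -` {a})"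
    unfolding continuous_on_open_vimage[OF open_UNIV] using Topological_Spaces.open_discrete[of "{a}"] by simp
  then show ?thesis by (simp add: vimage_def)
qed

lemma measurable_symbol:
  "(\<lambda>p. fst p i) \<in> measurable (restrict_space borel (skew_space k)) (count_space {..<k})"
proof -
  have "(\<lambda>p. fst p i) -` {a} \<inter> space (restrict_space borel (skew_space k))
      \<in> sets (restrict_space borel (skew_space k))" for a
  proof -
    have "(\<lambda>p. fst p i) -` {a} \<inter> space (restrict_space borel (skew_space k))
      = skew_space k \<inter> {p. fst p i = a}" by (auto simp: space_restrict_space)
    then show ?thesis using borel_open[OF open_symbol[of i a]] unfolding sets_restrict_space by blast
  qed
  then show ?thesis
    by (subst measurable_count_space_eq_countable)
       (auto simp: space_restrict_space skew_space_symbol)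
qed

lemma measurable_fiber:
  assumes "\<And>i. i < k \<Longrightarrow> continuous_on UNIV (g i :: circle \<Rightarrow> 'a::topological_space)"
  shows "(\<lambda>p. g (fst p 0) (snd p)) \<in> measurable (restrict_space borel (skew_space k)) borel"
proof (rule measurable_compose_countable'[where f = "\<lambda>i p. g i (snd p)" and I = "{..<k}"])
  fix i assume "i \<in> {..<k}"
  then have "continuous_on UNIV (\<lambda>p :: (int \<Rightarrow> nat) \<times> circle. g i (snd p))"
    using assms by (intro continuous_on_compose2[of UNIV "g i" UNIV snd] continuous_on_snd continuous_on_id) auto
  then show "(\<lambda>p. g i (snd p)) \<in> measurable (restrict_space borel (skew_space k)) borel"
    by (intro measurable_restrict_space1 borel_measurable_continuous_onI)
qed (auto intro: measurable_symbol)

lemma measurable_into_skew_space: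
  assumes "\<And>i. (\<lambda>x. \<xi> x i) \<in> measurable M (borel :: nat measure)" "\<phi> \<in> borel_measurable M"
    and "\<And>x. x \<in> space M \<Longrightarrow> \<xi> x \<in> full_shift k"
  shows "(\<lambda>x. (\<xi> x, \<phi> x)) \<in> measurable M (restrict_space borel (skew_space k))"
proof (rule measurable_restrict_space2)
  have "\<xi> \<in> borel_measurable M" by (rule measurable_coordinatewise_then_product[OF assms(1)])
  then show "(\<lambda>x. (\<xi> x, \<phi> x)) \<in> borel_measurable M" using assms(2) by (rule borel_measurable_Pair)
qed (use assms(3) in \<open>auto simp: skew_space_def\<close>)

lemma measurable_skew_product:
  assumes f: "\<forall>i<k. circle_C1_diffeo (f i)"
  shows "skew_product f \<in> measurable (restrict_space borel (skew_space k)) (restrict_space borel (skew_space k))"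
proof -
  have "(\<lambda>p. (shift (fst p), f (fst p 0) (snd p)))
    \<in> measurable (restrict_space borel (skew_space k)) (restrict_space borel (skew_space k))"
  proof (rule measurable_into_skew_space)
    show "(\<lambda>p. shift (fst p) i) \<in> borel_measurable (restrict_space borel (skew_space k))" for i
      unfolding shift_def
      by (rule measurable_compose[OF measurable_symbol[of "i + 1"]]) simp
    show "(\<lambda>p. f (fst p 0) (snd p)) \<in> borel_measurable (restrict_space borel (skew_space k))"
      using f by (intro measurable_fiber circle_C1_diffeoD) auto
  qed (auto simp: skew_space_def full_shift_def shift_def space_restrict_space)
  then show ?thesis by (simp add: skew_product_def case_prod_beta')
qed

text \<open>The Birkhoff sums of the logarithmic fiber derivative are, by the chain rule, the logarithmic derivatives
  of the compositions along words.\<close>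

lemma log_fiber_derivative:
  assumes f: "\<forall>i<k. circle_C1_diffeo (f i)"
  defines "g \<equiv> \<lambda>p. ln \<bar>circle_deriv (f (fst p 0)) (snd p)\<bar>"
  shows "g \<in> borel_measurable (restrict_space borel (skew_space k))"
    and "\<exists>C. \<forall>p\<in>skew_space k. \<bar>g p\<bar> \<le> C"
    and "p \<in> skew_space k \<Longrightarrow> (\<Sum>j<n. g ((skew_product f ^^ j) p))
      = ln \<bar>circle_deriv (fold f (map (\<lambda>i. fst p (int i)) [0..<n])) (snd p)\<bar>"
proof -
  have c: "continuous_on UNIV (\<lambda>x. ln \<bar>circle_deriv (f i) x\<bar>)" if "i < k" for i
    using f that circle_deriv_nonzero by (intro continuous_intros circle_C1_diffeoD) auto
  show "g \<in> borel_measurable (restrict_space borel (skew_space k))"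
    unfolding g_def by (rule measurable_fiber[OF c])
  have "\<forall>i. \<exists>C. i < k \<longrightarrow> (\<forall>x. \<bar>ln \<bar>circle_deriv (f i) x\<bar>\<bar> \<le> C)"
  proof
    fix i
    show "\<exists>C. i < k \<longrightarrow> (\<forall>x. \<bar>ln \<bar>circle_deriv (f i) x\<bar>\<bar> \<le> C)"
    proof (cases "i < k")
      case True
      then have "bounded ((\<lambda>x. ln \<bar>circle_deriv (f i) x\<bar>) ` UNIV)"
        by (intro compact_imp_bounded compact_continuous_image c compact_UNIV_circle)
      then show ?thesis by (auto simp: bounded_iff)
    qed simp
  qed
  then obtain C where C: "\<And>i x. i < k \<Longrightarrow> \<bar>ln \<bar>circle_deriv (f i) x\<bar>\<bar> \<le> C i" by metis
  have "\<bar>g p\<bar> \<le> (\<Sum>i<k. \<bar>C i\<bar>)" if "p \<in> skew_space k" for p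
  proof -
    have "fst p 0 < k" using that by (rule skew_space_symbol)
    then have "\<bar>C (fst p 0)\<bar> \<le> (\<Sum>i<k. \<bar>C i\<bar>)"
      by (intro member_le_sum[of "fst p 0" "{..<k}" "\<lambda>i. \<bar>C i\<bar>"]) auto
    then show ?thesis using C[OF \<open>fst p 0 < k\<close>, of "snd p"] unfolding g_def by linarith
  qed
  then show "\<exists>C. \<forall>p\<in>skew_space k. \<bar>g p\<bar> \<le> C" by blast
  assume p: "p \<in> skew_space k"
  show "(\<Sum>j<n. g ((skew_product f ^^ j) p))
      = ln \<bar>circle_deriv (fold f (map (\<lambda>i. fst p (int i)) [0..<n])) (snd p)\<bar>"
  proof (induct n)
    case 0
    then show ?case by (simp add: id_def circle_C1_id)
  next
    case (Suc n)
    let ?w = "map (\<lambda>i. fst p (int i)) [0..<n]"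
    have w: "set ?w \<subseteq> {..<k}" "set [fst p (int n)] \<subseteq> {..<k}"
      using skew_space_word[OF p] skew_space_symbol[OF p] by (blast, auto)
    have "circle_deriv (fold f ?w) (snd p) \<noteq> 0"
      "circle_deriv (f (fst p (int n))) (fold f ?w (snd p)) \<noteq> 0"
      using circle_C1_diffeo_fold[OF f w(1)] f w(2) circle_deriv_nonzero by auto
    then have "ln \<bar>circle_deriv (f (fst p (int n))) (fold f ?w (snd p)) * circle_deriv (fold f ?w) (snd p)\<bar>
      = ln \<bar>circle_deriv (f (fst p (int n))) (fold f ?w (snd p))\<bar> + ln \<bar>circle_deriv (fold f ?w) (snd p)\<bar>"
      by (simp add: abs_mult ln_mult)
    moreover have "g ((skew_product f ^^ n) p) = ln \<bar>circle_deriv (f (fst p (int n))) (fold f ?w (snd p))\<bar>"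
      by (simp add: g_def skew_product_iterate)
    moreover have "circle_deriv (fold f (map (\<lambda>i. fst p (int i)) [0..<Suc n])) (snd p)
      = circle_deriv (f (fst p (int n))) (fold f ?w (snd p)) * circle_deriv (fold f ?w) (snd p)"
      using circle_deriv_fold_append[OF f w, of "snd p"] by (simp del: fold_append)
    ultimately show ?case unfolding sum.lessThan_Suc Suc by (simp only: add.commute)
  qed
qed

text \<open>Measures whose cylinders of length \<open>n\<close> have mass at most about \<open>m powr (- n / N)\<close> have entropy
  at least \<open>ln m / N\<close>.\<close>

lemma metric_entropy_ge_cylinders:
  assumes prob: "prob_space \<mu>" and sets: "sets \<mu> = sets (restrict_space borel (skew_space k))"
    and k: "k > 0" and f: "\<forall>i<k. circle_C1_diffeo (f i)" and m: "m \<ge> 1" and N: "N > 0"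
    and cyl: "\<And>n u. measure \<mu> {p \<in> skew_space k. \<forall>i<n. fst p (int i) = u i} \<le> (1 / real m) ^ (n div N - 1)"
  shows "ereal (ln m / N) \<le> metric_entropy (skew_product f) \<mu>"
proof -
  interpret prob_space \<mu> by (rule prob)
  let ?X = "skew_space k" and ?T = "skew_product f"
  have sp: "space \<mu> = ?X" using sets_eq_imp_space_eq[OF sets] by (simp add: space_restrict_space)
  define P where "P = (\<lambda>a. {p \<in> ?X. fst p 0 = a}) ` {..<k}"
  have P: "finite P" "\<Union>P = ?X" "disjoint P"
    using skew_space_symbol by (auto simp: P_def disjoint_def)
  have "{p \<in> ?X. fst p 0 = a} \<noteq> {}" if "a < k" for a
  proof -
    have "((\<lambda>_. a), to_circle 0) \<in> {p \<in> ?X. fst p 0 = a}"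
      using that by (simp add: skew_space_def full_shift_def)
    then show ?thesis by blast
  qed
  then have "{} \<notin> P" unfolding P_def by (auto simp only: image_iff lessThan_iff)
  then have "partition_on ?X P" using P(2,3) unfolding partition_on_def by blast
  moreover have Ps: "P \<subseteq> sets \<mu>"
  proof -
    have "{p \<in> ?X. fst p 0 = a} \<in> sets \<mu>" for a
    proof -
      have "{p \<in> ?X. fst p 0 = a} = ?X \<inter> {p. fst p 0 = a}" by auto
      then show ?thesis unfolding sets sets_restrict_space using borel_open[OF open_symbol[of 0 a]] by blast
    qed
    then show ?thesis by (auto simp: P_def)
  qed
  ultimately have "limsup (\<lambda>n. ereal (partition_entropy \<mu> (dynamical_join (space \<mu>) ?T P n) / real n))
      \<le> metric_entropy ?T \<mu>"
    unfolding metric_entropy_def using P(1) sp by (intro SUP_upper) auto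
  moreover have "ereal (ln m / N) \<le> limsup (\<lambda>n. ereal (partition_entropy \<mu> (dynamical_join (space \<mu>) ?T P n) / real n))"
  proof -
    have TM: "?T \<in> measurable \<mu> \<mu>"
      using measurable_skew_product[OF f] measurable_cong_sets[OF sets sets] by blast
    have ge: "(real n / N - 2) * ln m / n \<le> partition_entropy \<mu> (dynamical_join ?X ?T P n) / n" for n
    proof -
      have "- ln ((1 / real m) ^ (n div N - 1)) \<le> partition_entropy \<mu> (dynamical_join ?X ?T P n)"
      proof (rule partition_entropy_ge[OF prob])
        show "finite (dynamical_join ?X ?T P n)" using P(1) by (rule finite_dynamical_join)
        show "dynamical_join ?X ?T P n \<subseteq> sets \<mu>" by (rule dynamical_join_sets[OF sp TM Ps])
        show "disjoint (dynamical_join ?X ?T P n)" using P(3) by (rule disjoint_dynamical_join)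
        show "\<Union> (dynamical_join ?X ?T P n) = space \<mu>"
          unfolding sp using P(2) by (intro Union_dynamical_join) (auto intro: skew_product_in_space)
        fix C assume "C \<in> dynamical_join ?X ?T P n"
        then obtain A where A: "A \<in> {..<n} \<rightarrow> P" "C = {x \<in> ?X. \<forall>i<n. (?T ^^ i) x \<in> A i}"
          by (auto simp: dynamical_join_def)
        have "\<forall>i. \<exists>a. i < n \<longrightarrow> A i = {p \<in> ?X. fst p 0 = a}"
          using A(1) unfolding P_def Pi_iff by blast
        then obtain u where u: "\<And>i. i < n \<longrightarrow> A i = {p \<in> ?X. fst p 0 = u i}" by (rule choice[THEN exE]) blast
        have "C = {p \<in> ?X. \<forall>i<n. fst p (int i) = u i}"
        proof -
          have "(?T ^^ i) p \<in> A i \<longleftrightarrow> fst p (int i) = u i" if "p \<in> ?X" "i < n" for p i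
            using u[of i] skew_product_iterate_in_space[OF that(1), where f = f and n = i] that(2)
            by (simp add: skew_product_iterate)
          then show ?thesis unfolding A(2) by blast
        qed
        then show "measure \<mu> C \<le> (1 / real m) ^ (n div N - 1)" using cyl by simp
      qed
      moreover have "- ln ((1 / real m) ^ (n div N - 1)) = real (n div N - 1) * ln m"
        using m by (simp add: ln_realpow ln_div)
      moreover have "real n / N - 2 \<le> real (n div N - 1)"
      proof -
        have "real n / N < real (n div N) + 1"
        proof -
          have "n < N * (n div N) + N" using dividend_less_times_div[OF N, of n] by simp
          then have "real n < real (N * (n div N) + N)" unfolding of_nat_less_iff .
          then show ?thesis using N by (simp add: field_simps)
        qed
        then show ?thesis by linarith
      qed
      then have "(real n / N - 2) * ln m \<le> real (n div N - 1) * ln m" using m by (intro mult_right_mono) auto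
      ultimately show ?thesis by (intro divide_right_mono) auto
    qed
    have "(\<lambda>n. (real n / N - 2) * ln m / n) \<longlonglongrightarrow> ln m / N"
    proof -
      have "(\<lambda>n. (1 / N - 2 * (1 / real n)) * ln m) \<longlonglongrightarrow> (1 / N - 2 * 0) * ln m"
        by (intro tendsto_intros lim_1_over_n)
      moreover have "\<forall>\<^sub>F n in sequentially. (1 / N - 2 * (1 / real n)) * ln m = (real n / N - 2) * ln m / n"
        using eventually_gt_at_top[of 0] by eventually_elim (simp add: field_simps)
      ultimately show ?thesis by (simp add: tendsto_cong)
    qed
    then have "ereal (ln m / N) = limsup (\<lambda>n. ereal ((real n / N - 2) * ln m / n))"
      by (intro lim_imp_Limsup[symmetric]) (auto intro: tendsto_ereal)
    also have "\<dots> \<le> limsup (\<lambda>n. ereal (partition_entropy \<mu> (dynamical_join (space \<mu>) ?T P n) / real n))"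
      unfolding sp using ge by (intro Limsup_mono) auto
    finally show ?thesis .
  qed
  ultimately show ?thesis by (rule order_trans[rotated])
qed

section \<open>Measures carried by horseshoes\<close>

text \<open>The sequence of symbols obtained by writing out the words \<open>\<omega> i\<close>, all of length \<open>N\<close>,
  one after the other, the word \<open>\<omega> 0\<close> starting at position \<open>0\<close>.\<close>

definition concat_blocks :: "nat \<Rightarrow> (int \<Rightarrow> nat list) \<Rightarrow> int \<Rightarrow> nat" where
  "concat_blocks N \<omega> i = \<omega> (i div int N) ! nat (i mod int N)"

lemma concat_blocks_shift:
  assumes "N > 0"
  shows "concat_blocks N \<omega> (i + int N) = concat_blocks N (shift_seq \<omega>) i"
  using assms by (simp add: concat_blocks_def shift_seq_def)

lemma concat_blocks_nth:
  assumes "r < N"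
  shows "concat_blocks N \<omega> (int (b * N + r)) = \<omega> (int b) ! r"
proof -
  have "(b * N + r) div N = b" "(b * N + r) mod N = r" using assms by auto
  then show ?thesis
    unfolding concat_blocks_def by (simp only: zdiv_int[symmetric] zmod_int[symmetric] nat_int)
qed

lemma concat_blocks_word:
  assumes "length (\<omega> 0) = N"
  shows "map (\<lambda>i. concat_blocks N \<omega> (int i)) [0..<N] = \<omega> 0"
  by (rule nth_equalityI) (use assms concat_blocks_nth[of _ N \<omega> 0] in auto)

lemma sets_bernoulli_cylinder:
  assumes W: "finite W" "W \<noteq> {}" and I: "finite I"
  shows "{\<omega> \<in> space (bernoulli W). \<forall>i\<in>I. \<omega> i = u i} \<in> sets (bernoulli W)"
proof (rule sets.sets_Collect_finite_All[OF _ I])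
  fix i
  have "(\<lambda>\<omega>. \<omega> i) -` (W \<inter> {u i}) \<inter> space (bernoulli W) \<in> sets (bernoulli W)"
    by (rule measurable_sets[OF measurable_bernoulli_component[OF W]]) simp
  moreover have "(\<lambda>\<omega>. \<omega> i) -` (W \<inter> {u i}) \<inter> space (bernoulli W) = {\<omega> \<in> space (bernoulli W). \<omega> i = u i}"
    by (auto simp: space_bernoulli[OF W])
  ultimately show "{\<omega> \<in> space (bernoulli W). \<omega> i = u i} \<in> sets (bernoulli W)" by simp
qed

text \<open>Equal-length words together with an equivariant section over the Bernoulli shift on these words
  yield an ergodic measure of the skew-product, whose entropy counts the words.\<close>

lemma horseshoe_measure:
  assumes k: "k > 0" and f: "\<forall>i<k. circle_C1_diffeo (f i)" and N: "N > 0" and W: "finite W" "W \<noteq> {}"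
    and words: "\<And>w. w \<in> W \<Longrightarrow> length w = N \<and> set w \<subseteq> {..<k}"
    and \<phi>: "\<phi> \<in> borel_measurable (bernoulli W)"
    and equiv: "\<And>\<omega>. \<omega> \<in> space (bernoulli W) \<Longrightarrow> \<phi> (shift_seq \<omega>) = fold f (\<omega> 0) (\<phi> \<omega>)"
  shows "\<exists>\<mu>\<in>ergodic_measures (skew_space k) (skew_product f).
    ereal (ln (card W) / N) \<le> metric_entropy (skew_product f) \<mu> \<and>
    integrable (bernoulli W) (\<lambda>\<omega>. ln \<bar>circle_deriv (fold f (\<omega> 0)) (\<phi> \<omega>)\<bar>) \<and>
    fiber_exponent f \<mu> = (\<integral>\<omega>. ln \<bar>circle_deriv (fold f (\<omega> 0)) (\<phi> \<omega>)\<bar> \<partial>bernoulli W) / N"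
proof -
  define \<Phi> where "\<Phi> \<omega> = (concat_blocks N \<omega>, \<phi> \<omega>)" for \<omega>
  have inW: "\<omega> i \<in> W" if "\<omega> \<in> space (bernoulli W)" for \<omega> i
    using that by (simp add: space_bernoulli[OF W])
  have full: "concat_blocks N \<omega> \<in> full_shift k" if \<omega>: "\<omega> \<in> space (bernoulli W)" for \<omega>
  proof -
    have "concat_blocks N \<omega> i < k" for i
    proof -
      have "nat (i mod int N) < N" using N by (simp add: nat_less_iff)
      then have "concat_blocks N \<omega> i \<in> set (\<omega> (i div int N))"
        using words[OF inW[OF \<omega>]] unfolding concat_blocks_def by (intro nth_mem) simp
      then show ?thesis using words[OF inW[OF \<omega>]] by blast
    qed
    then show ?thesis by (simp add: full_shift_def)
  qed
  have \<Phi>_in: "\<Phi> \<omega> \<in> skew_space k" if "\<omega> \<in> space (bernoulli W)" for \<omega>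
    using full[OF that] by (simp add: \<Phi>_def skew_space_def)
  have word0: "map (\<lambda>i. concat_blocks N \<omega> (int i)) [0..<N] = \<omega> 0" if "\<omega> \<in> space (bernoulli W)" for \<omega>
    using words[OF inW[OF that]] by (intro concat_blocks_word) simp
  interpret suspension "bernoulli W" shift_seq "skew_space k" "skew_product f" \<Phi> N
  proof (intro suspension.intro suspension_axioms.intro prob_space_bernoulli[OF W]
      measurable_shift_seq[OF W] distr_shift_seq[OF W] bernoulli_ergodic[OF W] measurable_skew_product[OF f] N)
    show "\<Phi> \<in> measurable (bernoulli W) (restrict_space borel (skew_space k))"
      unfolding \<Phi>_def
    proof (rule measurable_into_skew_space)
      show "(\<lambda>\<omega>. concat_blocks N \<omega> i) \<in> borel_measurable (bernoulli W)" for i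
        unfolding concat_blocks_def by (rule measurable_bernoulli_discrete[OF W]) simp
    qed (use \<phi> full in auto)
    show "(skew_product f ^^ N) (\<Phi> \<omega>) = \<Phi> (shift_seq \<omega>)" if \<omega>: "\<omega> \<in> space (bernoulli W)" for \<omega>
      unfolding skew_product_iterate \<Phi>_def fst_conv snd_conv word0[OF \<omega>] equiv[OF \<omega>]
      using concat_blocks_shift[OF N] by (simp add: fun_eq_iff)
  qed
  define m where "m = card W"
  have m: "m \<ge> 1" using W unfolding m_def by (simp add: card_gt_0_iff Suc_leI)
  have "measure \<mu> {p \<in> skew_space k. \<forall>i<n. fst p (int i) = u i} \<le> (1 / real m) ^ (n div N - 1)"
    for n :: nat and u :: "nat \<Rightarrow> nat"
  proof -
    define C where "C = {p \<in> skew_space k. \<forall>i<n. fst p (int i) = u i}"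
    define \<delta> where "\<delta> = (1 / real m) ^ (n div N - 1)"
    have C: "C \<in> sets (restrict_space borel (skew_space k))"
    proof -
      have "C = {p \<in> skew_space k. \<forall>i\<in>{..<n}. fst p (int i) = u i}" by (auto simp: C_def)
      also have "\<dots> = skew_space k \<inter> {p \<in> space borel. \<forall>i\<in>{..<n}. fst p (int i) = u i}" by auto
      also have "\<dots> \<in> sets (restrict_space borel (skew_space k))"
        unfolding sets_restrict_space
      proof (intro imageI sets.sets_Collect_finite_All)
        show "{p \<in> space borel. fst p (int i) = u i} \<in> sets (borel :: ((int \<Rightarrow> nat) \<times> circle) measure)" for i
          using borel_open[OF open_symbol[of "int i" "u i"]] by simp
      qed simp
      finally show ?thesis .
    qed
    have "prob ((\<lambda>\<omega>. (skew_product f ^^ j) (\<Phi> \<omega>)) -` C \<inter> space (bernoulli W)) \<le> \<delta>" if j: "j < N" for j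
    proof -
      \<comment> \<open>The blocks \<open>1, ..., n div N - 1\<close> lie entirely inside the window of length \<open>n\<close> that starts
        at position \<open>j < N\<close>.\<close>
      define I where "I = int ` {1..<n div N}"
      define v where "v b = map (\<lambda>r. u (nat b * N + r - j)) [0..<N]" for b
      have I: "finite I" "card I = n div N - 1" by (auto simp: I_def card_image)
      have "(\<lambda>\<omega>. (skew_product f ^^ j) (\<Phi> \<omega>)) -` C \<inter> space (bernoulli W)
        \<subseteq> {\<omega> \<in> space (bernoulli W). \<forall>i\<in>I. \<omega> i = v i}"
      proof (intro subsetI CollectI conjI ballI)
        fix \<omega> assume "\<omega> \<in> (\<lambda>\<omega>. (skew_product f ^^ j) (\<Phi> \<omega>)) -` C \<inter> space (bernoulli W)"
        then have \<omega>: "\<omega> \<in> space (bernoulli W)" "(skew_product f ^^ j) (\<Phi> \<omega>) \<in> C" by simp_all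
        show "\<omega> \<in> space (bernoulli W)" by (rule \<omega>(1))
        fix i assume "i \<in> I"
        then obtain b where b: "i = int b" "1 \<le> b" "b < n div N" by (auto simp: I_def)
        show "\<omega> i = v i"
        proof (rule nth_equalityI)
          show "length (\<omega> i) = length (v i)" using words[OF inW[OF \<omega>(1)]] by (simp add: v_def)
          fix r assume "r < length (\<omega> i)"
          then have r: "r < N" using words[OF inW[OF \<omega>(1)]] by simp
          have "(b + 1) * N \<le> n div N * N" using b(3) by (intro mult_right_mono) auto
          also have "\<dots> \<le> n" by simp
          finally have "(b + 1) * N \<le> n" .
          moreover have "N \<le> b * N" using b(2) by simp
          moreover have "(b + 1) * N = b * N + N" by simp
          ultimately have pos: "b * N + r - j < n" "j \<le> b * N + r" using j r by linarith+
          have "fst ((skew_product f ^^ j) (\<Phi> \<omega>)) (int (b * N + r - j)) = u (b * N + r - j)"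
            using \<omega>(2) pos(1) unfolding C_def by blast
          moreover have "fst ((skew_product f ^^ j) (\<Phi> \<omega>)) (int (b * N + r - j)) = concat_blocks N \<omega> (int (b * N + r))"
            using pos(2) by (simp add: skew_product_iterate \<Phi>_def of_nat_diff)
          ultimately show "\<omega> i ! r = v i ! r"
            using r concat_blocks_nth[OF r, of \<omega> b] by (simp add: b(1) v_def)
        qed
      qed
      then have "prob ((\<lambda>\<omega>. (skew_product f ^^ j) (\<Phi> \<omega>)) -` C \<inter> space (bernoulli W))
        \<le> prob {\<omega> \<in> space (bernoulli W). \<forall>i\<in>I. \<omega> i = v i}"
        using sets_bernoulli_cylinder[OF W I(1)] by (rule finite_measure_mono)
      also have "\<dots> \<le> \<delta>" using bernoulli_cylinder[OF W I(1), of v] by (simp add: I(2) \<delta>_def m_def)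
      finally show ?thesis .
    qed
    then have "(\<Sum>j<N. prob ((\<lambda>\<omega>. (skew_product f ^^ j) (\<Phi> \<omega>)) -` C \<inter> space (bernoulli W))) \<le> (\<Sum>j<N. \<delta>)"
      by (intro sum_mono) simp
    then have "measure \<mu> C \<le> \<delta>"
      unfolding suspension_prob[OF C] using N by (simp add: field_simps)
    then show ?thesis by (simp add: C_def \<delta>_def)
  qed
  then have entropy: "ereal (ln m / N) \<le> metric_entropy (skew_product f) \<mu>"
    by (rule metric_entropy_ge_cylinders[OF prob_space_suspension sets_suspension(1) k f m N])
  define g where "g = (\<lambda>p :: (int \<Rightarrow> nat) \<times> circle. ln \<bar>circle_deriv (f (fst p 0)) (snd p)\<bar>)"
  obtain C where C: "\<And>p. p \<in> skew_space k \<Longrightarrow> \<bar>g p\<bar> \<le> C"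
    using log_fiber_derivative(2)[OF f] unfolding g_def by blast
  have gm: "g \<in> borel_measurable (restrict_space borel (skew_space k))"
    unfolding g_def by (rule log_fiber_derivative(1)[OF f])
  note gint = suspension_integral[OF gm C]
  have sum: "(\<Sum>j<N. g ((skew_product f ^^ j) (\<Phi> \<omega>))) = ln \<bar>circle_deriv (fold f (\<omega> 0)) (\<phi> \<omega>)\<bar>"
    if "\<omega> \<in> space (bernoulli W)" for \<omega>
    using log_fiber_derivative(3)[OF f \<Phi>_in[OF that], of N] word0[OF that] unfolding g_def \<Phi>_def by simp
  have "integrable (bernoulli W) (\<lambda>\<omega>. \<Sum>j<N. g ((skew_product f ^^ j) (\<Phi> \<omega>)))"
    by (intro Bochner_Integration.integrable_sum gint(2))
  then have int: "integrable (bernoulli W) (\<lambda>\<omega>. ln \<bar>circle_deriv (fold f (\<omega> 0)) (\<phi> \<omega>)\<bar>)"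
    by (rule iffD1[OF Bochner_Integration.integrable_cong[OF refl], rotated]) (rule sum)
  have "fiber_exponent f \<mu> = integral\<^sup>L \<mu> g"
    unfolding fiber_exponent_def g_def by (simp add: case_prod_beta')
  also have "\<dots> = (\<integral>\<omega>. (\<Sum>j<N. g ((skew_product f ^^ j) (\<Phi> \<omega>))) \<partial>bernoulli W) / N"
    using gint(1) by (subst Bochner_Integration.integral_sum[OF gint(2)]) auto
  also have "(\<integral>\<omega>. (\<Sum>j<N. g ((skew_product f ^^ j) (\<Phi> \<omega>))) \<partial>bernoulli W)
      = (\<integral>\<omega>. ln \<bar>circle_deriv (fold f (\<omega> 0)) (\<phi> \<omega>)\<bar> \<partial>bernoulli W)"
    by (rule Bochner_Integration.integral_cong[OF refl sum])
  finally show ?thesis using suspension_ergodic entropy int unfolding m_def by blast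
qed

section \<open>Attracting and repelling sections\<close>

text \<open>Along a past \<open>\<omega>\<close> of contractions of \<open>J\<close>, the images of \<open>J\<close> shrink to a point that depends
  measurably on \<open>\<omega>\<close>.\<close>

lemma attracting_section:
  fixes k :: nat
  assumes f: "\<forall>i<k. circle_C1_diffeo (f i)" and J: "closed_circle_interval J"
    and W: "finite W" "W \<noteq> {}"
    and words: "\<And>w. w \<in> W \<Longrightarrow> set w \<subseteq> {..<k} \<and> fold f w ` J \<subseteq> J \<and> (\<forall>p\<in>J. \<bar>circle_deriv (fold f w) p\<bar> \<le> 1 / 2)"
  shows "\<exists>\<phi>\<in>borel_measurable (bernoulli W). \<forall>\<omega>\<in>space (bernoulli W).
    \<phi> (shift_seq \<omega>) = fold f (\<omega> 0) (\<phi> \<omega>) \<and> \<phi> \<omega> \<in> J"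
proof -
  let ?B = "bernoulli W"
  obtain a b where ab: "a < b" "b < a + 1" "J = to_circle ` {a..b}"
    using J unfolding closed_circle_interval_def by blast
  have inW: "\<omega> i \<in> W" if "\<omega> \<in> space ?B" for \<omega> i
    using that by (simp add: space_bernoulli[OF W])
  define F where "F = rec_nat (\<lambda>(\<omega> :: int \<Rightarrow> nat list) p. p) (\<lambda>n G \<omega> p. G \<omega> (fold f (\<omega> (- int n - 1)) p))"
  have F0: "F 0 \<omega> = (\<lambda>p. p)" and FS: "F (Suc n) \<omega> p = F n \<omega> (fold f (\<omega> (- int n - 1)) p)" for n \<omega> p
    by (simp_all add: F_def)
  have FS': "F (Suc n) \<omega> = F n \<omega> \<circ> fold f (\<omega> (- int n - 1))" for n \<omega>
    by (simp add: fun_eq_iff FS)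
  have shift: "F (Suc n) (shift_seq \<omega>) p = fold f (\<omega> 0) (F n \<omega> p)" for n \<omega> p
  proof (induct n arbitrary: p)
    case 0
    show ?case unfolding FS F0 shift_seq_def by simp
  next
    case (Suc n)
    have "F (Suc (Suc n)) (shift_seq \<omega>) p = F (Suc n) (shift_seq \<omega>) (fold f (\<omega> (- int n - 1)) p)"
    proof -
      have "- int (Suc n) - 1 + 1 = - int n - 1" by simp
      then show ?thesis unfolding FS[of "Suc n"] shift_seq_def by (simp only:)
    qed
    also have "\<dots> = fold f (\<omega> 0) (F n \<omega> (fold f (\<omega> (- int n - 1)) p))" by (rule Suc)
    also have "\<dots> = fold f (\<omega> 0) (F (Suc n) \<omega> p)" unfolding FS[of n \<omega>] ..
    finally show ?case .
  qed
  have F: "circle_C1_diffeo (F n \<omega>) \<and> (\<forall>p\<in>J. F n \<omega> p \<in> J) \<and> (\<forall>p\<in>J. \<bar>circle_deriv (F n \<omega>) p\<bar> \<le> (1 / 2) ^ n)"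
    if \<omega>: "\<omega> \<in> space ?B" for n \<omega>
  proof (induct n)
    case 0
    show ?case unfolding F0 by (simp add: circle_C1_diffeo_id circle_C1_id)
  next
    case (Suc n)
    define w where "w = \<omega> (- int n - 1)"
    have w: "set w \<subseteq> {..<k}" "\<And>p. p \<in> J \<Longrightarrow> fold f w p \<in> J" "\<And>p. p \<in> J \<Longrightarrow> \<bar>circle_deriv (fold f w) p\<bar> \<le> 1 / 2"
      using words[OF inW[OF \<omega>, of "- int n - 1"]] unfolding w_def by blast+
    have dw: "circle_C1_diffeo (fold f w)" using circle_C1_diffeo_fold[OF f w(1)] .
    have "\<bar>circle_deriv (F n \<omega> \<circ> fold f w) p\<bar> \<le> (1 / 2) ^ Suc n" if p: "p \<in> J" for p
    proof -
      have "\<bar>circle_deriv (F n \<omega>) (fold f w p)\<bar> * \<bar>circle_deriv (fold f w) p\<bar> \<le> (1 / 2) ^ n * (1 / 2)"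
        using Suc w(2,3)[OF p] by (intro mult_mono) auto
      then show ?thesis using Suc by (subst circle_deriv_compose[OF dw]) (auto simp: abs_mult)
    qed
    moreover have "circle_C1_diffeo (F n \<omega> \<circ> fold f w)" using Suc dw by (intro circle_C1_diffeo_compose) auto
    moreover have "\<forall>p\<in>J. (F n \<omega> \<circ> fold f w) p \<in> J" using Suc w(2) by simp
    ultimately show ?case unfolding FS' w_def[symmetric] by blast
  qed
  have contr: "dist (F n \<omega> p) (F n \<omega> q) \<le> (1 / 2) ^ n" if \<omega>: "\<omega> \<in> space ?B" and "p \<in> J" "q \<in> J" for n \<omega> p q
  proof -
    have *: "dist (F n \<omega> (to_circle s)) (F n \<omega> (to_circle t)) \<le> (1 / 2) ^ n"
      if "s \<le> t" "s \<in> {a..b}" "t \<in> {a..b}" for s t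
    proof -
      have "dist (F n \<omega> (to_circle s)) (F n \<omega> (to_circle t)) \<le> (1 / 2) ^ n * (t - s)"
      proof (rule circle_mean_value[OF \<open>s \<le> t\<close>, where D = "\<lambda>u. circle_deriv (F n \<omega>) (to_circle u)"])
        fix u assume "s \<le> u" "u \<le> t"
        then have "to_circle u \<in> J" using that ab(3) by auto
        then show "\<bar>circle_deriv (F n \<omega>) (to_circle u)\<bar> \<le> (1 / 2) ^ n" using F[OF \<omega>] by blast
        show "has_circle_derivative (F n \<omega>) (circle_deriv (F n \<omega>) (to_circle u)) (to_circle u)"
          using F[OF \<omega>] circle_C1_diffeoD(1) by blast
      qed
      also have "\<dots> \<le> (1 / 2) ^ n * 1" using that ab by (intro mult_left_mono) auto
      finally show ?thesis by simp
    qed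
    obtain s t where "s \<in> {a..b}" "t \<in> {a..b}" "p = to_circle s" "q = to_circle t"
      using \<open>p \<in> J\<close> \<open>q \<in> J\<close> unfolding ab(3) by blast
    then show ?thesis using *[of s t] *[of t s] by (cases "s \<le> t") (auto simp: dist_commute)
  qed
  define p0 where "p0 = to_circle a"
  have p0: "p0 \<in> J" using ab by (auto simp: p0_def)
  have deep: "\<exists>q\<in>J. F (n + m) \<omega> p = F n \<omega> q" if \<omega>: "\<omega> \<in> space ?B" and "p \<in> J" for n m \<omega> p
    using \<open>p \<in> J\<close>
  proof (induct m arbitrary: p)
    case 0
    then show ?case by auto
  next
    case (Suc m)
    have "fold f (\<omega> (- int (n + m) - 1)) p \<in> J"
      using words[OF inW[OF \<omega>]] Suc(2) by blast
    from Suc(1)[OF this] show ?case using FS[of "n + m" \<omega> p] by simp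
  qed
  define \<phi> where "\<phi> \<omega> = lim (\<lambda>n. F n \<omega> p0)" for \<omega>
  have conv: "(\<lambda>n. F n \<omega> p0) \<longlonglongrightarrow> \<phi> \<omega>" if \<omega>: "\<omega> \<in> space ?B" for \<omega>
  proof -
    have "Cauchy (\<lambda>n. F n \<omega> p0)"
      unfolding Cauchy_altdef
    proof (intro allI impI)
      fix e :: real assume "e > 0"
      then obtain n0 where n0: "(1 / 2 :: real) ^ n0 < e" using real_arch_pow_inv[of e "1/2"] by auto
      have "dist (F m \<omega> p0) (F n \<omega> p0) < e" if "n0 \<le> m" "m < n" for m n
      proof -
        obtain q where q: "q \<in> J" "F n \<omega> p0 = F m \<omega> q" using deep[OF \<omega> p0, of m "n - m"] \<open>m < n\<close> by auto
        have "dist (F m \<omega> p0) (F n \<omega> p0) \<le> (1 / 2) ^ m" unfolding q(2) by (rule contr[OF \<omega> p0 q(1)])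
        also have "\<dots> \<le> (1 / 2) ^ n0" using \<open>n0 \<le> m\<close> by (intro power_decreasing) auto
        finally show ?thesis using n0 by simp
      qed
      then show "\<exists>M. \<forall>m\<ge>M. \<forall>n>m. dist (F m \<omega> p0) (F n \<omega> p0) < e" by blast
    qed
    then have "\<exists>l\<in>UNIV. (\<lambda>n. F n \<omega> p0) \<longlonglongrightarrow> l"
      using compact_imp_complete[OF compact_UNIV_circle] unfolding complete_def by blast
    then show ?thesis unfolding \<phi>_def using limI by blast
  qed
  have "(\<lambda>\<omega>. F n \<omega> p) \<in> borel_measurable ?B" for n p
  proof (induct n arbitrary: p)
    case 0
    show ?case unfolding F0 by simp
  next
    case (Suc n)
    show ?case unfolding FS
      by (rule measurable_compose_countable'[where f = "\<lambda>w \<omega>. F n \<omega> (fold f w p)" and I = W])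
         (use Suc measurable_bernoulli_component[OF W] W(1) in \<open>auto intro: countable_finite\<close>)
  qed
  then have "\<phi> \<in> borel_measurable ?B"
    using conv by (rule borel_measurable_LIMSEQ_metric)
  moreover have "\<phi> (shift_seq \<omega>) = fold f (\<omega> 0) (\<phi> \<omega>) \<and> \<phi> \<omega> \<in> J" if \<omega>: "\<omega> \<in> space ?B" for \<omega>
  proof
    have "closed J"
      unfolding ab(3) by (intro compact_imp_closed compact_continuous_image continuous_to_circle compact_Icc)
    moreover have "F n \<omega> p0 \<in> J" for n using F[OF \<omega>] p0 by blast
    ultimately show "\<phi> \<omega> \<in> J" using conv[OF \<omega>] by (rule closed_sequentially)
    have "shift_seq \<omega> \<in> space ?B" using measurable_space[OF measurable_shift_seq[OF W] \<omega>] .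
    from LIMSEQ_Suc[OF conv[OF this]] have 1: "(\<lambda>n. fold f (\<omega> 0) (F n \<omega> p0)) \<longlonglongrightarrow> \<phi> (shift_seq \<omega>)"
      unfolding shift .
    have "set (\<omega> 0) \<subseteq> {..<k}" using words[OF inW[OF \<omega>]] by blast
    then have "continuous_on UNIV (fold f (\<omega> 0))"
      using circle_C1_diffeo_fold[OF f] circle_C1_diffeoD(3) by blast
    then have "(\<lambda>n. fold f (\<omega> 0) (F n \<omega> p0)) \<longlonglongrightarrow> fold f (\<omega> 0) (\<phi> \<omega>)"
      using conv[OF \<omega>] by (intro continuous_on_tendsto_compose[of UNIV "fold f (\<omega> 0)"]) auto
    from LIMSEQ_unique[OF 1 this] show "\<phi> (shift_seq \<omega>) = fold f (\<omega> 0) (\<phi> \<omega>)" .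
  qed
  ultimately show ?thesis by blast
qed

text \<open>The section of the inverse system, with time reversed: words that contract under the inverse maps
  become expanding words, read backwards.\<close>

lemma repelling_section:
  fixes k :: nat
  assumes f: "\<forall>i<k. circle_C1_diffeo (f i)" and J: "closed_circle_interval J"
    and V: "finite V" "V \<noteq> {}"
    and words: "\<And>w. w \<in> V \<Longrightarrow> set w \<subseteq> {..<k} \<and> fold (\<lambda>i. inv (f i)) w ` J \<subseteq> J \<and>
      (\<forall>p\<in>J. \<bar>circle_deriv (fold (\<lambda>i. inv (f i)) w) p\<bar> \<le> 1 / 2)"
  shows "\<exists>\<phi>\<in>borel_measurable (bernoulli (rev ` V)). \<forall>\<omega>\<in>space (bernoulli (rev ` V)).
    \<phi> (shift_seq \<omega>) = fold f (\<omega> 0) (\<phi> \<omega>) \<and> \<bar>circle_deriv (fold f (\<omega> 0)) (\<phi> \<omega>)\<bar> \<ge> 2"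
proof -
  let ?g = "\<lambda>i. inv (f i)" and ?W = "rev ` V"
  have g: "\<forall>i<k. circle_C1_diffeo (?g i)" using f circle_C1_diffeo_inv by blast
  have W: "finite ?W" "?W \<noteq> {}" using V by auto
  obtain \<psi> where \<psi>: "\<psi> \<in> borel_measurable (bernoulli V)"
    "\<And>\<omega>. \<omega> \<in> space (bernoulli V) \<Longrightarrow> \<psi> (shift_seq \<omega>) = fold ?g (\<omega> 0) (\<psi> \<omega>) \<and> \<psi> \<omega> \<in> J"
    using attracting_section[OF g J V words] by blast
  define flip where "flip \<omega> = (\<lambda>i :: int. rev (\<omega> (- 1 - i) :: nat list))" for \<omega>
  have flip_space: "flip \<omega> \<in> space (bernoulli V)" if "\<omega> \<in> space (bernoulli ?W)" for \<omega>
    using that by (auto simp: space_bernoulli[OF V] space_bernoulli[OF W] flip_def image_iff) (metis rev_rev_ident)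
  have flip: "flip \<in> measurable (bernoulli ?W) (bernoulli V)"
    unfolding bernoulli_def[of V]
  proof (rule measurable_PiM_single')
    fix i :: int
    have "(\<lambda>\<omega>. flip \<omega> i) \<in> measurable (bernoulli ?W) (count_space V)"
      unfolding flip_def
      by (rule measurable_compose[OF measurable_bernoulli_component[OF W]]) auto
    then show "(\<lambda>\<omega>. flip \<omega> i) \<in> measurable (bernoulli ?W) (uniform_count_measure V)"
      using measurable_cong_sets[OF refl sets_uniform_count_measure_count_space] by blast
  qed (use flip_space in \<open>auto simp: space_bernoulli[OF V] space_uniform_count_measure\<close>)
  have flip_shift: "flip \<omega> = shift_seq (flip (shift_seq \<omega>))" for \<omega>
  proof -
    have "- 1 - (i + 1) + 1 = - 1 - i" for i :: int by simp
    then show ?thesis unfolding flip_def shift_seq_def by (simp only:)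
  qed
  have flip0: "flip (shift_seq \<omega>) 0 = rev (\<omega> 0)" for \<omega> by (simp add: flip_def shift_seq_def)
  define \<phi> where "\<phi> \<omega> = \<psi> (flip \<omega>)" for \<omega>
  have "\<phi> \<in> borel_measurable (bernoulli ?W)"
    unfolding \<phi>_def using flip \<psi>(1) by (rule measurable_compose)
  moreover have "\<phi> (shift_seq \<omega>) = fold f (\<omega> 0) (\<phi> \<omega>) \<and> \<bar>circle_deriv (fold f (\<omega> 0)) (\<phi> \<omega>)\<bar> \<ge> 2"
    if \<omega>: "\<omega> \<in> space (bernoulli ?W)" for \<omega>
  proof -
    have s\<omega>: "shift_seq \<omega> \<in> space (bernoulli ?W)" using measurable_space[OF measurable_shift_seq[OF W] \<omega>] .
    have bk: "\<phi> \<omega> = fold ?g (rev (\<omega> 0)) (\<phi> (shift_seq \<omega>))" "\<phi> (shift_seq \<omega>) \<in> J"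
      using \<psi>(2)[OF flip_space[OF s\<omega>]] unfolding \<phi>_def flip_shift[of \<omega>] flip0 by auto
    have V0: "rev (\<omega> 0) \<in> V" using \<omega> by (auto simp: space_bernoulli[OF W] image_iff) (metis rev_rev_ident)
    have w: "set (\<omega> 0) \<subseteq> {..<k}" using words[OF V0] by simp
    have bij: "\<forall>i\<in>set (\<omega> 0). bij (f i)" using f w circle_C1_diffeoD(4) by auto
    have inv: "fold ?g (rev (\<omega> 0)) = inv (fold f (\<omega> 0))" "bij (fold f (\<omega> 0))" using fold_inv_rev[OF bij] .
    have eq: "\<phi> (shift_seq \<omega>) = fold f (\<omega> 0) (\<phi> \<omega>)"
      unfolding bk(1) inv(1) using surj_f_inv_f[OF bij_is_surj[OF inv(2)]] by metis
    have "circle_deriv (fold ?g (rev (\<omega> 0))) (fold f (\<omega> 0) (\<phi> \<omega>)) * circle_deriv (fold f (\<omega> 0)) (\<phi> \<omega>) = 1"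
      unfolding inv(1) by (rule circle_deriv_inv[OF circle_C1_diffeo_fold[OF f w]])
    then have "\<bar>circle_deriv (fold ?g (rev (\<omega> 0))) (\<phi> (shift_seq \<omega>))\<bar> * \<bar>circle_deriv (fold f (\<omega> 0)) (\<phi> \<omega>)\<bar> = 1"
      unfolding eq[symmetric] by (metis abs_mult abs_one)
    moreover have "\<bar>circle_deriv (fold ?g (rev (\<omega> 0))) (\<phi> (shift_seq \<omega>))\<bar> * \<bar>circle_deriv (fold f (\<omega> 0)) (\<phi> \<omega>)\<bar>
      \<le> 1 / 2 * \<bar>circle_deriv (fold f (\<omega> 0)) (\<phi> \<omega>)\<bar>"
      using words[OF V0] bk(2) by (intro mult_right_mono) auto
    ultimately have "\<bar>circle_deriv (fold f (\<omega> 0)) (\<phi> \<omega>)\<bar> \<ge> 2" by linarith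
    with eq show ?thesis by blast
  qed
  ultimately show ?thesis by blast
qed

section \<open>Partitions of the circle into arcs\<close>

text \<open>The representative of a point of the circle in \<open>[0, 1)\<close>.\<close>

definition unit_lift :: "circle \<Rightarrow> real" where
  "unit_lift p = frac (rep_circle p)"

lemma to_circle_unit_lift: "to_circle (unit_lift p) = p"
  using Quotient3_abs_rep[OF Quotient3_circle] by (simp add: unit_lift_def to_circle_frac)

lemma unit_lift_bounds: "0 \<le> unit_lift p" "unit_lift p < 1"
  by (auto simp: unit_lift_def frac_lt_1)

lemma unit_lift_unique:
  assumes "0 \<le> t" "t < 1"
  shows "unit_lift (to_circle t) = t"
proof -
  have "unit_lift (to_circle t) - t \<in> \<int>"
    using to_circle_unit_lift[of "to_circle t"] by (simp add: to_circle_eq_iff)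
  moreover have "\<bar>unit_lift (to_circle t) - t\<bar> < 1"
    using unit_lift_bounds[of "to_circle t"] assms by linarith
  ultimately show ?thesis using Ints_nonzero_abs_less1 by fastforce
qed

text \<open>The index of the arc \<open>[a / M, (a + 1) / M)\<close> that contains a point, for \<open>a < M\<close>.\<close>

definition arc :: "nat \<Rightarrow> circle \<Rightarrow> nat" where
  "arc M p = nat \<lfloor>real M * unit_lift p\<rfloor>"

lemma arc_eq_iff:
  assumes "M > 0"
  shows "arc M p = a \<longleftrightarrow> real a \<le> real M * unit_lift p \<and> real M * unit_lift p < real a + 1"
proof -
  have "0 \<le> real M * unit_lift p" using unit_lift_bounds by simp
  then have "arc M p = a \<longleftrightarrow> \<lfloor>real M * unit_lift p\<rfloor> = int a" by (auto simp: arc_def)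
  also have "\<dots> \<longleftrightarrow> real a \<le> real M * unit_lift p \<and> real M * unit_lift p < real a + 1"
    by (simp add: floor_eq_iff)
  finally show ?thesis .
qed

lemma arc_less:
  assumes "M > 0"
  shows "arc M p < M"
proof -
  have "real (arc M p) \<le> real M * unit_lift p" using arc_eq_iff[OF assms] by blast
  also have "\<dots> < real M" using unit_lift_bounds(2) assms by simp
  finally show ?thesis by simp
qed

lemma arc_dist:
  assumes "M > 0" "arc M p = arc M q"
  shows "dist p q \<le> 1 / M"
proof -
  have "\<bar>real M * unit_lift p - real M * unit_lift q\<bar> \<le> 1"
    using arc_eq_iff[OF assms(1), of p "arc M p"] arc_eq_iff[OF assms(1), of q "arc M p"] assms(2) by auto
  then have "real M * \<bar>unit_lift p - unit_lift q\<bar> \<le> 1" by (simp add: abs_mult flip: right_diff_distrib)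
  then have "\<bar>unit_lift p - unit_lift q\<bar> \<le> 1 / M" using assms(1) by (simp add: field_simps)
  then show ?thesis
    using dist_to_circle_le[of "unit_lift p" "unit_lift q"] by (simp add: to_circle_unit_lift)
qed

lemma arc_double: "arc (2 * M) p div 2 = arc M p"
proof -
  have "\<lfloor>real (2 * M) * unit_lift p / real_of_int 2\<rfloor> = \<lfloor>real (2 * M) * unit_lift p\<rfloor> div 2"
    by (rule floor_divide_real_eq_div) simp
  then have "\<lfloor>real M * unit_lift p\<rfloor> = \<lfloor>real (2 * M) * unit_lift p\<rfloor> div 2" by simp
  moreover have "0 \<le> \<lfloor>real (2 * M) * unit_lift p\<rfloor>" using unit_lift_bounds by simp
  ultimately show ?thesis unfolding arc_def by (simp add: nat_div_distrib)
qed

text \<open>The arcs without their left end points.\<close>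

definition open_arc :: "nat \<Rightarrow> nat \<Rightarrow> circle set" where
  "open_arc M a = to_circle ` {real a / M<..<(real a + 1) / M}"

lemma open_to_circle_image:
  assumes "open U"
  shows "open (to_circle ` U)"
proof -
  have "to_circle -` (to_circle ` U) = (\<Union>n. (\<lambda>t. t + real_of_int n) -` U)"
  proof (intro equalityI subsetI)
    fix t assume "t \<in> to_circle -` (to_circle ` U)"
    then obtain u where u: "u \<in> U" "to_circle u = to_circle t" by auto
    then have "u - t \<in> \<int>" by (simp add: to_circle_eq_iff)
    then obtain n where "u - t = real_of_int n" by (auto elim: Ints_cases)
    then have "t + real_of_int n = u" by simp
    with u(1) show "t \<in> (\<Union>n. (\<lambda>t. t + real_of_int n) -` U)" by blast
  next
    fix t assume "t \<in> (\<Union>n. (\<lambda>t. t + real_of_int n) -` U)"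
    then obtain n where n: "t + real_of_int n \<in> U" by blast
    have "to_circle t = to_circle (t + real_of_int n)" by (simp add: to_circle_eq_iff)
    then show "t \<in> to_circle -` (to_circle ` U)" using n by auto
  qed
  moreover have "open ((\<lambda>t. t + real_of_int n) -` U)" for n
    by (rule open_vimage[OF assms]) (intro continuous_intros)
  ultimately show ?thesis unfolding open_circle_iff by auto
qed

lemma arc_iff_open_arc:
  assumes M: "M > 0" and p: "\<And>a. a < M \<Longrightarrow> p \<noteq> to_circle (real a / M)" and a: "a < M"
  shows "p \<in> open_arc M a \<longleftrightarrow> arc M p = a"
proof
  assume "p \<in> open_arc M a"
  then obtain t where t: "p = to_circle t" "real a / M < t" "t < (real a + 1) / M" by (auto simp: open_arc_def)
  have "real a + 1 \<le> real M" using a by simp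
  then have "(real a + 1) / M \<le> 1" using M by (simp add: field_simps)
  then have "unit_lift p = t" unfolding t(1) using t(2,3) by (intro unit_lift_unique) (auto intro: order_trans[of 0 "real a / M"])
  then show "arc M p = a" using t M by (simp add: arc_eq_iff field_simps)
next
  assume eq: "arc M p = a"
  have "real M * unit_lift p \<noteq> real a"
  proof
    assume "real M * unit_lift p = real a"
    then have "unit_lift p = real a / M" using M by (simp add: field_simps)
    then show False using p[OF a] to_circle_unit_lift[of p] by simp
  qed
  then have "real a / M < unit_lift p" "unit_lift p < (real a + 1) / M"
    using eq M by (auto simp: arc_eq_iff field_simps)
  then have "to_circle (unit_lift p) \<in> open_arc M a" unfolding open_arc_def by (intro imageI) simp
  then show "p \<in> open_arc M a" by (simp add: to_circle_unit_lift)
qed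

lemma open_open_arc: "open (open_arc M a)"
  unfolding open_arc_def by (rule open_to_circle_image) simp

lemma arc_constant_on_connected:
  assumes M: "M > 0" and S: "connected S" and cuts: "\<And>a. a < M \<Longrightarrow> to_circle (real a / M) \<notin> S"
    and pq: "p \<in> S" "q \<in> S"
  shows "arc M p = arc M q"
proof (rule ccontr)
  assume ne: "arc M p \<noteq> arc M q"
  define U where "U = open_arc M (arc M p)"
  define V where "V = (\<Union>a\<in>{..<M} - {arc M p}. open_arc M a)"
  have iff: "x \<in> open_arc M a \<longleftrightarrow> arc M x = a" if "x \<in> S" "a < M" for x a
    using cuts that by (intro arc_iff_open_arc[OF M]) auto
  have "open U" "open V" unfolding U_def V_def using open_open_arc by auto
  moreover have "U \<inter> V \<inter> S = {}" unfolding U_def V_def using iff arc_less[OF M] by auto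
  moreover have "S \<subseteq> U \<union> V" unfolding U_def V_def using iff arc_less[OF M] by auto
  ultimately have "U \<inter> S = {} \<or> V \<inter> S = {}" using S by (intro connectedD)
  moreover have "p \<in> U" unfolding U_def using iff[OF pq(1)] arc_less[OF M] by simp
  moreover have "q \<in> V" unfolding V_def using iff[OF pq(2)] arc_less[OF M] ne by auto
  ultimately show False using pq by blast
qed

text \<open>Finitely many circle homeomorphisms pull the end points of \<open>M\<close> arcs back to at most \<open>n * M\<close>
  points. These points and the gaps between them are the classes on which all the arc indices are constant.\<close>

lemma arc_itinerary_classes:
  assumes M: "M > 0" and h: "\<And>i. i < n \<Longrightarrow> continuous_on UNIV (h i) \<and> bij (h i)"
  shows "\<exists>cls :: circle \<Rightarrow> nat. (\<forall>x. cls x \<le> 2 * (n * M)) \<and>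
    (\<forall>x y. cls x = cls y \<longrightarrow> (\<forall>i<n. arc M (h i x) = arc M (h i y)))"
proof -
  define D where "D = (\<lambda>(i, a). unit_lift (inv (h i) (to_circle (real a / M)))) ` ({..<n} \<times> {..<M})"
  have D: "finite D" "card D \<le> n * M"
    unfolding D_def using card_image_le[of "{..<n} \<times> {..<M}"] by auto
  \<comment> \<open>A class is coded by the number of cut points to the left and by being a cut point or not.\<close>
  define c where "c x = card {d \<in> D. d < unit_lift x}" for x
  define cls where "cls x = 2 * c x + (if unit_lift x \<in> D then 1 else 0)" for x
  have "cls x \<le> 2 * (n * M)" for x
  proof (cases "unit_lift x \<in> D")
    case True
    then have "{d \<in> D. d < unit_lift x} \<subset> D" by auto
    then have "c x < card D" unfolding c_def using D(1) by (rule psubset_card_mono[rotated])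
    then show ?thesis using D(2) True by (simp add: cls_def)
  next
    case False
    have "c x \<le> card D" unfolding c_def using D(1) by (intro card_mono) auto
    then show ?thesis using D(2) False by (simp add: cls_def)
  qed
  moreover have key: "arc M (h i x) = arc M (h i y)"
    if eq: "cls x = cls y" and le: "unit_lift x \<le> unit_lift y" and i: "i < n" for x y i
  proof -
    have D_iff: "unit_lift x \<in> D \<longleftrightarrow> unit_lift y \<in> D" and c_eq: "c x = c y"
    proof -
      have "even (cls x) \<longleftrightarrow> unit_lift x \<notin> D" "even (cls y) \<longleftrightarrow> unit_lift y \<notin> D"
        "cls x div 2 = c x" "cls y div 2 = c y" by (auto simp: cls_def)
      with eq show "unit_lift x \<in> D \<longleftrightarrow> unit_lift y \<in> D" "c x = c y" by metis+
    qed
    have none: "d \<notin> D" if d: "unit_lift x \<le> d" "d < unit_lift y" for d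
    proof
      assume "d \<in> D"
      then have "d \<in> {d \<in> D. d < unit_lift y}" "d \<notin> {d \<in> D. d < unit_lift x}" using d by simp_all
      moreover have "{d \<in> D. d < unit_lift x} \<subseteq> {d \<in> D. d < unit_lift y}" using le by auto
      ultimately have "{d \<in> D. d < unit_lift x} \<subset> {d \<in> D. d < unit_lift y}" by blast
      then have "c x < c y" unfolding c_def using D(1) by (intro psubset_card_mono) auto
      with c_eq show False by simp
    qed
    show ?thesis
    proof (cases "unit_lift x = unit_lift y")
      case True
      then have "x = y" using to_circle_unit_lift by metis
      then show ?thesis by simp
    next
      case False
      then have "unit_lift x \<notin> D" using none[of "unit_lift x"] le by auto
      then have avoid: "u \<notin> D" if "u \<in> {unit_lift x..unit_lift y}" for u
        using none[of u] D_iff that by (cases "u = unit_lift y") auto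
      define S where "S = h i ` to_circle ` {unit_lift x..unit_lift y}"
      have "connected S"
        unfolding S_def using h[OF i] continuous_on_subset
        by (intro connected_continuous_image continuous_to_circle) auto
      moreover have "to_circle (real a / M) \<notin> S" if a: "a < M" for a
      proof
        assume "to_circle (real a / M) \<in> S"
        then obtain u where u: "u \<in> {unit_lift x..unit_lift y}" "h i (to_circle u) = to_circle (real a / M)"
          unfolding S_def by auto
        have "0 \<le> u" "u < 1" using u(1) unit_lift_bounds[of x] unit_lift_bounds[of y] by auto
        have "inv (h i) (to_circle (real a / M)) = to_circle u"
          unfolding u(2)[symmetric] using h[OF i] by (simp add: bij_is_inj)
        then have "unit_lift (inv (h i) (to_circle (real a / M))) = u"
          using unit_lift_unique \<open>0 \<le> u\<close> \<open>u < 1\<close> by simp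
        then have "u \<in> D" unfolding D_def using i a by (auto intro!: image_eqI[of _ _ "(i, a)"])
        with avoid[OF u(1)] show False by simp
      qed
      moreover have "h i x \<in> S" "h i y \<in> S"
        unfolding S_def using le to_circle_unit_lift
        by (auto intro!: imageI image_eqI[of x to_circle "unit_lift x"] image_eqI[of y to_circle "unit_lift y"])
      ultimately show ?thesis using arc_constant_on_connected[OF M] by blast
    qed
  qed
  then have "\<forall>x y. cls x = cls y \<longrightarrow> (\<forall>i<n. arc M (h i x) = arc M (h i y))"
    by (metis linear)
  ultimately show ?thesis by blast
qed

section \<open>Counting itineraries\<close>

text \<open>The name of a point in the partition of the phase space into cylinders over the window \<open>{-L..L}\<close> times
  \<open>2 ^ L\<close> arcs. The symbols outside the window are replaced by \<open>0\<close>; the number of arcs is a power of two to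
  make the partitions refine one another as \<open>L\<close> grows.\<close>

definition cell :: "nat \<Rightarrow> (int \<Rightarrow> nat) \<times> circle \<Rightarrow> (int \<Rightarrow> nat) \<times> nat" where
  "cell L p = ((\<lambda>i. if \<bar>i\<bar> \<le> int L then fst p i else 0), arc (2 ^ L) (snd p))"

lemma cell_eq_iff:
  "cell L p = cell L q \<longleftrightarrow> (\<forall>i. \<bar>i\<bar> \<le> int L \<longrightarrow> fst p i = fst q i) \<and> arc (2 ^ L) (snd p) = arc (2 ^ L) (snd q)"
  by (auto simp: cell_def fun_eq_iff)

lemma cell_mono:
  assumes "L \<le> L'" "cell L' p = cell L' q"
  shows "cell L p = cell L q"
  using assms
proof (induct L' rule: dec_induct)
  case (step m)
  have "arc (2 ^ Suc m) (snd p) = arc (2 ^ Suc m) (snd q)" using step(4) by (simp add: cell_eq_iff)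
  then have "arc (2 ^ m) (snd p) = arc (2 ^ m) (snd q)"
    using arc_double[of "2 ^ m" "snd p"] arc_double[of "2 ^ m" "snd q"] by simp
  then have "cell m p = cell m q" using step(4) by (auto simp: cell_eq_iff)
  then show ?case by (rule step(3))
qed

text \<open>The names, under \<open>g\<close>, of the first \<open>n\<close> points of the orbit of \<open>x\<close>.\<close>

definition itinerary :: "('a \<Rightarrow> 'b) \<Rightarrow> ('a \<Rightarrow> 'a) \<Rightarrow> nat \<Rightarrow> 'a \<Rightarrow> 'b list" where
  "itinerary g T n x = map (\<lambda>i. g ((T ^^ i) x)) [0..<n]"

text \<open>The itinerary of \<open>(\<xi>, x)\<close> is determined by the symbols of \<open>\<xi>\<close> in the window from \<open>-L\<close> to \<open>n + L - 1\<close> and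
  by the class of \<open>x\<close> relative to the fiber maps along this word.\<close>

lemma card_itineraries:
  assumes f: "\<forall>i<k. circle_C1_diffeo (f i)"
  shows "finite (itinerary (cell L) (skew_product f) n ` skew_space k)"
    and "card (itinerary (cell L) (skew_product f) n ` skew_space k) \<le> k ^ (n + 2 * L) * (2 * (n * 2 ^ L) + 1)"
proof -
  let ?X = "skew_space k" and ?I = "itinerary (cell L) (skew_product f) n"
  define word where "word p = map (\<lambda>i. fst p (int i - int L)) [0..<n + 2 * L]" for p :: "(int \<Rightarrow> nat) \<times> circle"
  have word: "fst p j = word p ! nat (j + int L)" if "- int L \<le> j" "j < int n + int L" for p j
    using that by (simp add: word_def nat_less_iff)
  define h where "h v i = fold f (map (\<lambda>j. v ! (L + j)) [0..<i])" for v :: "nat list" and i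
  have h: "(skew_product f ^^ i) p = ((\<lambda>j. fst p (j + int i)), h (word p) i (snd p))" if "i < n" for i p
  proof -
    have "map (\<lambda>i. fst p (int i)) [0..<i] = map (\<lambda>j. word p ! (L + j)) [0..<i]"
      using that by (auto simp: word_def)
    then show ?thesis unfolding skew_product_iterate h_def by (simp only:)
  qed
  define S where "S = {v. set v \<subseteq> {..<k} \<and> length v = n + 2 * L}"
  have S: "finite S" "card S = k ^ (n + 2 * L)"
    unfolding S_def using card_lists_length_eq[of "{..<k}" "n + 2 * L"] finite_lists_length_eq[of "{..<k}" "n + 2 * L"]
    by auto
  define good where "good v cls \<longleftrightarrow> (\<forall>x. cls x \<le> 2 * (n * 2 ^ L)) \<and>
    (\<forall>x y. cls x = cls y \<longrightarrow> (\<forall>i<n. arc (2 ^ L) (h v i x) = arc (2 ^ L) (h v i y)))" for v and cls :: "circle \<Rightarrow> nat"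
  have "\<forall>v. \<exists>cls. v \<in> S \<longrightarrow> good v cls"
  proof (intro allI)
    fix v
    have "continuous_on UNIV (h v i) \<and> bij (h v i)" if v: "v \<in> S" and i: "i < n" for i
    proof -
      have "set (map (\<lambda>j. v ! (L + j)) [0..<i]) \<subseteq> {..<k}"
      proof
        fix a assume "a \<in> set (map (\<lambda>j. v ! (L + j)) [0..<i])"
        then obtain j where "j < i" "a = v ! (L + j)" by auto
        moreover have "L + j < length v" using v i \<open>j < i\<close> by (simp add: S_def)
        then have "v ! (L + j) \<in> set v" by (rule nth_mem)
        ultimately show "a \<in> {..<k}" using v unfolding S_def by blast
      qed
      from circle_C1_diffeo_fold[OF f this] show ?thesis unfolding h_def using circle_C1_diffeoD by blast
    qed
    then show "\<exists>cls. v \<in> S \<longrightarrow> good v cls"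
      using arc_itinerary_classes[of "2 ^ L" n "h v"] unfolding good_def by (cases "v \<in> S") simp_all
  qed
  then obtain cls where "\<And>v. v \<in> S \<Longrightarrow> good v (cls v)" by metis
  then have cls: "\<And>v x. v \<in> S \<Longrightarrow> cls v x \<le> 2 * (n * 2 ^ L)"
    "\<And>v x y i. v \<in> S \<Longrightarrow> cls v x = cls v y \<Longrightarrow> i < n \<Longrightarrow> arc (2 ^ L) (h v i x) = arc (2 ^ L) (h v i y)"
    unfolding good_def by blast+
  define code where "code p = (word p, cls (word p) (snd p))" for p
  have wS: "word p \<in> S" if "p \<in> ?X" for p
    using skew_space_symbol[OF that] by (auto simp: S_def word_def)
  have sub: "code ` ?X \<subseteq> S \<times> {..2 * (n * 2 ^ L)}" using wS cls(1) by (auto simp: code_def)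
  have fin: "finite (S \<times> {..2 * (n * 2 ^ L)})" using S(1) by simp
  have code: "finite (code ` ?X)" "card (code ` ?X) \<le> k ^ (n + 2 * L) * (2 * (n * 2 ^ L) + 1)"
    using finite_subset[OF sub fin] card_mono[OF fin sub] S(2) by (simp_all add: card_cartesian_product)
  have det: "?I p = ?I q" if pq: "p \<in> ?X" "q \<in> ?X" "code p = code q" for p q
    unfolding itinerary_def
  proof (rule map_cong[OF refl])
    fix i assume "i \<in> set [0..<n]"
    then have i: "i < n" by simp
    have w: "word p = word q" and c: "cls (word p) (snd p) = cls (word p) (snd q)"
      using pq(3) by (auto simp: code_def)
    have "fst p (j + int i) = fst q (j + int i)" if "\<bar>j\<bar> \<le> int L" for j
      using word[of "j + int i" p] word[of "j + int i" q] that i w by auto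
    moreover have "arc (2 ^ L) (h (word p) i (snd p)) = arc (2 ^ L) (h (word q) i (snd q))"
      unfolding w[symmetric] using cls(2)[OF wS[OF pq(1)] c i] .
    ultimately show "cell L ((skew_product f ^^ i) p) = cell L ((skew_product f ^^ i) q)"
      unfolding cell_eq_iff h[OF i] by simp
  qed
  have "?I ` ?X = (\<lambda>c. ?I (SOME p. p \<in> ?X \<and> code p = c)) ` code ` ?X"
  proof -
    have "?I (SOME q. q \<in> ?X \<and> code q = code p) = ?I p" if "p \<in> ?X" for p
    proof -
      have "(SOME q. q \<in> ?X \<and> code q = code p) \<in> ?X \<and> code (SOME q. q \<in> ?X \<and> code q = code p) = code p"
        by (rule someI[of "\<lambda>q. q \<in> ?X \<and> code q = code p" p]) (use that in simp)
      then show ?thesis using det that by blast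
    qed
    then show ?thesis unfolding image_image by (intro image_cong) auto
  qed
  then show "finite (?I ` ?X)" "card (?I ` ?X) \<le> k ^ (n + 2 * L) * (2 * (n * 2 ^ L) + 1)"
    using code card_image_le[OF code(1), of "\<lambda>c. ?I (SOME p. p \<in> ?X \<and> code p = c)"] by auto
qed

lemma itineraries_growth:
  assumes k: "k > 0"
  shows "(\<lambda>n. ln (real (k ^ (n + 2 * L) * (2 * (n * 2 ^ L) + 1))) / real n) \<longlonglongrightarrow> ln k"
proof -
  define c where "c = 2 * (2 :: real) ^ L"
  have c: "c > 0" by (simp add: c_def)
  have "(\<lambda>n. ln k + (2 * L * ln k) * (1 / real n) + ln (c * real n + 1) / real n) \<longlonglongrightarrow> ln k + (2 * L * ln k) * 0 + 0"
  proof (intro tendsto_add tendsto_mult tendsto_const lim_1_over_n)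
    show "(\<lambda>n. ln (c * real n + 1) / real n) \<longlonglongrightarrow> 0" using c by real_asymp
  qed
  moreover have "\<forall>\<^sub>F n in sequentially. ln k + (2 * L * ln k) * (1 / real n) + ln (c * real n + 1) / real n
    = ln (real (k ^ (n + 2 * L) * (2 * (n * 2 ^ L) + 1))) / real n"
    using eventually_gt_at_top[of 0]
  proof eventually_elim
    case (elim n)
    have eq: "real (k ^ (n + 2 * L) * (2 * (n * 2 ^ L) + 1)) = real k ^ (n + 2 * L) * (c * real n + 1)"
      by (simp add: c_def algebra_simps)
    have "ln (real k ^ (n + 2 * L) * (c * real n + 1)) = (n + 2 * L) * ln k + ln (c * real n + 1)"
    proof -
      have "c * real n + 1 > 0" using c by (intro add_nonneg_pos) auto
      then show ?thesis using k by (simp add: ln_mult ln_realpow)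
    qed
    then show ?case unfolding eq using elim by (simp add: field_simps)
  qed
  ultimately show ?thesis by (simp add: tendsto_cong)
qed

section \<open>Topological entropy\<close>

text \<open>Locally uniformly, cells of a high level are contained in a given open set.\<close>

lemma cell_neighbourhood:
  assumes U: "open U" "p \<in> U"
  shows "\<exists>L V. open V \<and> p \<in> V \<and> (\<forall>q\<in>V. \<forall>q'. cell L q' = cell L q \<longrightarrow> q' \<in> U)"
proof -
  obtain A B where AB: "open A" "open B" "p \<in> A \<times> B" "A \<times> B \<subseteq> U"
    using open_prod_elim[OF U] by metis
  have "openin (product_topology (\<lambda>_. euclidean) UNIV) A" using AB(1) by (simp add: open_fun_def)
  moreover have "fst p \<in> A" using AB(3) by auto
  ultimately obtain X where X: "fst p \<in> (\<Pi>\<^sub>E i\<in>UNIV. X i)" "finite {i. X i \<noteq> UNIV}" "(\<Pi>\<^sub>E i\<in>UNIV. X i) \<subseteq> A"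
    using product_topology_open_contains_basis[of "\<lambda>_. euclidean" UNIV A "fst p"] by (auto simp: topspace_euclidean)
  have "snd p \<in> B" using AB(3) by auto
  then obtain e where e: "e > 0" "ball (snd p) e \<subseteq> B" by (rule openE[OF AB(2)])
  obtain L1 where L1: "(1 / 2 :: real) ^ L1 < e / 2" using real_arch_pow_inv[of "e / 2" "1 / 2"] e(1) by auto
  define L where "L = L1 + nat (Max (insert 0 (abs ` {i. X i \<noteq> UNIV})))"
  have L: "\<bar>i\<bar> \<le> int L" if "X i \<noteq> UNIV" for i
  proof -
    have "\<bar>i\<bar> \<le> Max (insert 0 (abs ` {i. X i \<noteq> UNIV}))" using X(2) that by (intro Max_ge) auto
    then show ?thesis unfolding L_def by linarith
  qed
  have eL: "1 / real (2 ^ L) < e / 2"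
  proof -
    have "(1 / 2 :: real) ^ L \<le> (1 / 2) ^ L1" by (intro power_decreasing) (auto simp: L_def)
    then show ?thesis using L1 by (simp add: power_one_over)
  qed
  define V where "V = (\<Inter>i\<in>{- int L..int L}. {q :: (int \<Rightarrow> nat) \<times> circle. fst q i = fst p i}) \<inter> (UNIV \<times> ball (snd p) (e / 2))"
  have "open V"
    unfolding V_def by (intro open_Int open_INT ballI open_symbol open_Times open_UNIV open_ball) simp
  moreover have "p \<in> V" using e(1) by (cases p) (auto simp: V_def)
  moreover have "q' \<in> U" if q: "q \<in> V" and c: "cell L q' = cell L q" for q q'
  proof -
    have agree: "fst q' i = fst p i" if "\<bar>i\<bar> \<le> int L" for i
    proof -
      have "i \<in> {- int L..int L}" using that by auto
      then have "fst q i = fst p i" using q unfolding V_def by blast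
      then show ?thesis using c that by (simp add: cell_eq_iff)
    qed
    have "fst q' i \<in> X i" for i
    proof (cases "X i = UNIV")
      case False
      then have "fst q' i = fst p i" by (intro agree L)
      moreover have "fst p i \<in> X i" using X(1) by auto
      ultimately show ?thesis by simp
    qed simp
    then have "fst q' \<in> A" using X(3) by auto
    moreover have "snd q' \<in> B"
    proof -
      have "dist (snd q') (snd q) \<le> 1 / real (2 ^ L)"
        using c by (intro arc_dist) (auto simp: cell_eq_iff)
      moreover have "dist (snd p) (snd q) < e / 2" using q unfolding V_def by (cases q) auto
      ultimately have "dist (snd p) (snd q') < e"
        using eL dist_triangle[of "snd p" "snd q'" "snd q"] by (simp add: dist_commute)
      then show ?thesis using e(2) by auto
    qed
    ultimately show ?thesis using AB(4) by (cases q') auto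
  qed
  ultimately show ?thesis by blast
qed

lemma compact_skew_space: "compact (skew_space k)"
proof -
  have "compactin (product_topology (\<lambda>_::int. euclidean) UNIV) (\<Pi>\<^sub>E i\<in>(UNIV :: int set). {..<k})"
    unfolding compactin_PiE by (auto simp: compactin_euclidean_iff finite_imp_compact)
  moreover have "(\<Pi>\<^sub>E i\<in>(UNIV :: int set). {..<k}) = full_shift k" by (auto simp: full_shift_def)
  ultimately have "compact (full_shift k)"
    by (simp add: euclidean_product_topology flip: compactin_euclidean_iff)
  then show ?thesis unfolding skew_space_def by (rule compact_Times) (rule compact_UNIV_circle)
qed

text \<open>A Lebesgue number lemma: fine enough cells lie inside members of a given open cover.\<close>

lemma cells_refine_cover:
  assumes "open_cover (skew_space k) C"
  shows "\<exists>L. \<forall>p\<in>skew_space k. \<exists>U\<in>C. {q \<in> skew_space k. cell L q = cell L p} \<subseteq> U"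
proof -
  let ?X = "skew_space k"
  define good where "good p L V \<longleftrightarrow> open V \<and> p \<in> V \<and>
    (\<exists>U\<in>C. \<forall>q\<in>V. \<forall>q'\<in>?X. cell L q' = cell L q \<longrightarrow> q' \<in> U)" for p L V
  have "\<forall>p\<in>?X. \<exists>L V. good p L V"
  proof
    fix p assume "p \<in> ?X"
    then obtain U where U: "U \<in> C" "p \<in> U" using assms unfolding open_cover_def by blast
    then obtain G where G: "open G" "U = ?X \<inter> G" using assms unfolding open_cover_def openin_open by blast
    then obtain L V where "open V" "p \<in> V" "\<forall>q\<in>V. \<forall>q'. cell L q' = cell L q \<longrightarrow> q' \<in> G"
      using cell_neighbourhood[of G p] U(2) by blast
    with U(1) G(2) have "good p L V" unfolding good_def by blast
    then show "\<exists>L V. good p L V" by blast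
  qed
  then obtain L V where LV: "\<And>p. p \<in> ?X \<Longrightarrow> good p (L p) (V p)" by metis
  have "open (V p)" if "p \<in> ?X" for p using LV[OF that] by (simp add: good_def)
  moreover have "?X \<subseteq> (\<Union>p\<in>?X. V p)" using LV by (auto simp: good_def)
  ultimately obtain F where F: "F \<subseteq> ?X" "finite F" "?X \<subseteq> (\<Union>p\<in>F. V p)"
    by (rule compactE_image[OF compact_skew_space[of k]])
  define M where "M = Max (insert 0 (L ` F))"
  have "\<exists>U\<in>C. {q \<in> ?X. cell M q = cell M p} \<subseteq> U" if p: "p \<in> ?X" for p
  proof -
    obtain z where z: "z \<in> F" "p \<in> V z" using F(3) p by blast
    then obtain U where U: "U \<in> C" "\<forall>q\<in>V z. \<forall>q'\<in>?X. cell (L z) q' = cell (L z) q \<longrightarrow> q' \<in> U"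
      using LV[of z] F(1) unfolding good_def by blast
    have "L z \<le> M" unfolding M_def using F(2) z(1) by (intro Max_ge) auto
    then have "{q \<in> ?X. cell M q = cell M p} \<subseteq> U" using U(2) z(2) cell_mono by blast
    with U(1) show ?thesis by blast
  qed
  then show ?thesis by blast
qed

lemma topological_entropy_le:
  assumes k: "k > 0" and f: "\<forall>i<k. circle_C1_diffeo (f i)"
  shows "topological_entropy (skew_space k) (skew_product f) \<le> ereal (ln k)"
  unfolding topological_entropy_def
proof (rule SUP_least)
  let ?X = "skew_space k" and ?T = "skew_product f"
  fix C assume "C \<in> {C. open_cover ?X C}"
  then obtain L where L: "\<forall>p\<in>?X. \<exists>U\<in>C. {q \<in> ?X. cell L q = cell L p} \<subseteq> U"
    using cells_refine_cover by blast
  define I where "I = itinerary (cell L) ?T"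
  define N where "N n = k ^ (n + 2 * L) * (2 * (n * 2 ^ L) + 1)" for n
  have "\<forall>v. \<exists>U. v \<in> cell L ` ?X \<longrightarrow> U \<in> C \<and> (\<forall>q\<in>?X. cell L q = v \<longrightarrow> q \<in> U)" using L by blast
  then obtain U where U: "\<And>v. v \<in> cell L ` ?X \<Longrightarrow> U v \<in> C" "\<And>q. q \<in> ?X \<Longrightarrow> q \<in> U (cell L q)"
    by (metis imageI)
  have min_le: "min_subcover ?X (dynamical_join ?X ?T C n) \<le> N n" for n
  proof -
    define D where "D l = {x \<in> ?X. \<forall>i<n. (?T ^^ i) x \<in> U (l ! i)}" for l
    have nth: "I n p ! i = cell L ((?T ^^ i) p)" if "i < n" for p i
      using that by (simp add: I_def itinerary_def)
    have inX: "(?T ^^ i) p \<in> ?X" if "p \<in> ?X" for i p using that by (rule skew_product_iterate_in_space)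
    have "D ` I n ` ?X \<subseteq> dynamical_join ?X ?T C n"
    proof safe
      fix p assume p: "p \<in> ?X"
      have "(\<lambda>i. U (I n p ! i)) \<in> {..<n} \<rightarrow> C" using U(1) inX[OF p] nth by auto
      then show "D (I n p) \<in> dynamical_join ?X ?T C n"
        unfolding dynamical_join_def D_def by (intro CollectI exI[of _ "\<lambda>i. U (I n p ! i)"] conjI refl)
    qed
    moreover have "?X \<subseteq> \<Union> (D ` I n ` ?X)"
    proof
      fix p assume p: "p \<in> ?X"
      then have "p \<in> D (I n p)" unfolding D_def using U(2)[OF inX[OF p]] nth by simp
      then show "p \<in> \<Union> (D ` I n ` ?X)" using p by blast
    qed
    moreover have "finite (D ` I n ` ?X)" using card_itineraries(1)[OF f] unfolding I_def by simp
    ultimately have "min_subcover ?X (dynamical_join ?X ?T C n) \<le> card (D ` I n ` ?X)"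
      unfolding min_subcover_def by (intro Least_le) blast
    also have "\<dots> \<le> card (I n ` ?X)" using card_itineraries(1)[OF f] unfolding I_def by (intro card_image_le)
    also have "\<dots> \<le> N n" using card_itineraries(2)[OF f] unfolding I_def N_def .
    finally show ?thesis .
  qed
  have "ln (real (min_subcover ?X (dynamical_join ?X ?T C n))) / real n \<le> ln (real (N n)) / real n" for n
  proof (intro divide_right_mono)
    have "N n > 0" using k by (simp add: N_def)
    then have N1: "real (N n) \<ge> 1" by linarith
    define m where "m = min_subcover ?X (dynamical_join ?X ?T C n)"
    have m: "real m \<le> real (N n)" using min_le[of n] unfolding m_def of_nat_le_iff .
    have "ln (real m) \<le> ln (real (N n))"
    proof (cases "m = 0")
      case True
      then show ?thesis using N1 by simp
    next
      case False
      then show ?thesis using m by (intro ln_mono) auto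
    qed
    then show "ln (real (min_subcover ?X (dynamical_join ?X ?T C n))) \<le> ln (real (N n))"
      unfolding m_def .
  qed simp
  then have "limsup (\<lambda>n. ereal (ln (real (min_subcover ?X (dynamical_join ?X ?T C n))) / real n))
    \<le> limsup (\<lambda>n. ereal (ln (real (N n)) / real n))"
    by (intro Limsup_mono) auto
  also have "\<dots> = ereal (ln k)"
    using itineraries_growth[OF k, of L] unfolding N_def by (intro lim_imp_Limsup) (auto intro: tendsto_ereal)
  finally show "limsup (\<lambda>n. ereal (ln (real (min_subcover ?X (dynamical_join ?X ?T C n))) / real n)) \<le> ereal (ln k)" .
qed

text \<open>The cover by the symbol at time \<open>0\<close> is a partition into open sets, and a subcover of its \<open>n\<close>-th join needs
  one element for every word of length \<open>n\<close>.\<close>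

lemma topological_entropy_ge:
  assumes k: "k > 0"
  shows "ereal (ln k) \<le> topological_entropy (skew_space k) (skew_product f)"
proof -
  let ?X = "skew_space k" and ?T = "skew_product f"
  define C where "C = (\<lambda>a. ?X \<inter> {p. fst p 0 = a}) ` {..<k}"
  have cover: "open_cover ?X C"
    unfolding open_cover_def
  proof
    show "\<forall>U\<in>C. openin (top_of_set ?X) U" using open_symbol unfolding C_def by (auto intro: openin_open_Int)
    show "\<Union>C = ?X" using skew_space_symbol by (auto simp: C_def)
  qed
  have ge: "k ^ n \<le> min_subcover ?X (dynamical_join ?X ?T C n)" for n
  proof -
    have fin: "finite (dynamical_join ?X ?T C n)" by (rule finite_dynamical_join) (simp add: C_def)
    have "\<Union> (dynamical_join ?X ?T C n) = ?X"
      using cover by (intro Union_dynamical_join) (auto simp: open_cover_def intro: skew_product_in_space)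
    then have "\<exists>m. \<exists>D\<subseteq>dynamical_join ?X ?T C n. finite D \<and> card D = m \<and> ?X \<subseteq> \<Union>D" using fin by blast
    then have "\<exists>D\<subseteq>dynamical_join ?X ?T C n. finite D \<and> card D = min_subcover ?X (dynamical_join ?X ?T C n) \<and> ?X \<subseteq> \<Union>D"
      unfolding min_subcover_def by (rule LeastI_ex)
    then obtain D where D: "D \<subseteq> dynamical_join ?X ?T C n" "finite D"
      "card D = min_subcover ?X (dynamical_join ?X ?T C n)" "?X \<subseteq> \<Union>D" by blast
    define S where "S = {u. set u \<subseteq> {..<k} \<and> length u = n}"
    have S: "card S = k ^ n" unfolding S_def using card_lists_length_eq[of "{..<k}" n] by simp
    define pt where "pt u = ((\<lambda>i. if 0 \<le> i \<and> i < int n then u ! nat i else 0), to_circle 0)" for u :: "nat list"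
    have pt: "pt u \<in> ?X" if "u \<in> S" for u
    proof -
      have "fst (pt u) i < k" for i
      proof (cases "0 \<le> i \<and> i < int n")
        case True
        then have "u ! nat i \<in> set u" using that by (intro nth_mem) (auto simp: S_def)
        then show ?thesis using that True by (auto simp: S_def pt_def)
      qed (use k in \<open>auto simp: pt_def\<close>)
      then show ?thesis by (simp add: skew_space_def full_shift_def pt_def)
    qed
    have "\<forall>u\<in>S. \<exists>B\<in>D. pt u \<in> B" using pt D(4) by blast
    then obtain B where B: "\<And>u. u \<in> S \<Longrightarrow> B u \<in> D" "\<And>u. u \<in> S \<Longrightarrow> pt u \<in> B u" by metis
    have "inj_on B S"
    proof (rule inj_onI)
      fix u v assume uv: "u \<in> S" "v \<in> S" "B u = B v"
      have "B u \<in> dynamical_join ?X ?T C n" using B(1)[OF uv(1)] D(1) by blast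
      then obtain A where A: "A \<in> {..<n} \<rightarrow> C" "B u = {x \<in> ?X. \<forall>i<n. (?T ^^ i) x \<in> A i}"
        unfolding dynamical_join_def by blast
      show "u = v"
      proof (rule nth_equalityI)
        show "length u = length v" using uv by (simp add: S_def)
        fix i assume "i < length u"
        then have i: "i < n" using uv by (simp add: S_def)
        have "(?T ^^ i) (pt u) \<in> A i" "(?T ^^ i) (pt v) \<in> A i"
          using B(2)[OF uv(1)] B(2)[OF uv(2)] uv(3) A(2) i by auto
        moreover obtain a where "A i = ?X \<inter> {p. fst p 0 = a}" using A(1) i by (auto simp: C_def Pi_iff)
        ultimately have "fst ((?T ^^ i) (pt u)) 0 = fst ((?T ^^ i) (pt v)) 0" by simp
        then show "u ! i = v ! i" using i by (simp add: skew_product_iterate pt_def)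
      qed
    qed
    then have "card S \<le> card D" using B(1) D(2) by (intro card_inj_on_le) auto
    then show ?thesis using D(3) S by simp
  qed
  have "ereal (ln k) = limsup (\<lambda>n. ereal (ln (real (k ^ n)) / real n))"
  proof -
    have "\<forall>\<^sub>F n in sequentially. ln (real k) = ln (real (k ^ n)) / real n"
      using eventually_gt_at_top[of 0] by eventually_elim (use k in \<open>simp add: ln_realpow\<close>)
    then have "(\<lambda>n. ln (real (k ^ n)) / real n) \<longlonglongrightarrow> ln k" by (rule tendsto_eventually[OF eventually_mono]) simp
    then show ?thesis by (intro lim_imp_Limsup[symmetric]) (auto intro: tendsto_ereal)
  qed
  also have "\<dots> \<le> limsup (\<lambda>n. ereal (ln (real (min_subcover ?X (dynamical_join ?X ?T C n))) / real n))"
  proof (intro Limsup_mono always_eventually allI)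
    fix n
    have "0 < real (k ^ n)" using k by simp
    then have "ln (real (k ^ n)) \<le> ln (real (min_subcover ?X (dynamical_join ?X ?T C n)))"
      using ge[of n] by (intro ln_mono) (simp_all only: of_nat_le_iff)
    then show "ereal (ln (real (k ^ n)) / real n) \<le> ereal (ln (real (min_subcover ?X (dynamical_join ?X ?T C n))) / real n)"
      by (simp add: divide_right_mono)
  qed
  also have "\<dots> \<le> topological_entropy ?X ?T"
    unfolding topological_entropy_def using cover by (intro SUP_upper) simp
  finally show ?thesis .
qed

section \<open>Metric entropy is at most the logarithm of the number of symbols\<close>

text \<open>The entropy, with natural logarithms, of the distribution of a variable with finitely many values.\<close>

abbreviation shannon_entropy :: "'a measure \<Rightarrow> ('a \<Rightarrow> 'b) \<Rightarrow> real" where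
  "shannon_entropy M X \<equiv> prob_space.entropy M (exp 1) (count_space (X ` space M)) X"

lemma (in information_space) entropy_as_sum:
  assumes X: "simple_function M X" and S: "X ` space M \<subseteq> S" "finite S"
  shows "\<H>(X) = - (\<Sum>x\<in>S. prob (X -` {x} \<inter> space M) * log b (prob (X -` {x} \<inter> space M)))"
proof -
  have "\<H>(X) = - (\<Sum>x\<in>X ` space M. prob (X -` {x} \<inter> space M) * log b (prob (X -` {x} \<inter> space M)))"
    by (rule entropy_simple_distributed[OF simple_distributedI[OF X measure_nonneg refl]])
  also have "(\<Sum>x\<in>X ` space M. prob (X -` {x} \<inter> space M) * log b (prob (X -` {x} \<inter> space M)))
    = (\<Sum>x\<in>S. prob (X -` {x} \<inter> space M) * log b (prob (X -` {x} \<inter> space M)))"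
  proof (rule sum.mono_neutral_left[OF S(2,1)], rule ballI)
    fix x assume "x \<in> S - X ` space M"
    then have "X -` {x} \<inter> space M = {}" by auto
    then show "prob (X -` {x} \<inter> space M) * log b (prob (X -` {x} \<inter> space M)) = 0" by simp
  qed
  finally show ?thesis .
qed

lemma (in information_space) entropy_pair_le:
  assumes "simple_function M X" "simple_function M Y"
  shows "\<H>(\<lambda>x. (X x, Y x)) \<le> \<H>(X) + \<H>(Y)"
  using entropy_chain_rule[OF assms] conditional_entropy_less_eq_entropy[OF assms(2,1)] by simp

lemma simple_function_iterate:
  assumes g: "simple_function M g" and T: "T \<in> measurable M M"
  shows "simple_function M (\<lambda>x. g ((T ^^ n) x))"
proof -
  have Tn: "(T ^^ n) \<in> measurable M M"
  proof (induct n)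
    case (Suc n)
    then show ?case unfolding funpow.simps using T by (rule measurable_comp)
  qed simp
  have "(\<lambda>x. g ((T ^^ n) x)) ` space M \<subseteq> g ` space M" using measurable_space[OF Tn] by blast
  moreover have "finite (g ` space M)" using g by (rule simple_functionD)
  moreover have "(\<lambda>x. g ((T ^^ n) x)) -` {y} \<inter> space M \<in> sets M" for y
  proof -
    have "g -` {y} \<inter> space M \<in> sets M" using g by (rule simple_functionD)
    with Tn have "(T ^^ n) -` (g -` {y} \<inter> space M) \<inter> space M \<in> sets M" by (rule measurable_sets)
    moreover have "(T ^^ n) -` (g -` {y} \<inter> space M) \<inter> space M = (\<lambda>x. g ((T ^^ n) x)) -` {y} \<inter> space M"
      using measurable_space[OF Tn] by blast
    ultimately show ?thesis by simp
  qed
  ultimately show ?thesis unfolding simple_function_def using finite_subset by blast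
qed

lemma itinerary_Suc: "itinerary g T (Suc n) x = itinerary g T n x @ [g ((T ^^ n) x)]"
  by (simp add: itinerary_def)

lemma simple_function_itinerary:
  assumes g: "simple_function M g" and T: "T \<in> measurable M M"
  shows "simple_function M (itinerary g T n)"
proof (induct n)
  case 0
  show ?case by (simp add: itinerary_def)
next
  case (Suc n)
  have "simple_function M ((\<lambda>(l, a). l @ [a]) \<circ> (\<lambda>x. (itinerary g T n x, g ((T ^^ n) x))))"
    by (intro simple_function_compose simple_function_Pair Suc simple_function_iterate[OF g T])
  moreover have "(\<lambda>(l, a). l @ [a]) \<circ> (\<lambda>x. (itinerary g T n x, g ((T ^^ n) x))) = itinerary g T (Suc n)"
    by (simp add: fun_eq_iff itinerary_Suc)
  ultimately show ?case by simp
qed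

lemma (in information_space) entropy_itinerary_le:
  assumes g: "simple_function M g" and T: "T \<in> measurable M M" and inv: "distr M M T = M"
  shows "\<H>(itinerary g T n) \<le> n * \<H>(g)"
proof (induct n)
  case 0
  have "itinerary g T 0 -` {[]} \<inter> space M = space M" by (auto simp: itinerary_def)
  then have "\<H>(itinerary g T 0) = 0"
    using entropy_as_sum[OF simple_function_itinerary[OF g T], of 0 "{[]}"]
    by (auto simp: itinerary_def prob_space)
  then show ?case by simp
next
  case (Suc n)
  let ?gn = "\<lambda>x. g ((T ^^ n) x)"
  have gn: "simple_function M ?gn" by (rule simple_function_iterate[OF g T])
  have Tn: "(T ^^ n) \<in> measurable M M \<and> distr M M (T ^^ n) = M" for n
  proof (induct n)
    case 0
    show ?case by (simp add: id_def)
  next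
    case (Suc n)
    have "(T \<circ> (T ^^ n)) \<in> measurable M M" using Suc T by (intro measurable_comp) auto
    moreover have "distr M M (T \<circ> (T ^^ n)) = M" using Suc T inv distr_distr[of T M M "T ^^ n" M] by simp
    ultimately show ?case unfolding funpow.simps by blast
  qed
  have "\<H>(?gn) = \<H>(g)"
  proof -
    have fin: "finite (g ` space M)" using g by (rule simple_functionD)
    have sub: "?gn ` space M \<subseteq> g ` space M" using measurable_space[OF conjunct1[OF Tn]] by blast
    have "prob (?gn -` {y} \<inter> space M) = prob (g -` {y} \<inter> space M)" for y
    proof -
      have m: "g -` {y} \<inter> space M \<in> sets M" using g by (rule simple_functionD)
      have "?gn -` {y} \<inter> space M = (T ^^ n) -` (g -` {y} \<inter> space M) \<inter> space M"
        using measurable_space[OF conjunct1[OF Tn]] by blast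
      then have "prob (?gn -` {y} \<inter> space M) = measure (distr M M (T ^^ n)) (g -` {y} \<inter> space M)"
        using measure_distr[OF conjunct1[OF Tn[of n]] m] by (simp only:)
      then show ?thesis using Tn by simp
    qed
    then show ?thesis
      unfolding entropy_as_sum[OF gn sub fin] entropy_as_sum[OF g order_refl fin] by simp
  qed
  moreover have "\<H>(itinerary g T (Suc n)) \<le> \<H>(\<lambda>x. (itinerary g T n x, ?gn x))"
  proof -
    have eq: "itinerary g T (Suc n) = (\<lambda>(l, a). l @ [a]) \<circ> (\<lambda>x. (itinerary g T n x, ?gn x))"
      by (simp add: fun_eq_iff itinerary_Suc)
    show ?thesis
      unfolding eq by (rule entropy_data_processing[OF simple_function_Pair[OF simple_function_itinerary[OF g T] gn]])
  qed
  moreover have "\<H>(\<lambda>x. (itinerary g T n x, ?gn x)) \<le> \<H>(itinerary g T n) + \<H>(?gn)"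
    by (intro entropy_pair_le simple_function_itinerary[OF g T] gn)
  ultimately show ?case using Suc by (simp add: algebra_simps)
qed

lemma neg_mult_ln_le:
  fixes q :: real
  assumes "0 \<le> q"
  shows "- (q * ln q) \<le> 2 * sqrt q"
proof (cases "q = 0")
  case False
  with assms have q: "q > 0" by simp
  have "ln (1 / sqrt q) \<le> 1 / sqrt q - 1" using q by (intro ln_le_minus_one) simp
  then have "- ln q \<le> 2 / sqrt q" using q by (simp add: ln_div ln_sqrt)
  then have "q * - ln q \<le> q * (2 / sqrt q)" using q by (intro mult_left_mono) auto
  also have "q * (2 / sqrt q) = 2 * (q / sqrt q)" by simp
  also have "q / sqrt q = sqrt q" using assms by (rule real_div_sqrt)
  finally show ?thesis by simp
qed simp

text \<open>A variable that is constant outside an event of small probability has small entropy.\<close>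

lemma (in prob_space) entropy_rare:
  assumes Z: "simple_function M Z" and P: "finite P" "Z ` space M \<subseteq> insert None (Some ` P)"
    and d: "prob {x \<in> space M. Z x \<noteq> None} \<le> d" "d < 1"
  shows "shannon_entropy M Z \<le> - ln (1 - d) + 2 * card P * sqrt d"
proof -
  interpret information_space M "exp 1" by unfold_locales simp
  define p where "p z = prob (Z -` {z} \<inter> space M)" for z
  have sets: "Z -` A \<inter> space M \<in> sets M" for A using Z by (rule simple_functionD)
  have comp: "space M - (Z -` {None} \<inter> space M) = {x \<in> space M. Z x \<noteq> None}" by auto
  have "p None = 1 - prob {x \<in> space M. Z x \<noteq> None}"
    using prob_compl[OF sets[of "{None}"]] unfolding p_def comp by simp
  then have p0: "1 - d \<le> p None" "p None \<le> 1" using d(1) by (auto simp: p_def)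
  have "{x \<in> space M. Z x \<noteq> None} \<in> sets M" using sets.compl_sets[OF sets[of "{None}"]] unfolding comp .
  then have "p (Some A) \<le> prob {x \<in> space M. Z x \<noteq> None}" for A
    unfolding p_def by (intro finite_measure_mono) auto
  then have pS: "p (Some A) \<le> d" for A using d(1) order_trans by blast
  have "- (p None * ln (p None)) \<le> - ln (1 - d)"
  proof -
    have "ln (p None) \<le> 0" using p0 d(2) by simp
    then have "- (p None * ln (p None)) \<le> - ln (p None)"
      using p0(2) mult_left_le_one_le[of "- ln (p None)" "p None"] d(2) p0(1) by simp
    also have "\<dots> \<le> - ln (1 - d)" using p0(1) d(2) by simp
    finally show ?thesis .
  qed
  moreover have "(\<Sum>A\<in>P. - (p (Some A) * ln (p (Some A)))) \<le> (\<Sum>A\<in>P. 2 * sqrt d)"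
  proof (rule sum_mono)
    fix A
    have "- (p (Some A) * ln (p (Some A))) \<le> 2 * sqrt (p (Some A))" by (intro neg_mult_ln_le) (simp add: p_def)
    also have "\<dots> \<le> 2 * sqrt d" using pS by simp
    finally show "- (p (Some A) * ln (p (Some A))) \<le> 2 * sqrt d" .
  qed
  moreover have "shannon_entropy M (Z) = - (\<Sum>z\<in>insert None (Some ` P). p z * ln (p z))"
  proof -
    have "log (exp 1) x = ln x" for x :: real by (simp add: log_def)
    then show ?thesis using entropy_as_sum[OF Z P(2)] P(1) unfolding p_def by (simp only: finite_insert finite_imageI)
  qed
  moreover have "(\<Sum>z\<in>insert None (Some ` P). p z * ln (p z)) = p None * ln (p None) + (\<Sum>A\<in>P. p (Some A) * ln (p (Some A)))"
    using P(1) by (subst sum.insert) (auto simp: sum.reindex)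
  ultimately show ?thesis by (simp add: sum_negf)
qed

text \<open>The element of the partition \<open>P\<close> that contains \<open>x\<close>.\<close>

definition partition_element :: "'a set set \<Rightarrow> 'a \<Rightarrow> 'a set" where
  "partition_element P x = (THE A. A \<in> P \<and> x \<in> A)"

lemma partition_element_eq:
  assumes "partition_on X P" "A \<in> P" "x \<in> A"
  shows "partition_element P x = A"
  unfolding partition_element_def
proof (rule the_equality)
  show "A \<in> P \<and> x \<in> A" using assms(2,3) ..
  show "B = A" if "B \<in> P \<and> x \<in> B" for B
    using that assms disjointD[OF partition_onD2[OF assms(1)], of A B] by blast
qed

lemma partition_element_in:
  assumes "partition_on X P" "x \<in> X"
  shows "partition_element P x \<in> P" "x \<in> partition_element P x"
proof -
  obtain A where "A \<in> P" "x \<in> A" using assms unfolding partition_on_def by blast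
  then show "partition_element P x \<in> P" "x \<in> partition_element P x"
    using partition_element_eq[OF assms(1)] by auto
qed

lemma simple_function_partition_element:
  assumes "partition_on (space M) P" "finite P" "P \<subseteq> sets M"
  shows "simple_function M (partition_element P)"
proof -
  have sub: "partition_element P ` space M \<subseteq> P" using partition_element_in[OF assms(1)] by blast
  moreover have "partition_element P -` {A} \<inter> space M = A" if "A \<in> P" for A
    using that assms(1,3) partition_element_eq[OF assms(1) that] partition_element_in[OF assms(1)] sets.sets_into_space
    by blast
  ultimately show ?thesis unfolding simple_function_def using assms(2,3) finite_subset by (metis subset_iff)
qed

text \<open>The nonempty elements of the dynamical join are the level sets of the itinerary.\<close>

lemma partition_entropy_join:
  fixes n :: nat
  assumes "prob_space M" and P: "partition_on (space M) P" "finite P" "P \<subseteq> sets M" and T: "T \<in> measurable M M"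
  defines "I \<equiv> itinerary (partition_element P) T n"
  shows "partition_entropy M (dynamical_join (space M) T P n) = shannon_entropy M I"
proof -
  interpret prob_space M by fact
  interpret information_space M "exp 1" by unfold_locales simp
  let ?J = "dynamical_join (space M) T P n"
  have I: "simple_function M I"
    unfolding I_def by (intro simple_function_itinerary simple_function_partition_element P T)
  have TX: "(T ^^ i) x \<in> space M" if "x \<in> space M" for i x
    using that measurable_space[OF T] by (induct i) auto
  define \<Psi> where "\<Psi> l = I -` {l} \<inter> space M" for l
  have I_iff: "I x = I y \<longleftrightarrow> (\<forall>i<n. partition_element P ((T ^^ i) x) = partition_element P ((T ^^ i) y))" for x y
    by (auto simp: I_def itinerary_def)
  have inj: "inj_on \<Psi> (I ` space M)" by (rule inj_onI) (auto simp: \<Psi>_def)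
  have elem_iff: "z \<in> B \<longleftrightarrow> partition_element P z = B" if "z \<in> space M" "B \<in> P" for z B
    using partition_element_eq[OF P(1) that(2)] partition_element_in(2)[OF P(1) that(1)] by blast
  have "?J - {{}} = \<Psi> ` I ` space M"
  proof (intro equalityI subsetI)
    fix C assume "C \<in> ?J - {{}}"
    then obtain A x where A: "A \<in> {..<n} \<rightarrow> P" "C = {x \<in> space M. \<forall>i<n. (T ^^ i) x \<in> A i}" and x: "x \<in> C"
      by (auto simp: dynamical_join_def)
    have eq: "y \<in> C \<longleftrightarrow> y \<in> space M \<and> (\<forall>i<n. partition_element P ((T ^^ i) y) = A i)" for y
    proof -
      have "(T ^^ i) y \<in> A i \<longleftrightarrow> partition_element P ((T ^^ i) y) = A i" if "y \<in> space M" "i < n" for i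
        using A(1) that by (intro elem_iff TX) auto
      then show ?thesis unfolding A(2) by blast
    qed
    have "C = \<Psi> (I x)"
    proof (rule set_eqI)
      fix y
      show "y \<in> C \<longleftrightarrow> y \<in> \<Psi> (I x)"
        using eq[of x] eq[of y] x I_iff[of y x] unfolding \<Psi>_def by auto
    qed
    moreover have "x \<in> space M" using x eq by blast
    ultimately show "C \<in> \<Psi> ` I ` space M" by blast
  next
    fix C assume "C \<in> \<Psi> ` I ` space M"
    then obtain x where x: "x \<in> space M" "C = \<Psi> (I x)" by blast
    define A where "A i = partition_element P ((T ^^ i) x)" for i
    have "A i \<in> P" for i unfolding A_def using partition_element_in[OF P(1) TX[OF x(1)]] by simp
    moreover have "C = {y \<in> space M. \<forall>i<n. (T ^^ i) y \<in> A i}"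
    proof (rule set_eqI)
      fix y
      have "(T ^^ i) y \<in> A i \<longleftrightarrow> partition_element P ((T ^^ i) y) = A i" if "y \<in> space M" for i
        by (rule elem_iff[OF TX[OF that] \<open>A i \<in> P\<close>])
      then show "y \<in> C \<longleftrightarrow> y \<in> {y \<in> space M. \<forall>i<n. (T ^^ i) y \<in> A i}"
        unfolding x(2) \<Psi>_def using I_iff[of y x] by (auto simp: A_def)
    qed
    ultimately have "C \<in> ?J" unfolding dynamical_join_def by blast
    moreover have "x \<in> C" using x by (simp add: \<Psi>_def)
    ultimately show "C \<in> ?J - {{}}" by blast
  qed
  moreover have "(\<Sum>A\<in>?J. prob A * ln (prob A)) = (\<Sum>A\<in>?J - {{}}. prob A * ln (prob A))"
    using finite_dynamical_join[OF P(2)] by (intro sum.mono_neutral_right) auto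
  ultimately have "partition_entropy M ?J = - (\<Sum>l\<in>I ` space M. prob (\<Psi> l) * ln (prob (\<Psi> l)))"
    unfolding partition_entropy_def using inj by (simp add: sum.reindex)
  also have "\<dots> = shannon_entropy M (I)"
  proof -
    have "log (exp 1) x = ln x" for x :: real by (simp add: log_def)
    then show ?thesis
      using entropy_as_sum[OF I order_refl simple_functionD(1)[OF I]] unfolding \<Psi>_def by (simp only:)
  qed
  finally show ?thesis .
qed

section \<open>Cells generate the Borel sets\<close>

lemma finite_cells:
  assumes "\<forall>i<k. circle_C1_diffeo (f i)"
  shows "finite (cell L ` skew_space k)"
proof -
  have "cell L ` skew_space k = hd ` itinerary (cell L) (skew_product f) 1 ` skew_space k"
    by (simp add: image_image itinerary_def)
  then show ?thesis using card_itineraries(1)[OF assms, of L 1] by simp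
qed

lemma borel_arc:
  assumes M: "M > 0"
  shows "{x. arc M x = a} \<in> sets borel"
proof (cases "a < M")
  case True
  define K where "K = (\<lambda>b. to_circle (real b / M)) ` {..<M}"
  have "finite S \<Longrightarrow> S \<in> sets borel" for S :: "circle set"
    by (intro borel_closed finite_imp_closed)
  moreover have "{x. arc M x = a} = (open_arc M a - K) \<union> {x \<in> K. arc M x = a}"
    using arc_iff_open_arc[OF M _ True] by (auto simp: K_def)
  moreover have "finite K" by (simp add: K_def)
  moreover have "open_arc M a \<in> sets borel" by (intro borel_open open_open_arc)
  ultimately show ?thesis by (simp add: sets.Un sets.Diff)
next
  case False
  then have "{x. arc M x = a} = {}" using arc_less[OF M] by auto
  then show ?thesis by simp
qed

lemma sets_cells:
  assumes f: "\<forall>i<k. circle_C1_diffeo (f i)"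
  shows "{p \<in> skew_space k. cell L p \<in> V} \<in> sets (restrict_space borel (skew_space k))"
proof -
  let ?X = "skew_space k"
  have "{p \<in> ?X. cell L p = cell L q} \<in> sets (restrict_space borel ?X)" for q
  proof -
    have "(\<Inter>i\<in>{- int L..int L}. {p :: (int \<Rightarrow> nat) \<times> circle. fst p i = fst q i}) \<in> sets borel"
      by (intro borel_open open_INT ballI open_symbol) simp
    moreover have "snd -` {x. arc (2 ^ L) x = arc (2 ^ L) (snd q)} \<inter> space borel \<in> sets (borel :: ((int \<Rightarrow> nat) \<times> circle) measure)"
      by (rule measurable_sets[OF _ borel_arc]) (auto intro!: borel_measurable_continuous_onI continuous_on_snd)
    ultimately have "(\<Inter>i\<in>{- int L..int L}. {p. fst p i = fst q i}) \<inter>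
        snd -` {x. arc (2 ^ L) x = arc (2 ^ L) (snd q)} \<in> sets (borel :: ((int \<Rightarrow> nat) \<times> circle) measure)"
      by (simp add: sets.Int)
    moreover have "{p \<in> ?X. cell L p = cell L q} = ?X \<inter> ((\<Inter>i\<in>{- int L..int L}. {p. fst p i = fst q i}) \<inter>
        snd -` {x. arc (2 ^ L) x = arc (2 ^ L) (snd q)})"
      by (auto simp: cell_eq_iff abs_le_iff)
    ultimately show ?thesis unfolding sets_restrict_space by blast
  qed
  then have "(\<Union>v\<in>V \<inter> cell L ` ?X. {p \<in> ?X. cell L p = v}) \<in> sets (restrict_space borel ?X)"
    using finite_cells[OF f, of L] by (intro sets.finite_UN) auto
  moreover have "(\<Union>v\<in>V \<inter> cell L ` ?X. {p \<in> ?X. cell L p = v}) = {p \<in> ?X. cell L p \<in> V}" by auto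
  ultimately show ?thesis by simp
qed

text \<open>The unions of cells of one level, for all levels.\<close>

definition cell_algebra :: "nat \<Rightarrow> ((int \<Rightarrow> nat) \<times> circle) set set" where
  "cell_algebra k = {A. \<exists>L V. A = {p \<in> skew_space k. cell L p \<in> V}}"

lemma cell_algebra_refine:
  assumes "A = {p \<in> skew_space k. cell L p \<in> V}" "L \<le> L'"
  shows "A = {p \<in> skew_space k. cell L' p \<in> cell L' ` A}"
proof (intro equalityI subsetI)
  fix p assume "p \<in> A"
  moreover from this have "p \<in> skew_space k" using assms(1) by blast
  ultimately show "p \<in> {p \<in> skew_space k. cell L' p \<in> cell L' ` A}" by blast
next
  fix p assume "p \<in> {p \<in> skew_space k. cell L' p \<in> cell L' ` A}"
  then obtain q where q: "p \<in> skew_space k" "q \<in> A" "cell L' p = cell L' q" by blast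
  then have "cell L p = cell L q" using cell_mono[OF assms(2)] by blast
  moreover have "cell L q \<in> V" using q(2) assms(1) by blast
  ultimately have "cell L p \<in> V" by simp
  then show "p \<in> A" using q(1) assms(1) by blast
qed

lemma algebra_cell_algebra: "algebra (skew_space k) (cell_algebra k)"
proof (rule algebra_iff_Un[THEN iffD2], intro conjI ballI)
  show "cell_algebra k \<subseteq> Pow (skew_space k)" by (auto simp: cell_algebra_def)
  show "{} \<in> cell_algebra k" by (auto simp: cell_algebra_def intro!: exI[of _ "{}"])
  fix A assume A: "A \<in> cell_algebra k"
  then obtain L V where LV: "A = {p \<in> skew_space k. cell L p \<in> V}" by (auto simp: cell_algebra_def)
  have "skew_space k - A = {p \<in> skew_space k. cell L p \<in> - V}" by (auto simp: LV)
  then show "skew_space k - A \<in> cell_algebra k" unfolding cell_algebra_def by blast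
  fix B assume "B \<in> cell_algebra k"
  then obtain L' V' where LV': "B = {p \<in> skew_space k. cell L' p \<in> V'}" by (auto simp: cell_algebra_def)
  define N where "N = max L L'"
  have "A = {p \<in> skew_space k. cell N p \<in> cell N ` A}" "B = {p \<in> skew_space k. cell N p \<in> cell N ` B}"
    using cell_algebra_refine[OF LV, of N] cell_algebra_refine[OF LV', of N] by (auto simp: N_def)
  then have "A \<union> B = {p \<in> skew_space k. cell N p \<in> cell N ` A \<union> cell N ` B}" by blast
  then show "A \<union> B \<in> cell_algebra k" unfolding cell_algebra_def by blast
qed

lemma sigma_cell_algebra:
  assumes f: "\<forall>i<k. circle_C1_diffeo (f i)"
  shows "sets (restrict_space borel (skew_space k)) = sigma_sets (skew_space k) (cell_algebra k)"
proof
  let ?X = "skew_space k"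
  have sub: "cell_algebra k \<subseteq> Pow ?X" by (auto simp: cell_algebra_def)
  have "cell_algebra k \<subseteq> sets (restrict_space borel ?X)" using sets_cells[OF f] by (auto simp: cell_algebra_def)
  then show "sigma_sets ?X (cell_algebra k) \<subseteq> sets (restrict_space borel ?X)"
    using sets.sigma_sets_subset[of "cell_algebra k" "restrict_space borel ?X"] by (simp add: space_restrict_space)
  have "(\<lambda>x. x) \<in> borel_measurable (sigma ?X (cell_algebra k))"
  proof (rule borel_measurableI)
    fix U :: "((int \<Rightarrow> nat) \<times> circle) set" assume U: "open U"
    define V where "V L = {v. \<forall>q\<in>?X. cell L q = v \<longrightarrow> q \<in> U}" for L
    have "?X \<inter> U = (\<Union>L. {p \<in> ?X. cell L p \<in> V L})"
    proof (intro equalityI subsetI)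
      fix p assume p: "p \<in> ?X \<inter> U"
      then obtain L W where "p \<in> W" "\<forall>q\<in>W. \<forall>q'. cell L q' = cell L q \<longrightarrow> q' \<in> U"
        using cell_neighbourhood[OF U, of p] by blast
      then have "cell L p \<in> V L" by (auto simp: V_def)
      then show "p \<in> (\<Union>L. {p \<in> ?X. cell L p \<in> V L})" using p by blast
    qed (auto simp: V_def)
    moreover have "{p \<in> ?X. cell L p \<in> V L} \<in> sigma_sets ?X (cell_algebra k)" for L
      by (rule sigma_sets.Basic) (auto simp: cell_algebra_def)
    ultimately have "?X \<inter> U \<in> sigma_sets ?X (cell_algebra k)" by (auto intro: sigma_sets.Union)
    then show "(\<lambda>x. x) -` U \<inter> space (sigma ?X (cell_algebra k)) \<in> sets (sigma ?X (cell_algebra k))"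
      using sub by (simp add: space_measure_of sets_measure_of Int_commute)
  qed
  then have "?X \<inter> S \<in> sigma_sets ?X (cell_algebra k)" if "S \<in> sets borel" for S
    using measurable_sets[of "\<lambda>x. x" "sigma ?X (cell_algebra k)" borel S] that sub
    by (simp add: space_measure_of sets_measure_of Int_commute)
  then show "sets (restrict_space borel ?X) \<subseteq> sigma_sets ?X (cell_algebra k)"
    by (auto simp: sets_restrict_space)
qed

lemma metric_entropy_le:
  assumes k: "k > 0" and f: "\<forall>i<k. circle_C1_diffeo (f i)"
    and \<mu>: "\<mu> \<in> ergodic_measures (skew_space k) (skew_product f)"
  shows "metric_entropy (skew_product f) \<mu> \<le> ereal (ln k)"
  unfolding metric_entropy_def
proof (rule SUP_least)
  let ?X = "skew_space k" and ?T = "skew_product f"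
  have prob: "prob_space \<mu>" and sp: "space \<mu> = ?X" and sets: "sets \<mu> = sets (restrict_space borel ?X)"
    and T: "?T \<in> measurable \<mu> \<mu>" and inv: "distr \<mu> \<mu> ?T = \<mu>"
    using \<mu> by (auto simp: ergodic_measures_def)
  interpret prob_space \<mu> by (rule prob)
  interpret information_space \<mu> "exp 1" by unfold_locales simp
  fix P assume "P \<in> {P. finite P \<and> P \<subseteq> sets \<mu> \<and> partition_on (space \<mu>) P}"
  then have P: "finite P" "P \<subseteq> sets \<mu>" "partition_on (space \<mu>) P" by auto
  let ?J = "\<lambda>n. dynamical_join (space \<mu>) ?T P n"
  define pt where "pt = partition_element P"
  have pt_simple: "simple_function \<mu> pt" unfolding pt_def by (intro simple_function_partition_element P)
  show "limsup (\<lambda>n. ereal (partition_entropy \<mu> (?J n) / real n)) \<le> ereal (ln k)"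
  proof (rule ereal_le_epsilon2)
    fix \<epsilon> :: real assume \<epsilon>: "\<epsilon> > 0"
    obtain d where d: "0 < d" "d < 1" "- ln (1 - d) + 2 * card P * sqrt d < \<epsilon>"
    proof -
      have "((\<lambda>d. - ln (1 - d) + 2 * card P * sqrt d) \<longlongrightarrow> - ln (1 - 0) + 2 * card P * sqrt 0) (at_right 0)"
        by (intro tendsto_intros) auto
      then have "\<forall>\<^sub>F d in at_right 0. - ln (1 - d) + 2 * card P * sqrt d < \<epsilon>"
        using \<epsilon> by (intro order_tendstoD) auto
      moreover have "\<forall>\<^sub>F d :: real in at_right 0. d > 0" "\<forall>\<^sub>F d :: real in at_right 0. d < 1"
        by (auto simp: eventually_at_right_less intro: eventually_at_right_real[of 0 1, THEN eventually_mono])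
      ultimately have "\<forall>\<^sub>F d in at_right 0. 0 < d \<and> d < 1 \<and> - ln (1 - d) + 2 * card P * sqrt d < \<epsilon>"
        by eventually_elim simp
      from eventually_happens'[OF _ this] show ?thesis using that by auto
    qed
    \<comment> \<open>Each element of \<open>P\<close> is approximated by a union of cells of one common level \<open>L\<close>.\<close>
    have "\<forall>A\<in>P. \<exists>B\<in>cell_algebra k. prob ((A - B) \<union> (B - A)) < d / (card P + 1)"
    proof
      fix A assume "A \<in> P"
      then show "\<exists>B\<in>cell_algebra k. prob ((A - B) \<union> (B - A)) < d / (card P + 1)"
        using P(2) d(1) algebra_cell_algebra[of k] sigma_cell_algebra[OF f]
        by (intro approximation_by_algebra) (auto simp: sp sets)
    qed
    then obtain B where B: "\<And>A. A \<in> P \<Longrightarrow> B A \<in> cell_algebra k"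
      "\<And>A. A \<in> P \<Longrightarrow> prob ((A - B A) \<union> (B A - A)) < d / (card P + 1)" by metis
    have "\<forall>A\<in>P. \<exists>L. B A = {p \<in> ?X. cell L p \<in> cell L ` B A}"
    proof
      fix A assume "A \<in> P"
      then obtain L V where "B A = {p \<in> ?X. cell L p \<in> V}" using B(1) unfolding cell_algebra_def by blast
      from cell_algebra_refine[OF this order_refl] show "\<exists>L. B A = {p \<in> ?X. cell L p \<in> cell L ` B A}" by (rule exI)
    qed
    from bchoice[OF this] obtain l where l: "\<forall>A\<in>P. B A = {p \<in> ?X. cell (l A) p \<in> cell (l A) ` B A}" by (rule exE)
    then have lV: "B A = {p \<in> ?X. cell (l A) p \<in> cell (l A) ` B A}" if "A \<in> P" for A using that by (rule bspec)
    define L where "L = Max (insert 0 (l ` P))"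
    have BL: "B A = {p \<in> ?X. cell L p \<in> cell L ` B A}" if "A \<in> P" for A
    proof (rule cell_algebra_refine[OF lV[OF that]])
      show "l A \<le> L" unfolding L_def using P(1) that by (intro Max_ge) auto
    qed
    \<comment> \<open>\<open>guess\<close> predicts the element of \<open>P\<close> from the cell, and \<open>Z\<close> records the points where it is wrong,
      together with the right answer.\<close>
    define guess where "guess v = (SOME A. A \<in> P \<and> v \<in> cell L ` B A)" for v
    define Z where "Z x = (if pt x = guess (cell L x) then None else Some (pt x))" for x
    have cell_simple: "simple_function \<mu> (cell L)"
      unfolding simple_function_def sp sets
    proof (intro conjI ballI)
      show "finite (cell L ` ?X)" by (rule finite_cells[OF f])
      have "cell L -` {v} \<inter> ?X = {p \<in> ?X. cell L p \<in> {v}}" for v by auto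
      then show "cell L -` {v} \<inter> ?X \<in> sets (restrict_space borel ?X)" for v
        using sets_cells[OF f, of L "{v}"] by (simp only:)
    qed
    have Z_simple: "simple_function \<mu> Z"
    proof -
      have "simple_function \<mu> ((\<lambda>(v, A). if A = guess v then None else Some A) \<circ> (\<lambda>x. (cell L x, pt x)))"
        by (intro simple_function_compose simple_function_Pair cell_simple pt_simple)
      moreover have "(\<lambda>(v, A). if A = guess v then None else Some A) \<circ> (\<lambda>x. (cell L x, pt x)) = Z"
        by (simp add: fun_eq_iff Z_def)
      ultimately show ?thesis by simp
    qed
    have rare: "{x \<in> space \<mu>. Z x \<noteq> None} \<subseteq> (\<Union>A\<in>P. (A - B A) \<union> (B A - A))"
    proof
      fix x assume "x \<in> {x \<in> space \<mu>. Z x \<noteq> None}"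
      then have x: "x \<in> space \<mu>" "pt x \<noteq> guess (cell L x)" by (auto simp: Z_def split: if_splits)
      have A: "pt x \<in> P" "x \<in> pt x" using partition_element_in[OF P(3) x(1)] by (auto simp: pt_def)
      show "x \<in> (\<Union>A\<in>P. (A - B A) \<union> (B A - A))"
      proof (rule ccontr)
        assume no: "\<not> ?thesis"
        have "A' = pt x" if "A' \<in> P \<and> cell L x \<in> cell L ` B A'" for A'
        proof -
          have "x \<in> B A'" using BL[of A'] that x(1) sp by blast
          then have "x \<in> A'" using no that by blast
          then show ?thesis using partition_element_eq[OF P(3), of A' x] that by (simp add: pt_def)
        qed
        moreover have "x \<in> B (pt x)" using no A by blast
        then have "pt x \<in> P \<and> cell L x \<in> cell L ` B (pt x)" using A(1) by blast
        ultimately have "guess (cell L x) = pt x" unfolding guess_def by (intro some_equality)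
        with x(2) show False by simp
      qed
    qed
    have Bsets: "B A \<in> sets \<mu>" if "A \<in> P" for A
      using sets_cells[OF f, of "l A" "cell (l A) ` B A"] unfolding lV[OF that, symmetric] sets .
    have "prob {x \<in> space \<mu>. Z x \<noteq> None} \<le> prob (\<Union>A\<in>P. (A - B A) \<union> (B A - A))"
      using P(1,2) Bsets by (intro finite_measure_mono[OF rare] sets.finite_UN sets.Un sets.Diff) auto
    also have "\<dots> \<le> (\<Sum>A\<in>P. prob ((A - B A) \<union> (B A - A)))"
      using P(1,2) Bsets by (intro measure_UNION_le sets.Un sets.Diff) auto
    also have "\<dots> \<le> (\<Sum>A\<in>P. d / (card P + 1))" using B(2) by (intro sum_mono less_imp_le)
    also have "\<dots> \<le> d" using d(1) by (simp add: field_simps)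
    finally have small: "prob {x \<in> space \<mu>. Z x \<noteq> None} \<le> d" .
    have "Z ` space \<mu> \<subseteq> insert None (Some ` P)"
      using partition_element_in(1)[OF P(3)] by (auto simp: Z_def pt_def)
    from entropy_rare[OF Z_simple P(1) this small d(2)] have HZ: "shannon_entropy \<mu> (Z) \<le> \<epsilon>" using d(3) by simp
    define N where "N n = k ^ (n + 2 * L) * (2 * (n * 2 ^ L) + 1)" for n
    have bound: "partition_entropy \<mu> (?J n) \<le> ln (real (N n)) + n * \<epsilon>" for n
    proof -
      let ?IP = "itinerary pt ?T n" and ?IQ = "itinerary (cell L) ?T n" and ?IZ = "itinerary Z ?T n"
      define h where "h = (\<lambda>(ls, zs). map2 (\<lambda>v z. case z of None \<Rightarrow> guess v | Some A \<Rightarrow> A) ls (zs :: ((int \<Rightarrow> nat) \<times> circle) set option list))"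
      have eq: "?IP = h \<circ> (\<lambda>x. (?IQ x, ?IZ x))"
      proof
        fix x
        show "?IP x = (h \<circ> (\<lambda>x. (?IQ x, ?IZ x))) x"
          by (rule nth_equalityI) (auto simp: h_def itinerary_def Z_def)
      qed
      have IQ: "simple_function \<mu> ?IQ" and IZ: "simple_function \<mu> ?IZ"
        by (intro simple_function_itinerary cell_simple Z_simple T)+
      have "partition_entropy \<mu> (?J n) = shannon_entropy \<mu> (?IP)"
        unfolding pt_def by (rule partition_entropy_join[OF prob P(3,1,2) T])
      also have "\<dots> \<le> shannon_entropy \<mu> (\<lambda>x. (?IQ x, ?IZ x))"
        unfolding eq by (rule entropy_data_processing[OF simple_function_Pair[OF IQ IZ]])
      also have "\<dots> \<le> shannon_entropy \<mu> (?IQ) + shannon_entropy \<mu> (?IZ)" by (rule entropy_pair_le[OF IQ IZ])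
      also have "shannon_entropy \<mu> (?IQ) \<le> log (exp 1) (real (card (?IQ ` space \<mu>)))"
        by (rule entropy_le_card[OF simple_distributedI[OF IQ measure_nonneg refl]])
      also have "\<dots> \<le> ln (real (N n))"
      proof -
        have "?IQ ` space \<mu> \<noteq> {}" using not_empty by simp
        then have "card (?IQ ` space \<mu>) > 0"
          using card_itineraries(1)[OF f, of L n] unfolding sp by (simp add: card_gt_0_iff)
        moreover have "card (?IQ ` space \<mu>) \<le> N n"
          using card_itineraries(2)[OF f, of L n] unfolding sp N_def .
        ultimately have "ln (real (card (?IQ ` space \<mu>))) \<le> ln (real (N n))" by (intro ln_mono) auto
        then show ?thesis by (simp add: log_def)
      qed
      also have "shannon_entropy \<mu> (?IZ) \<le> n * shannon_entropy \<mu> (Z)" by (rule entropy_itinerary_le[OF Z_simple T inv])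
      also have "n * shannon_entropy \<mu> (Z) \<le> n * \<epsilon>" using HZ by (intro mult_left_mono) auto
      finally show ?thesis by simp
    qed
    have "limsup (\<lambda>n. ereal (partition_entropy \<mu> (?J n) / real n))
      \<le> limsup (\<lambda>n. ereal (ln (real (N n)) / real n + \<epsilon>))"
    proof (rule Limsup_mono)
      show "\<forall>\<^sub>F n in sequentially. ereal (partition_entropy \<mu> (?J n) / real n) \<le> ereal (ln (real (N n)) / real n + \<epsilon>)"
        using eventually_gt_at_top[of 0]
      proof eventually_elim
        case (elim n)
        then show ?case using bound[of n] by (simp add: field_simps)
      qed
    qed
    also have "\<dots> = ereal (ln k + \<epsilon>)"
      using itineraries_growth[OF k, of L] unfolding N_def
      by (intro lim_imp_Limsup) (auto intro!: tendsto_intros tendsto_ereal)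
    finally show "limsup (\<lambda>n. ereal (partition_entropy \<mu> (?J n) / real n)) \<le> ereal (ln k) + ereal \<epsilon>" by simp
  qed
qed

section \<open>Hyperbolic measures of almost maximal entropy\<close>

lemma CEC_plus_cong:
  assumes "\<And>i. i < k \<Longrightarrow> f i = g i"
  shows "CEC_plus k f J = CEC_plus k g J"
proof -
  have eq: "fold f w = fold g w" if "set w \<subseteq> {..<k}" for w
    using that assms by (intro ext fold_cong) auto
  show ?thesis unfolding CEC_plus_def by (simp only: eq cong: conj_cong)
qed

lemma Acc_plus_cong:
  assumes "\<And>i. i < k \<Longrightarrow> f i = g i"
  shows "Acc_plus k f J = Acc_plus k g J"
proof -
  have eq: "fold f w = fold g w" if "set w \<subseteq> {..<k}" for w
    using that assms by (intro ext fold_cong) auto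
  show ?thesis unfolding Acc_plus_def by (simp only: eq cong: conj_cong)
qed

lemma negative_exponent_measure:
  fixes k :: nat
  assumes k: "k > 0" and f: "\<forall>i<k. circle_C1_diffeo (f i)" and J: "closed_circle_interval J"
    and cec: "CEC_minus k f J" and acc: "Acc_minus k f J" and c: "0 \<le> c" "c < ln k"
  shows "\<exists>\<mu>\<in>ergodic_neg k f. ereal c \<le> metric_entropy (skew_product f) \<mu>"
proof -
  obtain N W where N: "N > 0" and W: "finite W" "W \<noteq> {}" and cN: "c * N < ln (card W)"
    and words: "\<forall>w\<in>W. length w = N \<and> set w \<subseteq> {..<k} \<and> fold f w ` J \<subseteq> J \<and>
      (\<forall>p\<in>J. \<bar>circle_deriv (fold f w) p\<bar> \<le> 1 / 2)"
    using contracting_horseshoe[OF k f J cec acc c] by (elim exE conjE)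
  obtain \<phi> where \<phi>: "\<phi> \<in> borel_measurable (bernoulli W)"
    "\<forall>\<omega>\<in>space (bernoulli W). \<phi> (shift_seq \<omega>) = fold f (\<omega> 0) (\<phi> \<omega>) \<and> \<phi> \<omega> \<in> J"
    using attracting_section[OF f J W words[THEN bspec, THEN conjunct2]] by (rule bexE)
  have lengths: "length w = N \<and> set w \<subseteq> {..<k}" if "w \<in> W" for w
    using words[THEN bspec, OF that] by (elim conjE, intro conjI)
  have "\<exists>\<mu>\<in>ergodic_measures (skew_space k) (skew_product f).
    ereal (ln (card W) / N) \<le> metric_entropy (skew_product f) \<mu> \<and>
    integrable (bernoulli W) (\<lambda>\<omega>. ln \<bar>circle_deriv (fold f (\<omega> 0)) (\<phi> \<omega>)\<bar>) \<and>
    fiber_exponent f \<mu> = (\<integral>\<omega>. ln \<bar>circle_deriv (fold f (\<omega> 0)) (\<phi> \<omega>)\<bar> \<partial>bernoulli W) / N"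
    by (rule horseshoe_measure[OF k f N W lengths \<phi>(1) \<phi>(2)[THEN bspec, THEN conjunct1]])
  then obtain \<mu> where \<mu>: "\<mu> \<in> ergodic_measures (skew_space k) (skew_product f)"
    "ereal (ln (card W) / N) \<le> metric_entropy (skew_product f) \<mu>"
    and int: "integrable (bernoulli W) (\<lambda>\<omega>. ln \<bar>circle_deriv (fold f (\<omega> 0)) (\<phi> \<omega>)\<bar>)"
    and exponent: "fiber_exponent f \<mu> = (\<integral>\<omega>. ln \<bar>circle_deriv (fold f (\<omega> 0)) (\<phi> \<omega>)\<bar> \<partial>bernoulli W) / N"
    by (elim bexE conjE)
  interpret prob_space "bernoulli W" by (rule prob_space_bernoulli[OF W])
  have "ln \<bar>circle_deriv (fold f (\<omega> 0)) (\<phi> \<omega>)\<bar> \<le> ln (1 / 2)" if \<omega>: "\<omega> \<in> space (bernoulli W)" for \<omega>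
  proof -
    have w: "\<omega> 0 \<in> W" using \<omega> by (simp add: space_bernoulli[OF W])
    have "circle_deriv (fold f (\<omega> 0)) (\<phi> \<omega>) \<noteq> 0"
      using circle_C1_diffeo_fold[OF f] words w circle_deriv_nonzero by blast
    moreover have "\<bar>circle_deriv (fold f (\<omega> 0)) (\<phi> \<omega>)\<bar> \<le> 1 / 2" using words w \<phi>(2) \<omega> by blast
    ultimately show ?thesis by (intro ln_mono) auto
  qed
  then have "(\<integral>\<omega>. ln \<bar>circle_deriv (fold f (\<omega> 0)) (\<phi> \<omega>)\<bar> \<partial>bernoulli W) \<le> ln (1 / 2)"
    by (intro integral_le_const int AE_I2)
  also have "ln (1 / 2 :: real) < 0" by simp
  finally have "fiber_exponent f \<mu> < 0" using N by (simp add: exponent divide_neg_pos)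
  then have "\<mu> \<in> ergodic_neg k f" using \<mu>(1) by (simp add: ergodic_neg_def)
  moreover have "ereal c \<le> ereal (ln (card W) / N)" using cN N by (simp add: field_simps)
  ultimately show ?thesis using \<mu>(2) order_trans by blast
qed

lemma positive_exponent_measure:
  fixes k :: nat
  assumes k: "k > 0" and f: "\<forall>i<k. circle_C1_diffeo (f i)" and J: "closed_circle_interval J"
    and cec: "CEC_plus k f J" and acc: "Acc_plus k f J" and c: "0 \<le> c" "c < ln k"
  shows "\<exists>\<mu>\<in>ergodic_pos k f. ereal c \<le> metric_entropy (skew_product f) \<mu>"
proof -
  let ?g = "\<lambda>i. inv (f i)"
  have g: "\<forall>i<k. circle_C1_diffeo (?g i)" using f circle_C1_diffeo_inv by blast
  have inv_inv: "inv (?g i) = f i" if "i < k" for i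
    using f that circle_C1_diffeoD(4) inv_inv_eq by blast
  have "CEC_minus k ?g J" using cec CEC_plus_cong[of k "\<lambda>i. inv (?g i)" f J] inv_inv by (simp add: CEC_minus_def)
  moreover have "Acc_minus k ?g J" using acc Acc_plus_cong[of k "\<lambda>i. inv (?g i)" f J] inv_inv by (simp add: Acc_minus_def)
  ultimately have "\<exists>N V. N > 0 \<and> finite V \<and> V \<noteq> {} \<and> c * N < ln (card V) \<and>
    (\<forall>w\<in>V. length w = N \<and> set w \<subseteq> {..<k} \<and> fold ?g w ` J \<subseteq> J \<and>
      (\<forall>p\<in>J. \<bar>circle_deriv (fold ?g w) p\<bar> \<le> 1 / 2))"
    by (rule contracting_horseshoe[OF k g J _ _ c])
  then obtain N V where N: "N > 0" and V: "finite V" "V \<noteq> {}" and cN: "c * N < ln (card V)"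
    and words: "\<forall>w\<in>V. length w = N \<and> set w \<subseteq> {..<k} \<and> fold ?g w ` J \<subseteq> J \<and>
      (\<forall>p\<in>J. \<bar>circle_deriv (fold ?g w) p\<bar> \<le> 1 / 2)"
    by (elim exE conjE)
  define W where "W = rev ` V"
  have W: "finite W" "W \<noteq> {}" using V by (auto simp: W_def)
  have card: "card W = card V" unfolding W_def by (rule card_image) simp
  have rev_words: "length w = N \<and> set w \<subseteq> {..<k}" if wW: "w \<in> W" for w
  proof -
    obtain v where v: "v \<in> V" "w = rev v" using wW by (auto simp: W_def)
    then show ?thesis using words[THEN bspec, OF v(1)] by simp
  qed
  obtain \<phi> where \<phi>: "\<phi> \<in> borel_measurable (bernoulli W)"
    "\<forall>\<omega>\<in>space (bernoulli W). \<phi> (shift_seq \<omega>) = fold f (\<omega> 0) (\<phi> \<omega>) \<and> 2 \<le> \<bar>circle_deriv (fold f (\<omega> 0)) (\<phi> \<omega>)\<bar>"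
    using repelling_section[OF f J V words[THEN bspec, THEN conjunct2]] unfolding W_def by (rule bexE)
  have "\<exists>\<mu>\<in>ergodic_measures (skew_space k) (skew_product f).
    ereal (ln (card W) / N) \<le> metric_entropy (skew_product f) \<mu> \<and>
    integrable (bernoulli W) (\<lambda>\<omega>. ln \<bar>circle_deriv (fold f (\<omega> 0)) (\<phi> \<omega>)\<bar>) \<and>
    fiber_exponent f \<mu> = (\<integral>\<omega>. ln \<bar>circle_deriv (fold f (\<omega> 0)) (\<phi> \<omega>)\<bar> \<partial>bernoulli W) / N"
    by (rule horseshoe_measure[OF k f N W rev_words \<phi>(1) \<phi>(2)[THEN bspec, THEN conjunct1]])
  then obtain \<mu> where \<mu>: "\<mu> \<in> ergodic_measures (skew_space k) (skew_product f)"
    "ereal (ln (card W) / N) \<le> metric_entropy (skew_product f) \<mu>"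
    and int: "integrable (bernoulli W) (\<lambda>\<omega>. ln \<bar>circle_deriv (fold f (\<omega> 0)) (\<phi> \<omega>)\<bar>)"
    and exponent: "fiber_exponent f \<mu> = (\<integral>\<omega>. ln \<bar>circle_deriv (fold f (\<omega> 0)) (\<phi> \<omega>)\<bar> \<partial>bernoulli W) / N"
    by (elim bexE conjE)
  interpret prob_space "bernoulli W" by (rule prob_space_bernoulli[OF W])
  have "ln 2 \<le> ln \<bar>circle_deriv (fold f (\<omega> 0)) (\<phi> \<omega>)\<bar>" if \<omega>: "\<omega> \<in> space (bernoulli W)" for \<omega>
    using \<phi>(2) \<omega> by (intro ln_mono) auto
  then have "ln 2 \<le> (\<integral>\<omega>. ln \<bar>circle_deriv (fold f (\<omega> 0)) (\<phi> \<omega>)\<bar> \<partial>bernoulli W)"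
    by (intro integral_ge_const int AE_I2)
  moreover have "0 < ln (2 :: real)" by simp
  ultimately have "0 < (\<integral>\<omega>. ln \<bar>circle_deriv (fold f (\<omega> 0)) (\<phi> \<omega>)\<bar> \<partial>bernoulli W)" by linarith
  then have "fiber_exponent f \<mu> > 0" using N by (simp add: exponent)
  then have "\<mu> \<in> ergodic_pos k f" using \<mu>(1) by (simp add: ergodic_pos_def)
  moreover have "ereal c \<le> ereal (ln (card W) / N)" using cN N by (simp add: card field_simps)
  ultimately show ?thesis using \<mu>(2) order_trans by blast
qed

text \<open>A class of ergodic measures with entropies arbitrarily close to \<open>ln k\<close> has \<open>ln k\<close> as supremum, since no
  ergodic measure exceeds it.\<close>

lemma SUP_entropy_eq:
  fixes k :: nat and \<M> :: "((int \<Rightarrow> nat) \<times> circle) measure set"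
  assumes k: "k \<ge> 2" and f: "\<forall>i<k. circle_C1_diffeo (f i)"
    and sub: "\<M> \<subseteq> ergodic_measures (skew_space k) (skew_product f)"
    and approx: "\<And>c. 0 \<le> c \<Longrightarrow> c < ln k \<Longrightarrow> \<exists>\<mu>\<in>\<M>. ereal c \<le> metric_entropy (skew_product f) \<mu>"
  shows "(SUP \<mu>\<in>\<M>. metric_entropy (skew_product f) \<mu>) = ereal (ln k)"
proof (rule antisym)
  show "(SUP \<mu>\<in>\<M>. metric_entropy (skew_product f) \<mu>) \<le> ereal (ln k)"
    using k sub by (intro SUP_least metric_entropy_le[OF _ f]) auto
  show "ereal (ln k) \<le> (SUP \<mu>\<in>\<M>. metric_entropy (skew_product f) \<mu>)"
  proof (rule dense_le)
    fix z assume z: "z < ereal (ln k)"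
    show "z \<le> (SUP \<mu>\<in>\<M>. metric_entropy (skew_product f) \<mu>)"
    proof (cases z)
      case (real r)
      have "max r 0 < ln k" using z real k by simp
      then obtain \<mu> where \<mu>: "\<mu> \<in> \<M>" "ereal (max r 0) \<le> metric_entropy (skew_product f) \<mu>"
        using approx[of "max r 0"] by auto
      have "z \<le> ereal (max r 0)" using real by simp
      also have "\<dots> \<le> metric_entropy (skew_product f) \<mu>" by (rule \<mu>(2))
      also have "\<dots> \<le> (SUP \<mu>\<in>\<M>. metric_entropy (skew_product f) \<mu>)" using \<mu>(1) by (rule SUP_upper)
      finally show ?thesis .
    qed (use z in auto)
  qed
qed

theorem theorem3:
  fixes k :: nat and f :: "nat \<Rightarrow> circle \<Rightarrow> circle"
  assumes "k \<ge> 2"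
    and "\<forall>i<k. circle_C1_diffeo (f i)"
    and "transitive_on (skew_space k) (skew_product f)"
    and "axioms_CEC_Acc k f"
  shows "topological_entropy (skew_space k) (skew_product f)
           = (SUP \<mu>\<in>ergodic_neg k f. metric_entropy (skew_product f) \<mu>)
       \<and> (SUP \<mu>\<in>ergodic_neg k f. metric_entropy (skew_product f) \<mu>)
           = (SUP \<mu>\<in>ergodic_pos k f. metric_entropy (skew_product f) \<mu>)"
proof -
  have k: "k > 0" using assms(1) by simp
  obtain J where J: "closed_circle_interval J" "CEC_plus k f J" "CEC_minus k f J" "Acc_plus k f J" "Acc_minus k f J"
    using assms(4) unfolding axioms_CEC_Acc_def by blast
  have "topological_entropy (skew_space k) (skew_product f) = ereal (ln k)"
    by (rule antisym[OF topological_entropy_le[OF k assms(2)] topological_entropy_ge[OF k]])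
  moreover have "(SUP \<mu>\<in>ergodic_neg k f. metric_entropy (skew_product f) \<mu>) = ereal (ln k)"
    using negative_exponent_measure[OF k assms(2) J(1,3,5)]
    by (intro SUP_entropy_eq assms(1,2)) (auto simp: ergodic_neg_def)
  moreover have "(SUP \<mu>\<in>ergodic_pos k f. metric_entropy (skew_product f) \<mu>) = ereal (ln k)"
    using positive_exponent_measure[OF k assms(2) J(1,2,4)]
    by (intro SUP_entropy_eq assms(1,2)) (auto simp: ergodic_pos_def)
  ultimately show ?thesis by simp
qed

end
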